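(* Let $(k,l)\in\{(0,2),(-1,-2)\}$. Let $Q_1=(C,\boldsymbol{x})$ be a symmetric quiver with $m$ nodes, let $n$ of its nodes $v_1,\dots,v_n$ be chosen, and let $\{Q_i\}_{i\in\mathbb{Z}_+}$ be a sequence of quivers that grows from $Q_1$ by $(k,l)$-splitting of these $n$ nodes, with all spectator shifts equal to $0$ (in every iteration). Let $Q_\infty=\bigcup_{i=1}^\infty Q_i$. Let $Q_1^+$ be the augmented quiver consisting of $Q_1$ and one extra node, with index $0$ and generating parameter $x_0$, where: - if $(k,l)=(0,2)$: $C_{00}=1$, $C_{0v_a}=1$ for $a=1,\dots,n$, $C_{0s}=0$ for every other node $s$ of $Q_1$; the multiplicative factor of the splittings is $\kappa=q^{-1}x_0$; - if $(k,l)=(-1,-2)$: $C_{00}=0$, $C_{0v_a}=-1$ for $a=1,\dots,n$, $C_{0s}=0$ for every other node $s$ of $Q_1$; the multiplicative factor of the splittings is $\kappa=x_0$. Then the spectrum of BPS states (motivic Donaldson--Thomas invariants) of $Q_\infty$ equals the spectrum of $Q_1^+$ minus the single state coming from the extra node. That is, as formal series in $x_0,x_1,\dots,x_m$ with coefficients depending on $q$, $$\Omega_{Q_\infty}=\Omega_{Q_1^+}-\omega_0,$$ where $\omega_0$ is the contribution of the extra node taken alone, i.e. $\omega_0=q\,x_0$ if $(k,l)=(0,2)$ and $\omega_0=-x_0$ if $(k,l)=(-1,-2)$.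
   Context: A symmetric quiver $Q=(C,\boldsymbol{x})$ is given by a symmetric integer matrix $C$ (negative entries allowed) whose rows are indexed by the nodes, together with a vector $\boldsymbol{x}$ assigning to each node $i$ a generating parameter $x_i$. Here the generating parameters of $Q_1$ are independent variables $x_1,\dots,x_m$, and $x_0$ is a further independent variable. Motivic generating series: with $(\xi;q^2)_d=\prod_{j=0}^{d-1}(1-\xi q^{2j})$, $$P_Q=\sum_{\boldsymbol d}(-q)^{\sum_{i,j}C_{ij}d_id_j}\prod_i\frac{x_i^{d_i}}{(q^2;q^2)_{d_i}},$$ the sum being over finitely supported vectors $\boldsymbol d$ of non-negative integers indexed by the nodes (this also covers the infinite quiver $Q_\infty$, for which each monomial in $x_0,\dots,x_m$ receives finitely many contributions). Donaldson--Thomas invariants (counting BPS states): when the generating parameters are monomials in $x_0,\dots,x_m$ times powers of $q$, the series $\Omega_Q=\sum_{\boldsymbol d\neq 0,\,s}\Omega_{\boldsymbol d,s}\,x_0^{d_0}\cdots x_m^{d_m}q^s$ is defined by $P_Q=\prod_{\boldsymbol d\ne 0}\prod_{s\in\mathbb Z}\big(x_0^{d_0}\cdots x_m^{d_m}q^s;q^2\big)_\infty^{\Omega_{\boldsymbol d,s}}$. $(k,l)$-splitting. Data: a quiver $(C,\boldsymbol x)$, $n$ ordered chosen nodes $v_1,\dots,v_n$, a permutation $\sigma\in S_n$, an integer shift $h_s$ for every remaining node $s$ (called a spectator), and a multiplicative factor $\kappa$. The result has the old nodes, with all mutual entries of $C$ and all parameters unchanged, and $n$ new nodes $v_1',\dots,v_n'$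 with parameters $x_{v_a'}=\kappa x_{v_a}$ and symmetric entries $C_{s v_a'}=C_{sv_a}+h_s$; $C_{v_av_a'}=C_{v_av_a}+k$; $C_{v_a'v_b'}=C_{v_av_b}+l$ (including $a=b$); and for $a<b$: if $\sigma(a)<\sigma(b)$ then $C_{v_av_b'}=C_{v_av_b}+k$, $C_{v_a'v_b}=C_{v_av_b}+k+1$; if $\sigma(a)>\sigma(b)$ then $C_{v_av_b'}=C_{v_av_b}+k+1$, $C_{v_a'v_b}=C_{v_av_b}+k$. Growth by $(k,l)$-splitting: $Q_2$ is obtained from $Q_1$ by $(k,l)$-splitting of the chosen $n$ nodes; for $i\ge2$, $Q_{i+1}$ is obtained from $Q_i$ by $(k,l)$-splitting of the $n$ nodes created in the previous step (all other nodes being spectators), with the same $\kappa$ in every step. Thus $Q_1\subset Q_2\subset\cdots$. *)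

theory Defs
  imports
    "HOL-Analysis.Analysis"
    "HOL-Library.Poly_Mapping"
    "HOL-Combinatorics.Permutations"
    "HOL-Computational_Algebra.Formal_Laurent_Series"
begin

section \<open>Formal power series in several variables\<close>

text \<open>
  Formal power series with coefficients in \<^typ>\<open>'b\<close>, in commuting variables indexed by
  \<^typ>\<open>'a\<close>. A monomial is given by its finitely supported vector of exponents.
\<close>

typedef ('a, 'b) mps = "UNIV :: (('a \<Rightarrow>\<^sub>0 nat) \<Rightarrow> 'b) set"
  morphisms mps_coeff Abs_mps
  by simp

setup_lifting type_definition_mps

lemma mps_eqI: "(\<And>e. mps_coeff f e = mps_coeff g e) \<Longrightarrow> f = g"
  by (metis ext mps_coeff_inject)

lemma mps_eq_iff: "f = g \<longleftrightarrow> (\<forall>e. mps_coeff f e = mps_coeff g e)"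
  by (auto intro: mps_eqI)

lemma mps_coeff_Abs [simp]: "mps_coeff (Abs_mps c) = c"
  by (simp add: Abs_mps_inverse)

lemma finite_exponents_below: "finite {a. \<exists>b. a + b = (e :: 'a \<Rightarrow>\<^sub>0 nat)}"
proof -
  have "a \<in> Abs_poly_mapping ` (\<lambda>g v. if v \<in> Poly_Mapping.keys e then g v else 0) `
      (PiE (Poly_Mapping.keys e) (\<lambda>v. {..Poly_Mapping.lookup e v}))" if "a + b = e" for a b
  proof -
    have le: "Poly_Mapping.lookup a v \<le> Poly_Mapping.lookup e v" for v
      using that by (metis le_add1 lookup_add)
    have zero: "Poly_Mapping.lookup a v = 0" if "v \<notin> Poly_Mapping.keys e" for v
      using le[of v] that by (simp add: in_keys_iff)
    have eq: "(\<lambda>v. if v \<in> Poly_Mapping.keys e then restrict (Poly_Mapping.lookup a) (Poly_Mapping.keys e) v else 0) = Poly_Mapping.lookup a"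
      using zero by auto
    have "restrict (Poly_Mapping.lookup a) (Poly_Mapping.keys e) \<in> PiE (Poly_Mapping.keys e) (\<lambda>v. {..Poly_Mapping.lookup e v})"
      using le by auto
    moreover have "a = Abs_poly_mapping
        (\<lambda>v. if v \<in> Poly_Mapping.keys e then restrict (Poly_Mapping.lookup a) (Poly_Mapping.keys e) v else 0)"
      unfolding eq by (simp add: lookup_inverse)
    ultimately show ?thesis by blast
  qed
  hence "{a. \<exists>b. a + b = e} \<subseteq>
      Abs_poly_mapping ` (\<lambda>g v. if v \<in> Poly_Mapping.keys e then g v else 0) `
      (PiE (Poly_Mapping.keys e) (\<lambda>v. {..Poly_Mapping.lookup e v}))"
    by blast
  thus ?thesis
    by (rule finite_subset) (intro finite_imageI finite_PiE; simp)
qed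

lemma finite_antidiagonal: "finite {(a, b). a + b = (e :: 'a \<Rightarrow>\<^sub>0 nat)}"
proof -
  have "{(a, b). a + b = e} \<subseteq> {a. \<exists>b. a + b = e} \<times> {a. \<exists>b. a + b = e}"
    by (auto, metis add.commute)
  thus ?thesis
    by (rule finite_subset) (simp add: finite_exponents_below)
qed

instantiation mps :: (type, zero) zero
begin
lift_definition zero_mps :: "('a, 'b) mps" is "\<lambda>_. 0" .
instance ..
end

instantiation mps :: (type, "{zero, one}") one
begin
lift_definition one_mps :: "('a, 'b) mps" is "\<lambda>e. if e = 0 then 1 else 0" .
instance ..
end

instantiation mps :: (type, plus) plus
begin
lift_definition plus_mps :: "('a, 'b) mps \<Rightarrow> ('a, 'b) mps \<Rightarrow> ('a, 'b) mps"
  is "\<lambda>f g e. f e + g e" .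
instance ..
end

instantiation mps :: (type, minus) minus
begin
lift_definition minus_mps :: "('a, 'b) mps \<Rightarrow> ('a, 'b) mps \<Rightarrow> ('a, 'b) mps"
  is "\<lambda>f g e. f e - g e" .
instance ..
end

instantiation mps :: (type, uminus) uminus
begin
lift_definition uminus_mps :: "('a, 'b) mps \<Rightarrow> ('a, 'b) mps"
  is "\<lambda>f e. - f e" .
instance ..
end

instantiation mps :: (type, "{comm_monoid_add, times}") times
begin
lift_definition times_mps :: "('a, 'b) mps \<Rightarrow> ('a, 'b) mps \<Rightarrow> ('a, 'b) mps"
  is "\<lambda>f g e. \<Sum>(a, b)\<in>{(a, b). a + b = e}. f a * g b" .
instance ..
end

lemmas mps_coeff_zero [simp] = zero_mps.rep_eq
lemmas mps_coeff_one = one_mps.rep_eq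
lemmas mps_coeff_plus [simp] = plus_mps.rep_eq
lemmas mps_coeff_minus [simp] = minus_mps.rep_eq
lemmas mps_coeff_uminus [simp] = uminus_mps.rep_eq
lemmas mps_coeff_times = times_mps.rep_eq

instance mps :: (type, comm_ring_1) comm_ring_1
proof
  fix f g h :: "('a, 'b) mps"
  show "f + g + h = f + (g + h)" "f + g = g + f" "0 + f = f" "- f + f = 0" "f - g = f + - g"
    by (rule mps_eqI; simp add: algebra_simps)+
  show "(0 :: ('a, 'b) mps) \<noteq> 1"
    by (auto simp: mps_eq_iff mps_coeff_one)
  show "f * g = g * f"
    by (rule mps_eqI, unfold mps_coeff_times,
        rule sum.reindex_bij_witness[where i = prod.swap and j = prod.swap])
      (auto simp: add.commute mult.commute)
  show "(f + g) * h = f * h + g * h"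
    by (rule mps_eqI) (simp add: mps_coeff_times split_def algebra_simps sum.distrib)
  show "1 * f = f"
  proof (rule mps_eqI)
    fix e
    have "mps_coeff (1 * f) e = (\<Sum>p\<in>{(0 :: 'a \<Rightarrow>\<^sub>0 nat, e)}. mps_coeff 1 (fst p) * mps_coeff f (snd p))"
      unfolding mps_coeff_times split_def
      by (rule sum.mono_neutral_right)
        (auto simp: finite_antidiagonal[unfolded split_def] mps_coeff_one)
    thus "mps_coeff (1 * f) e = mps_coeff f e"
      by (simp add: mps_coeff_one)
  qed
  show "f * g * h = f * (g * h)"
  proof (rule mps_eqI)
    fix e :: "'a \<Rightarrow>\<^sub>0 nat"
    let ?D = "\<lambda>e :: 'a \<Rightarrow>\<^sub>0 nat. {(a, b). a + b = e}"
    have "mps_coeff (f * g * h) e =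
        (\<Sum>p\<in>?D e. \<Sum>r\<in>?D (fst p).
          mps_coeff f (fst r) * mps_coeff g (snd r) * mps_coeff h (snd p))"
      by (simp add: mps_coeff_times split_def sum_distrib_right)
    also have "\<dots> = (\<Sum>(p, r)\<in>Sigma (?D e) (\<lambda>p. ?D (fst p)).
          mps_coeff f (fst r) * mps_coeff g (snd r) * mps_coeff h (snd p))"
      by (rule sum.Sigma) (auto simp: finite_antidiagonal)
    also have "\<dots> = (\<Sum>(p, r)\<in>Sigma (?D e) (\<lambda>p. ?D (snd p)).
          mps_coeff f (fst p) * (mps_coeff g (fst r) * mps_coeff h (snd r)))"
      by (rule sum.reindex_bij_witness[where
            i = "\<lambda>((a, _), (b, c)). ((a + b, c), (a, b))" and
            j = "\<lambda>((_, c), (a, b)). ((a, b + c), (b, c))"])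
        (auto simp: add.assoc mult.assoc)
    also have "\<dots> = (\<Sum>p\<in>?D e. \<Sum>r\<in>?D (snd p).
          mps_coeff f (fst p) * (mps_coeff g (fst r) * mps_coeff h (snd r)))"
      by (rule sum.Sigma[symmetric]) (auto simp: finite_antidiagonal)
    also have "\<dots> = mps_coeff (f * (g * h)) e"
      by (simp add: mps_coeff_times split_def sum_distrib_left)
    finally show "mps_coeff (f * g * h) e = mps_coeff (f * (g * h)) e" .
  qed
qed

instantiation mps :: (type, comm_ring_1) inverse
begin
definition inverse_mps :: "('a, 'b) mps \<Rightarrow> ('a, 'b) mps" where
  "inverse (f :: ('a, 'b) mps) = (if \<exists>g. f * g = 1 then THE g. f * g = 1 else 0)"
definition divide_mps :: "('a, 'b) mps \<Rightarrow> ('a, 'b) mps \<Rightarrow> ('a, 'b) mps" where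
  "f div g = f * inverse (g :: ('a, 'b) mps)"
instance ..
end

lemma mps_inverse_unique:
  fixes f g :: "('a, 'b :: comm_ring_1) mps"
  assumes "f * g = 1"
  shows "inverse f = g"
proof -
  have unique: "g' = g" if "f * g' = 1" for g'
  proof -
    have "g' = (f * g) * g'"
      by (simp add: assms)
    also have "\<dots> = (f * g') * g"
      by (simp only: ac_simps)
    finally show ?thesis
      by (simp add: that)
  qed
  have "(THE g. f * g = 1) = g"
    using assms unique by (rule the_equality)
  thus ?thesis
    using assms by (auto simp: inverse_mps_def)
qed

text \<open>
  Convergence of series is coefficientwise: this is the product topology, where for coefficients
  in \<^typ>\<open>'c fls\<close> the library topology on \<^typ>\<open>'c fls\<close> is the \<open>q\<close>-adic one.
\<close>

instantiation mps :: (type, topological_space) topological_space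
begin
definition open_mps :: "('a, 'b) mps set \<Rightarrow> bool" where
  "open_mps U \<longleftrightarrow> open (mps_coeff ` U)"
instance
proof
  have inj: "inj (mps_coeff :: ('a, 'b) mps \<Rightarrow> _)"
    by (simp add: inj_def mps_coeff_inject)
  have "range (mps_coeff :: ('a, 'b) mps \<Rightarrow> _) = UNIV"
    by (metis mps_coeff_Abs surjI)
  thus "open (UNIV :: ('a, 'b) mps set)"
    by (simp add: open_mps_def)
  show "open (S \<inter> T)" if "open S" "open T" for S T :: "('a, 'b) mps set"
    using that by (simp add: open_mps_def image_Int[OF inj] open_Int)
  show "open (\<Union>K)" if "\<forall>S\<in>K. open S" for K :: "('a, 'b) mps set set"
    using that by (auto simp: open_mps_def image_Union)
qed
end

lemma open_vimage_mps_coeff: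
  assumes "open U"
  shows "open ((\<lambda>f. mps_coeff f e) -` U)"
proof -
  have "c \<in> mps_coeff ` ((\<lambda>f. mps_coeff f e) -` U)" if "c e \<in> U" for c
    using that by (intro image_eqI[of _ _ "Abs_mps c"]) simp_all
  hence "mps_coeff ` ((\<lambda>f. mps_coeff f e) -` U) = (\<lambda>c. c e) -` U"
    by auto
  moreover have "open ((\<lambda>c. c e) -` U)"
    by (rule open_vimage[OF assms continuous_on_product_coordinates])
  ultimately show ?thesis
    by (simp add: open_mps_def)
qed

instance mps :: (type, t2_space) t2_space
proof
  fix f g :: "('a, 'b) mps"
  assume "f \<noteq> g"
  then obtain e where "mps_coeff f e \<noteq> mps_coeff g e"
    by (auto simp: mps_eq_iff)
  then obtain U V where "open U" "open V" "mps_coeff f e \<in> U" "mps_coeff g e \<in> V" "U \<inter> V = {}"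
    using hausdorff by meson
  thus "\<exists>U V. open U \<and> open V \<and> f \<in> U \<and> g \<in> V \<and> U \<inter> V = {}"
    by (intro exI[of _ "(\<lambda>f. mps_coeff f e) -` U"] exI[of _ "(\<lambda>f. mps_coeff f e) -` V"])
      (auto intro: open_vimage_mps_coeff)
qed

lemma tendsto_mps_iff:
  fixes f :: "'c \<Rightarrow> ('a, 'b :: topological_space) mps"
  shows
  "(f \<longlongrightarrow> l) F \<longleftrightarrow> (\<forall>e. ((\<lambda>x. mps_coeff (f x) e) \<longlongrightarrow> mps_coeff l e) F)"
    (is "?L \<longleftrightarrow> ?R")
proof
  assume L: ?L
  show ?R
    unfolding tendsto_def
  proof safe
    fix e and S :: "'b set" assume "open S" "mps_coeff l e \<in> S"
    with topological_tendstoD[OF L open_vimage_mps_coeff[of S e]]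
    show "\<forall>\<^sub>F x in F. mps_coeff (f x) e \<in> S" by simp
  qed
next
  assume R: ?R
  have lim: "((\<lambda>x. mps_coeff (f x)) \<longlongrightarrow> mps_coeff l) F"
    using R limitin_componentwise[of "\<lambda>_. euclidean" UNIV "\<lambda>x. mps_coeff (f x)" "mps_coeff l" F]
    by (simp add: euclidean_product_topology)
  show ?L
    unfolding tendsto_def
  proof safe
    fix S assume "open S" "l \<in> S"
    hence "\<forall>\<^sub>F x in F. mps_coeff (f x) \<in> mps_coeff ` S"
      using lim by (auto simp: open_mps_def tendsto_def)
    thus "\<forall>\<^sub>F x in F. f x \<in> S"
      by (rule eventually_mono) (auto simp: mps_coeff_inject)
  qed
qed

definition mps_monom :: "('a \<Rightarrow>\<^sub>0 nat) \<Rightarrow> 'b :: zero \<Rightarrow> ('a, 'b) mps" where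
  "mps_monom e c = Abs_mps (\<lambda>e'. if e' = e then c else 0)"

abbreviation mps_const :: "'b :: zero \<Rightarrow> ('a, 'b) mps" where
  "mps_const \<equiv> mps_monom 0"

definition mps_var :: "'a \<Rightarrow> ('a, 'b :: zero_neq_one) mps" where
  "mps_var i = mps_monom (Poly_Mapping.single i 1) 1"

text \<open>The \<open>p\<close>-Pochhammer symbols \<open>(\<xi>;p)\<^sub>d\<close> and \<open>(\<xi>;p)\<^sub>\<infinity>\<close>.\<close>

definition qpochhammer :: "'a :: comm_ring_1 \<Rightarrow> 'a \<Rightarrow> nat \<Rightarrow> 'a" where
  "qpochhammer \<xi> p d = (\<Prod>j<d. 1 - \<xi> * p ^ j)"

definition qpochhammer_inf :: "'a :: {comm_ring_1, t2_space} \<Rightarrow> 'a \<Rightarrow> 'a" where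
  "qpochhammer_inf \<xi> p = lim (\<lambda>d. qpochhammer \<xi> p d)"


section \<open>Symmetric quivers\<close>

text \<open>
  Series in the variables \<open>x\<^sub>0, x\<^sub>1, \<dots>\<close> whose coefficients are Laurent series in \<open>q\<close>;
  \<open>q\<close> itself is \<^term>\<open>fls_X\<close>.
\<close>

type_synonym series = "(nat, rat fls) mps"

record 'v quiver =
  nodes :: "'v set"
  adj :: "'v \<Rightarrow> 'v \<Rightarrow> int"
  gpar :: "'v \<Rightarrow> series"

definition symmetric_quiver :: "'v quiver \<Rightarrow> bool" where
  "symmetric_quiver Q \<longleftrightarrow> (\<forall>i\<in>nodes Q. \<forall>j\<in>nodes Q. adj Q i j = adj Q j i)"

definition motivic_series :: "'v quiver \<Rightarrow> series" where
  "motivic_series Q =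
    (\<Sum>\<^sub>\<infinity>d\<in>{d :: 'v \<Rightarrow>\<^sub>0 nat. Poly_Mapping.keys d \<subseteq> nodes Q}.
      mps_const ((- fls_X) powi
        (\<Sum>i\<in>Poly_Mapping.keys d. \<Sum>j\<in>Poly_Mapping.keys d.
          adj Q i j * int (Poly_Mapping.lookup d i) * int (Poly_Mapping.lookup d j))) *
      (\<Prod>i\<in>Poly_Mapping.keys d. gpar Q i ^ Poly_Mapping.lookup d i *
        mps_const (inverse (qpochhammer (fls_X\<^sup>2) (fls_X\<^sup>2) (Poly_Mapping.lookup d i)))))"

text \<open>
  The family \<open>\<Omega>\<^bsub>d,s\<^esub>\<close> is stored as the series \<open>\<Sum> \<Omega>\<^bsub>d,s\<^esub> x\<^sup>d q\<^sup>s\<close> with integer coefficients, so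
  that \<open>\<Omega>\<^bsub>d,s\<^esub>\<close> is the coefficient at \<open>q\<^sup>s\<close> of the coefficient at \<open>x\<^sup>d\<close>. The infinite product is
  the (unordered) limit of its finite subproducts. For every \<^term>\<open>P\<close> with integer coefficients
  and constant term 1 there is exactly one such series: modulo the factors of lower degree, the
  coefficient of the product at \<open>x\<^sup>d\<close> is \<open>- (\<Sum>s. \<Omega>\<^bsub>d,s\<^esub> q\<^sup>s) / (1 - q\<^sup>2)\<close>.
\<close>

definition has_DT_series :: "series \<Rightarrow> (nat, int fls) mps \<Rightarrow> bool" where
  "has_DT_series P \<Omega> \<longleftrightarrow>
    mps_coeff \<Omega> 0 = 0 \<and>
    ((\<lambda>F. \<Prod>(d, s)\<in>F.
        qpochhammer_inf (mps_monom d (fls_X powi s)) (mps_const (fls_X\<^sup>2))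
          powi (fls_nth (mps_coeff \<Omega> d) s))
      \<longlongrightarrow> P) (finite_subsets_at_top {(d, s). d \<noteq> 0})"

definition DT_series :: "'v quiver \<Rightarrow> (nat, int fls) mps" where
  "DT_series Q = (THE \<Omega>. has_DT_series (motivic_series Q) \<Omega>)"


section \<open>Splitting of nodes\<close>

text \<open>
  \<open>Q'\<close> arises from \<open>Q\<close> by \<open>(k,l)\<close>-splitting of the nodes \<open>v 1, \<dots>, v n\<close> with permutation \<open>\<sigma>\<close>,
  spectator shifts \<open>h\<close> and multiplicative factor \<open>\<kappa>\<close>; the new nodes are \<open>v' 1, \<dots>, v' n\<close>.
  The entries not listed are determined by symmetry of \<open>Q'\<close>.
\<close>

definition is_splitting ::
  "int \<Rightarrow> int \<Rightarrow> nat \<Rightarrow> series \<Rightarrow> (nat \<Rightarrow> nat) \<Rightarrow> ('v \<Rightarrow> int) \<Rightarrow>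
    'v quiver \<Rightarrow> (nat \<Rightarrow> 'v) \<Rightarrow> 'v quiver \<Rightarrow> (nat \<Rightarrow> 'v) \<Rightarrow> bool" where
  "is_splitting k l n \<kappa> \<sigma> h Q v Q' v' \<longleftrightarrow>
    \<sigma> permutes {1..n} \<and>
    inj_on v {1..n} \<and> v ` {1..n} \<subseteq> nodes Q \<and>
    inj_on v' {1..n} \<and> v' ` {1..n} \<inter> nodes Q = {} \<and>
    nodes Q' = nodes Q \<union> v' ` {1..n} \<and>
    symmetric_quiver Q' \<and>
    (\<forall>i\<in>nodes Q. \<forall>j\<in>nodes Q. adj Q' i j = adj Q i j) \<and>
    (\<forall>i\<in>nodes Q. gpar Q' i = gpar Q i) \<and>
    (\<forall>a\<in>{1..n}. gpar Q' (v' a) = \<kappa> * gpar Q (v a)) \<and>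
    (\<forall>s\<in>nodes Q - v ` {1..n}. \<forall>a\<in>{1..n}. adj Q' s (v' a) = adj Q s (v a) + h s) \<and>
    (\<forall>a\<in>{1..n}. adj Q' (v a) (v' a) = adj Q (v a) (v a) + k) \<and>
    (\<forall>a\<in>{1..n}. \<forall>b\<in>{1..n}. adj Q' (v' a) (v' b) = adj Q (v a) (v b) + l) \<and>
    (\<forall>a\<in>{1..n}. \<forall>b\<in>{1..n}. a < b \<longrightarrow>
      (if \<sigma> a < \<sigma> b
       then adj Q' (v a) (v' b) = adj Q (v a) (v b) + k \<and>
            adj Q' (v' a) (v b) = adj Q (v a) (v b) + k + 1
       else adj Q' (v a) (v' b) = adj Q (v a) (v b) + k + 1 \<and>
            adj Q' (v' a) (v b) = adj Q (v a) (v b) + k))"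

text \<open>
  The quivers are \<open>Q 1, Q 2, \<dots>\<close>; the value \<open>Q 0\<close> plays no role. \<open>w i 1, \<dots>, w i n\<close> are the nodes
  of \<open>Q i\<close> that are split in the \<open>i\<close>-th step. Each step has its own permutation and its own
  spectator shifts.
\<close>

definition grows_by_splitting ::
  "int \<Rightarrow> int \<Rightarrow> nat \<Rightarrow> series \<Rightarrow> (nat \<Rightarrow> 'v \<Rightarrow> int) \<Rightarrow> (nat \<Rightarrow> 'v) \<Rightarrow>
    (nat \<Rightarrow> 'v quiver) \<Rightarrow> bool" where
  "grows_by_splitting k l n \<kappa> h v Q \<longleftrightarrow>
    (\<exists>w \<sigma>. w 1 = v \<and>
      (\<forall>i\<ge>1. is_splitting k l n \<kappa> (\<sigma> i) (h i) (Q i) (w i) (Q (Suc i)) (w (Suc i))))"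

text \<open>The union of an increasing sequence \<open>Q 1 \<subseteq> Q 2 \<subseteq> \<dots>\<close> of quivers.\<close>

definition quiver_Union :: "(nat \<Rightarrow> 'v quiver) \<Rightarrow> 'v quiver" where
  "quiver_Union Q =
    \<lparr>nodes = (\<Union>i\<in>{1..}. nodes (Q i)),
     adj = (\<lambda>s t. adj (Q (LEAST i. i \<ge> 1 \<and> s \<in> nodes (Q i) \<and> t \<in> nodes (Q i))) s t),
     gpar = (\<lambda>s. gpar (Q (LEAST i. i \<ge> 1 \<and> s \<in> nodes (Q i))) s)\<rparr>"

text \<open>
  \<open>Q\<close> with an additional node \<open>z\<close>, where \<open>c\<close> is the entry at \<open>(z,z)\<close>, \<open>r s\<close> is the entry at
  \<open>(z,s)\<close> and \<open>(s,z)\<close>, and \<open>x\<close> is the generating parameter of \<open>z\<close>.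
\<close>

definition add_node :: "'v \<Rightarrow> int \<Rightarrow> ('v \<Rightarrow> int) \<Rightarrow> series \<Rightarrow> 'v quiver \<Rightarrow> 'v quiver" where
  "add_node z c r x Q =
    \<lparr>nodes = insert z (nodes Q),
     adj = (\<lambda>s t. if s = z then (if t = z then c else r t)
                  else if t = z then r s else adj Q s t),
     gpar = (gpar Q)(z := x)\<rparr>"

end

theory Submission
  imports Defs
begin

text \<open>
  Write \<open>p = q\<^sup>2\<close>, \<open>\<epsilon> = 1 + 2k\<close> (so \<open>l = 2\<epsilon>\<close>) and \<open>P = p\<^sup>\<epsilon>\<close>. Grouping the vectors of a split quiver by the
  total multiplicity of each pair (chosen node, copy), the \<open>q\<close>-Vandermonde identity turns the
  motivic series of the split quiver, weighted by a function \<open>g\<close> of the total multiplicity of the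
  copies, into the series of the original quiver, weighted by
  \<open>(T g)(N) = (\<Sum>M. [N choose M]\<^sub>P P\<^bsup>M\<^sup>2\<^esup> \<kappa>\<^sup>M g(M))\<close>. The permutation only fixes the order in which the
  Vandermonde identity is iterated, so it drops out. Adding the extra node to \<open>Q\<^sub>1\<close> weights its series by
  \<open>A(N) = E(P\<^sup>N x\<^sub>0)\<close>, where \<open>E\<close> is, up to scaling its argument, one of Euler's two \<open>q\<close>-exponentials. Their functional equation
  gives \<open>T A = A\<close>, and \<open>T\<close> raises the \<open>x\<^sub>0\<close>-order of functions vanishing at \<open>0\<close>, so the iterates of
  \<open>T\<close> on the constant \<open>1\<close> tend to \<open>A / A(0)\<close>. Hence the series of \<open>Q\<^sub>1\<^sup>+\<close> is \<open>A(0)\<close> times that of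
  \<open>Q\<^sub>\<infinity>\<close>, and \<open>A(0)\<close> is the factor with Donaldson--Thomas series \<open>\<omega>\<^sub>0\<close>.
\<close>

section \<open>Coefficientwise convergence\<close>


text \<open>One splitting gives no recursion for the motivic series alone, since only the copies are
  split again; carrying a weight that depends on their total multiplicity closes the recursion. This
  rests on the zero spectator shifts, on a copy-copy shift l that is the same for all pairs, and on
  {k, k + 1} = {0, \<epsilon>}: of the two mixed shifts of a pair one vanishes and the other is
  \<epsilon>. The factor \<kappa> is tuned to the extra node: in both cases A(N) = (1 - P^(N+1)
  \<kappa>) A(N+1). \<open>DT_series\<close> is a definite description, so existence and uniqueness
  of the exponents are part of the work. Uniqueness compares terms of lowest degree. Existence is
  shown for Q_1^+, whose series has integral coefficients and constant term 1, and carries over to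
  Q_\<infinity> upon division by A(0). Limits are taken coefficientwise in x and q-adically in each
  coefficient; because negative powers of q occur, convergence of the infinite product needs a bound
  on the poles that is uniform over the divisors of a monomial.\<close>

definition fls_ord_ge :: "int \<Rightarrow> 'a :: zero fls \<Rightarrow> bool" where
  "fls_ord_ge m f \<longleftrightarrow> (\<forall>r<m. fls_nth f r = 0)"

lemma fls_ord_ge_iff_subdegree: "f \<noteq> 0 \<Longrightarrow> fls_ord_ge m f \<longleftrightarrow> m \<le> fls_subdegree f"
  unfolding fls_ord_ge_def
  by (metis fls_eq0_below_subdegree linorder_not_less nth_fls_subdegree_nonzero order_less_le_trans)

lemma fls_ord_ge_mono: "fls_ord_ge m f \<Longrightarrow> n \<le> m \<Longrightarrow> fls_ord_ge n f"
  by (auto simp: fls_ord_ge_def)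

lemma fls_ord_ge_0 [simp]: "fls_ord_ge m 0"
  by (simp add: fls_ord_ge_def)

lemma fls_ord_ge_add: "fls_ord_ge m f \<Longrightarrow> fls_ord_ge m g \<Longrightarrow> fls_ord_ge m (f + g)"
  for f :: "'a :: monoid_add fls"
  by (simp add: fls_ord_ge_def)

lemma fls_ord_ge_sum: "(\<And>x. x \<in> A \<Longrightarrow> fls_ord_ge m (f x)) \<Longrightarrow> fls_ord_ge m (\<Sum>x\<in>A. f x)"
  for f :: "'x \<Rightarrow> 'a :: comm_monoid_add fls"
  by (induction A rule: infinite_finite_induct) (auto intro: fls_ord_ge_add)

lemma fls_ord_ge_mult:
  fixes f g :: "'a :: semiring_0 fls"
  assumes "fls_ord_ge m f" "fls_ord_ge n g"
  shows "fls_ord_ge (m + n) (f * g)"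
proof (cases "f = 0 \<or> g = 0")
  case False
  have "m \<le> fls_subdegree f" "n \<le> fls_subdegree g"
    using assms False by (auto simp: fls_ord_ge_iff_subdegree)
  then show ?thesis
    by (auto simp: fls_ord_ge_def intro: fls_times_nth_eq0)
qed auto

text \<open>For a \<noteq> b the distance is 2^(-s) with s the subdegree of a - b, also when s is
  negative; strictness makes the condition s \<ge> n + 1.\<close>

lemma dist_fls_less_iff:
  "dist a b < inverse (2 ^ n) \<longleftrightarrow> fls_ord_ge (int n + 1) (a - b)" for a b :: "'a :: group_add fls"
proof (cases "a = b")
  case False
  define s where "s = fls_subdegree (a - b)"
  have "fls_ord_ge (int n + 1) (a - b) \<longleftrightarrow> s \<ge> int n + 1"
    using False unfolding s_def by (intro fls_ord_ge_iff_subdegree) simp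
  moreover have "dist a b < inverse (2 ^ n) \<longleftrightarrow> s \<ge> int n + 1"
  proof (cases "s \<ge> 0")
    case True
    have "inverse (2 ^ nat s) < inverse (2 ^ n :: real) \<longleftrightarrow> n < nat s"
      by (subst inverse_less_iff_less) auto
    thus ?thesis using True False by (auto simp: dist_fls_def s_def)
  next
    case neg: False
    have "inverse (2 ^ n :: real) \<le> 1" "(1::real) \<le> 2 ^ nat (- s)"
      by (simp_all add: inverse_le_1_iff)
    hence "\<not> 2 ^ nat (- s) < inverse (2 ^ n :: real)" by linarith
    thus ?thesis using neg False by (auto simp: dist_fls_def s_def)
  qed
  ultimately show ?thesis by simp
qed simp

lemma tendsto_fls_iff:
  fixes f :: "'x \<Rightarrow> 'a :: group_add fls"
  shows "(f \<longlongrightarrow> l) F \<longleftrightarrow> (\<forall>N. eventually (\<lambda>x. fls_ord_ge N (f x - l)) F)"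
proof
  assume L: "(f \<longlongrightarrow> l) F"
  show "\<forall>N. eventually (\<lambda>x. fls_ord_ge N (f x - l)) F"
  proof
    fix N
    have "eventually (\<lambda>x. dist (f x) l < inverse (2 ^ nat N)) F"
      using L by (auto simp: tendsto_iff)
    thus "eventually (\<lambda>x. fls_ord_ge N (f x - l)) F"
      by (rule eventually_mono) (auto simp: dist_fls_less_iff elim!: fls_ord_ge_mono)
  qed
next
  assume R: "\<forall>N. eventually (\<lambda>x. fls_ord_ge N (f x - l)) F"
  show "(f \<longlongrightarrow> l) F"
    unfolding tendsto_iff
  proof (intro allI impI)
    fix e :: real assume "e > 0"
    then obtain n where n: "inverse (2 ^ n) < e"
      using real_arch_pow_inv[of e "1/2"] by (auto simp: power_one_over inverse_eq_divide)
    have "eventually (\<lambda>x. fls_ord_ge (int n + 1) (f x - l)) F"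
      using R by blast
    thus "eventually (\<lambda>x. dist (f x) l < e) F"
      by (rule eventually_mono) (use n in \<open>auto simp flip: dist_fls_less_iff\<close>)
  qed
qed

lemma tendsto_fls_mult:
  fixes f g :: "'x \<Rightarrow> 'a :: ring fls"
  assumes "(f \<longlongrightarrow> a) F" "(g \<longlongrightarrow> b) F"
  shows "((\<lambda>x. f x * g x) \<longlongrightarrow> a * b) F"
  unfolding tendsto_fls_iff
proof
  fix N
  define m where "m = min 0 (fls_subdegree a)"
  define n where "n = min 0 (fls_subdegree b)"
  have a: "fls_ord_ge m a" and b: "fls_ord_ge n b"
    by (auto simp: m_def n_def fls_ord_ge_def)
  \<comment> \<open>The difference of the products is split as (f - a) g + a (g - b). The maximum
    with 0 gives \<open>g x - b\<close> order at least 0 \<ge> n, so \<open>g x\<close> inherits the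
    pole bound n of \<open>b\<close>.\<close>
  have "eventually (\<lambda>x. fls_ord_ge (N - n) (f x - a)) F" "eventually (\<lambda>x. fls_ord_ge (max 0 (N - m)) (g x - b)) F"
    using assms by (auto simp: tendsto_fls_iff)
  thus "eventually (\<lambda>x. fls_ord_ge N (f x * g x - a * b)) F"
  proof eventually_elim
    case (elim x)
    have "fls_ord_ge n (g x - b)"
      by (rule fls_ord_ge_mono[OF elim(2)]) (auto simp: n_def)
    hence g: "fls_ord_ge n (g x)"
      using fls_ord_ge_add[OF _ b] by fastforce
    have "fls_ord_ge (N - n + n) ((f x - a) * g x)"
      by (rule fls_ord_ge_mult[OF elim(1) g])
    moreover have "fls_ord_ge (m + max 0 (N - m)) (a * (g x - b))"
      by (rule fls_ord_ge_mult[OF a elim(2)])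
    ultimately have "fls_ord_ge N ((f x - a) * g x + a * (g x - b))"
      by (intro fls_ord_ge_add) (auto elim: fls_ord_ge_mono)
    thus ?case by (simp add: algebra_simps)
  qed
qed

lemma tendsto_fls_sum:
  fixes f :: "'y \<Rightarrow> 'x \<Rightarrow> 'a :: ab_group_add fls"
  assumes "\<And>i. i \<in> I \<Longrightarrow> (f i \<longlongrightarrow> a i) F"
  shows "((\<lambda>x. \<Sum>i\<in>I. f i x) \<longlongrightarrow> (\<Sum>i\<in>I. a i)) F"
proof (cases "finite I")
  case True
  show ?thesis
    unfolding tendsto_fls_iff
  proof
    fix N
    have "eventually (\<lambda>x. \<forall>i\<in>I. fls_ord_ge N (f i x - a i)) F"
      using True assms by (intro eventually_ball_finite) (auto simp: tendsto_fls_iff)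
    thus "eventually (\<lambda>x. fls_ord_ge N ((\<Sum>i\<in>I. f i x) - (\<Sum>i\<in>I. a i))) F"
      by eventually_elim (auto simp flip: sum_subtractf intro: fls_ord_ge_sum)
  qed
qed simp

lemma tendsto_mps_mult:
  fixes f g :: "'x \<Rightarrow> ('v, 'a :: comm_ring_1 fls) mps"
  assumes "(f \<longlongrightarrow> a) F" "(g \<longlongrightarrow> b) F"
  shows "((\<lambda>x. f x * g x) \<longlongrightarrow> a * b) F"
  using assms by (auto simp: tendsto_mps_iff mps_coeff_times split_def
      intro!: tendsto_fls_sum tendsto_fls_mult)

text \<open>Completeness: on a nontrivial filter the approximations \<open>c M\<close> and
  \<open>c N\<close> agree wherever both are binding, so coefficient k of the limit can be read from
  \<open>c (k + 1)\<close>, the first one that determines it.\<close>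

lemma convergent_flsI:
  fixes f :: "'x \<Rightarrow> 'a :: ab_group_add fls"
  assumes "F \<noteq> bot" "\<And>N. \<exists>c. eventually (\<lambda>x. fls_ord_ge N (f x - c)) F"
  shows "\<exists>l. (f \<longlongrightarrow> l) F"
proof -
  obtain c where c: "\<And>N. eventually (\<lambda>x. fls_ord_ge N (f x - c N)) F"
    using assms(2) by metis
  have eq: "fls_nth (c M) k = fls_nth (c N) k" if "k < M" "k < N" for M N k
  proof -
    have "eventually (\<lambda>x. fls_nth (c M) k = fls_nth (c N) k) F"
      using c[of M] c[of N] by eventually_elim (use that in \<open>auto simp: fls_ord_ge_def\<close>)
    thus ?thesis using assms(1) by (simp add: eventually_const_iff)
  qed
  define l where "l = Abs_fls (\<lambda>k. fls_nth (c (k + 1)) k)"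
  \<comment> \<open>The coefficients at negative exponents are already determined by
    \<open>c 0\<close>, which bounds the pole of the limit.\<close>
  have "fls_nth (c (k + 1)) k = 0" if "k < min 0 (fls_subdegree (c 0))" for k
    using that eq[of k "k + 1" 0] by auto
  hence nth_l: "fls_nth l k = fls_nth (c (k + 1)) k" for k
    unfolding l_def by (subst nth_Abs_fls_lower_bound[where N = "min 0 (fls_subdegree (c 0))"]) auto
  have "(f \<longlongrightarrow> l) F"
    unfolding tendsto_fls_iff
  proof
    fix N
    show "eventually (\<lambda>x. fls_ord_ge N (f x - l)) F"
      using c[of N] by eventually_elim (auto simp: fls_ord_ge_def nth_l eq[of _ "_ + 1" N])
  qed
  thus ?thesis ..
qed

lemma convergent_mpsI:
  fixes f :: "'x \<Rightarrow> ('v, 'a :: ab_group_add fls) mps"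
  assumes "F \<noteq> bot" "\<And>e N. \<exists>c. eventually (\<lambda>x. fls_ord_ge N (mps_coeff (f x) e - c)) F"
  shows "\<exists>l. (f \<longlongrightarrow> l) F"
proof -
  have "\<forall>e. \<exists>c. ((\<lambda>x. mps_coeff (f x) e) \<longlongrightarrow> c) F"
    by (intro allI convergent_flsI assms)
  then obtain c where "\<And>e. ((\<lambda>x. mps_coeff (f x) e) \<longlongrightarrow> c e) F"
    by metis
  hence "(f \<longlongrightarrow> Abs_mps c) F"
    by (simp add: tendsto_mps_iff)
  thus ?thesis ..
qed

section \<open>Order and substitution\<close>

definition pm_deg :: "('a \<Rightarrow>\<^sub>0 nat) \<Rightarrow> nat" where
  "pm_deg e = (\<Sum>i\<in>Poly_Mapping.keys e. Poly_Mapping.lookup e i)"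

lemma pm_deg_superset:
  "finite S \<Longrightarrow> Poly_Mapping.keys e \<subseteq> S \<Longrightarrow> pm_deg e = (\<Sum>i\<in>S. Poly_Mapping.lookup e i)"
  unfolding pm_deg_def by (rule sum.mono_neutral_left) (auto simp: in_keys_iff)

lemma pm_deg_0 [simp]: "pm_deg 0 = 0"
  by (simp add: pm_deg_def)

lemma pm_deg_plus [simp]: "pm_deg (d + e) = pm_deg d + pm_deg e"
proof -
  let ?S = "Poly_Mapping.keys d \<union> Poly_Mapping.keys e"
  have "pm_deg (d + e) = (\<Sum>i\<in>?S. Poly_Mapping.lookup (d + e) i)"
    by (rule pm_deg_superset) (use keys_add[of d e] in auto)
  thus ?thesis
    by (simp add: lookup_add sum.distrib pm_deg_superset[of ?S])
qed

lemma pm_deg_single [simp]: "pm_deg (Poly_Mapping.single i n) = n"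
  by (simp add: pm_deg_def)

lemma pm_deg_eq_0_iff [simp]: "pm_deg e = 0 \<longleftrightarrow> e = 0"
  by (auto simp: pm_deg_def in_keys_iff intro!: poly_mapping_eqI)

lemma mps_coeff_monom: "mps_coeff (mps_monom d c) e = (if e = d then c else 0)"
  by (simp add: mps_monom_def)

lemma mps_coeff_sum: "mps_coeff (\<Sum>x\<in>A. f x) e = (\<Sum>x\<in>A. mps_coeff (f x) e)"
  for f :: "_ \<Rightarrow> ('a, 'b :: comm_ring_1) mps"
  by (induction A rule: infinite_finite_induct) auto

lemma mps_coeff_monom_mult:
  fixes c :: "'b :: comm_ring_1"
  shows "mps_coeff (mps_monom d c * f) (d + e) = c * mps_coeff f e"
proof -
  have "mps_coeff (mps_monom d c * f) (d + e) =
      (\<Sum>p\<in>{(d, e)}. mps_coeff (mps_monom d c) (fst p) * mps_coeff f (snd p))"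
    unfolding mps_coeff_times split_def
    by (rule sum.mono_neutral_right)
      (auto simp: finite_antidiagonal[unfolded split_def] mps_coeff_monom)
  thus ?thesis by (simp add: mps_coeff_monom)
qed

lemma mps_coeff_const_mult [simp]:
  "mps_coeff (mps_const c * f) e = c * mps_coeff f e" for c :: "'b :: comm_ring_1"
  using mps_coeff_monom_mult[of 0 c f e] by simp

lemma mps_coeff_monom_mult_eq_0:
  fixes c :: "'b :: comm_ring_1"
  assumes "\<And>b. e \<noteq> d + b"
  shows "mps_coeff (mps_monom d c * f) e = 0"
  unfolding mps_coeff_times by (rule sum.neutral) (use assms in \<open>auto simp: mps_coeff_monom\<close>)

lemma mps_monom_mult:
  "mps_monom d a * mps_monom e b = mps_monom (d + e) (a * b)" for a b :: "'b :: comm_ring_1"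
proof (rule mps_eqI)
  fix r
  show "mps_coeff (mps_monom d a * mps_monom e b) r = mps_coeff (mps_monom (d + e) (a * b)) r"
  proof (cases "\<exists>s. r = d + s")
    case True
    then obtain s where "r = d + s" ..
    thus ?thesis by (simp add: mps_coeff_monom_mult) (simp add: mps_coeff_monom)
  next
    case False
    thus ?thesis by (subst mps_coeff_monom_mult_eq_0) (auto simp: mps_coeff_monom)
  qed
qed

lemma mps_const_1 [simp]: "mps_const 1 = 1"
  by (rule mps_eqI) (simp add: mps_coeff_monom mps_coeff_one)

lemma mps_const_0 [simp]: "mps_const 0 = 0"
  by (rule mps_eqI) (simp add: mps_coeff_monom)

lemma mps_const_mult: "mps_const (a * b) = mps_const a * mps_const b" for a b :: "'b :: comm_ring_1"
  by (simp add: mps_monom_mult)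

lemma mps_const_add: "mps_const (a + b) = mps_const a + mps_const b" for a b :: "'b :: comm_ring_1"
  by (rule mps_eqI) (simp add: mps_coeff_monom)

lemma mps_const_diff: "mps_const (a - b) = mps_const a - mps_const b" for a b :: "'b :: comm_ring_1"
  by (rule mps_eqI) (simp add: mps_coeff_monom)

lemma mps_const_power: "mps_const (a ^ n) = mps_const a ^ n" for a :: "'b :: comm_ring_1"
  by (induction n) (simp_all add: mps_const_mult)

lemma mps_const_prod: "mps_const (\<Prod>x\<in>A. f x) = (\<Prod>x\<in>A. mps_const (f x))"
  for f :: "_ \<Rightarrow> 'b :: comm_ring_1"
  by (induction A rule: infinite_finite_induct) (simp_all add: mps_const_mult)

definition mps_ord_ge :: "nat \<Rightarrow> ('a, 'b :: zero) mps \<Rightarrow> bool" where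
  "mps_ord_ge n f \<longleftrightarrow> (\<forall>e. pm_deg e < n \<longrightarrow> mps_coeff f e = 0)"

lemma mps_ord_ge_0 [simp]: "mps_ord_ge 0 f"
  by (simp add: mps_ord_ge_def)

lemma mps_ord_ge_zero [simp]: "mps_ord_ge n 0"
  by (simp add: mps_ord_ge_def)

lemma mps_ord_ge_mono: "mps_ord_ge m f \<Longrightarrow> n \<le> m \<Longrightarrow> mps_ord_ge n f"
  by (auto simp: mps_ord_ge_def)

lemma mps_ord_ge_add: "mps_ord_ge n f \<Longrightarrow> mps_ord_ge n g \<Longrightarrow> mps_ord_ge n (f + g)"
  for f :: "('a, 'b :: monoid_add) mps"
  by (simp add: mps_ord_ge_def)

lemma mps_ord_ge_diff: "mps_ord_ge n f \<Longrightarrow> mps_ord_ge n g \<Longrightarrow> mps_ord_ge n (f - g)"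
  for f :: "('a, 'b :: group_add) mps"
  by (simp add: mps_ord_ge_def)

lemma mps_ord_ge_mult:
  fixes f g :: "('a, 'b :: comm_ring_1) mps"
  assumes "mps_ord_ge m f" "mps_ord_ge n g"
  shows "mps_ord_ge (m + n) (f * g)"
  unfolding mps_ord_ge_def
proof (intro allI impI)
  fix e :: "'a \<Rightarrow>\<^sub>0 nat" assume e: "pm_deg e < m + n"
  show "mps_coeff (f * g) e = 0"
    unfolding mps_coeff_times
  proof (rule sum.neutral, safe)
    fix a b assume "e = a + b"
    hence "pm_deg a < m \<or> pm_deg b < n" using e by auto
    thus "mps_coeff f a * mps_coeff g b = 0"
      using assms by (auto simp: mps_ord_ge_def)
  qed
qed

lemma mps_ord_ge_mult_left: "mps_ord_ge n g \<Longrightarrow> mps_ord_ge n (f * g)"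
  for f g :: "('a, 'b :: comm_ring_1) mps"
  using mps_ord_ge_mult[of 0 f n g] by simp

lemma mps_ord_ge_sum: "(\<And>x. x \<in> A \<Longrightarrow> mps_ord_ge n (f x)) \<Longrightarrow> mps_ord_ge n (\<Sum>x\<in>A. f x)"
  for f :: "_ \<Rightarrow> ('a, 'b :: comm_ring_1) mps"
  by (simp add: mps_ord_ge_def mps_coeff_sum)

lemma mps_ord_ge_power: "mps_ord_ge 1 f \<Longrightarrow> mps_ord_ge n (f ^ n)"
  for f :: "('a, 'b :: comm_ring_1) mps"
  by (induction n) (use mps_ord_ge_mult[of 1 f] in force)+

lemma mps_eqI_ord:
  fixes f g :: "('a, 'b :: comm_ring_1) mps"
  assumes "\<And>n. mps_ord_ge (Suc n) (f - g)"
  shows "f = g"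
  by (rule mps_eqI) (use assms in \<open>auto simp: mps_ord_ge_def\<close>)

definition mps_powser :: "(nat \<Rightarrow> 'b) \<Rightarrow> ('a, 'b :: comm_ring_1) mps \<Rightarrow> ('a, 'b) mps" where
  "mps_powser c x = Abs_mps (\<lambda>e. \<Sum>j\<le>pm_deg e. c j * mps_coeff (x ^ j) e)"

lemma mps_powser_truncate:
  fixes x :: "('a, 'b :: comm_ring_1) mps"
  assumes "mps_ord_ge 1 x"
  shows "mps_ord_ge (Suc n) (mps_powser c x - (\<Sum>j\<le>n. mps_const (c j) * x ^ j))"
  unfolding mps_ord_ge_def
proof (intro allI impI)
  fix e :: "'a \<Rightarrow>\<^sub>0 nat" assume e: "pm_deg e < Suc n"
  have "(\<Sum>j\<le>pm_deg e. c j * mps_coeff (x ^ j) e) = (\<Sum>j\<le>n. c j * mps_coeff (x ^ j) e)"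
    by (rule sum.mono_neutral_left)
      (use e mps_ord_ge_power[OF assms] in \<open>auto simp: mps_ord_ge_def\<close>)
  thus "mps_coeff (mps_powser c x - (\<Sum>j\<le>n. mps_const (c j) * x ^ j)) e = 0"
    by (simp add: mps_powser_def mps_coeff_sum)
qed

lemma mps_powser_scale: "mps_powser (\<lambda>j. c j * y ^ j) x = mps_powser c (mps_const y * x)"
  by (simp add: mps_powser_def power_mult_distrib mult.assoc flip: mps_const_power)

text \<open>The recursion for c' is multiplication of the generating series by 1 - t. On partial
  sums the two sides differ only by the boundary term c(n) x^(n+1), whose order is too high to
  matter.\<close>

lemma mps_powser_linear_mult:
  assumes x: "mps_ord_ge 1 x" and c': "c' 0 = c 0" "\<And>j. c' (Suc j) = c (Suc j) - c j"
  shows "mps_powser c' x = (1 - x) * mps_powser c x"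
proof (rule mps_eqI_ord)
  fix n
  let ?S = "\<lambda>c n. \<Sum>j\<le>n. mps_const (c j) * x ^ j"
  have S: "?S c' n = (1 - x) * ?S c n + x ^ Suc n * mps_const (c n)"
    by (induction n) (simp_all add: c' mps_const_diff algebra_simps)
  have "mps_ord_ge (Suc n) ((mps_powser c' x - ?S c' n) -
      (1 - x) * (mps_powser c x - ?S c n) + mps_const (c n) * x ^ Suc n)"
    by (intro mps_ord_ge_add mps_ord_ge_diff mps_ord_ge_mult_left mps_powser_truncate
        mps_ord_ge_power x)
  thus "mps_ord_ge (Suc n) (mps_powser c' x - (1 - x) * mps_powser c x)"
    unfolding S by (simp add: algebra_simps)
qed

section \<open>Euler's \<open>q\<close>-exponentials\<close>

definition inv_qfact :: "nat \<Rightarrow> rat fls" where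
  "inv_qfact j = inverse (qpochhammer (fls_X\<^sup>2) (fls_X\<^sup>2) j)"

lemma fls_X_power_neq_1: "n > 0 \<Longrightarrow> (fls_X ^ n :: rat fls) \<noteq> 1"
proof
  assume "n > 0" "(fls_X ^ n :: rat fls) = 1"
  hence "fls_nth (fls_X ^ n :: rat fls) 0 = 1" by simp
  with \<open>n > 0\<close> show False by (simp add: fls_X_power_nth)
qed

lemma inv_qfact_0 [simp]: "inv_qfact 0 = 1"
  by (simp add: inv_qfact_def qpochhammer_def)

lemma inv_qfact_Suc: "(1 - (fls_X\<^sup>2) ^ Suc j) * inv_qfact (Suc j) = inv_qfact j"
proof -
  have "(fls_X\<^sup>2) ^ Suc j \<noteq> (1 :: rat fls)"
    using fls_X_power_neq_1[of "2 * Suc j"] unfolding power_mult by simp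
  hence nz: "1 - (fls_X\<^sup>2) ^ Suc j \<noteq> (0 :: rat fls)"
    by simp
  have "qpochhammer (fls_X\<^sup>2) (fls_X\<^sup>2) (Suc j) =
      (1 - (fls_X\<^sup>2) ^ Suc j) * (qpochhammer (fls_X\<^sup>2) (fls_X\<^sup>2) j :: rat fls)"
    by (simp add: qpochhammer_def)
  thus ?thesis
    using nz by (simp only: inv_qfact_def
        inverse_mult_distrib mult.assoc[symmetric] right_inverse[OF nz] mult_1_left)
qed

text \<open>By Euler's identities, for x without constant term, \<open>euler_E x\<close> is
  (x;q^2)_\<infinity> and \<open>euler_e x\<close> its inverse. As power series they have functional
  equations that are mere recursions of coefficients.\<close>

definition euler_E :: "('a, rat fls) mps \<Rightarrow> ('a, rat fls) mps" where
  "euler_E = mps_powser (\<lambda>j. (-1) ^ j * fls_X ^ (j * (j - 1)) * inv_qfact j)"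

definition euler_e :: "('a, rat fls) mps \<Rightarrow> ('a, rat fls) mps" where
  "euler_e = mps_powser inv_qfact"

lemma euler_E_rec:
  assumes "mps_ord_ge 1 x"
  shows "euler_E x = (1 - x) * euler_E (mps_const (fls_X\<^sup>2) * x)"
  unfolding euler_E_def mps_powser_scale[symmetric]
proof (rule mps_powser_linear_mult[OF assms])
  fix j
  \<comment> \<open>The comparison of coefficients with its factors as indeterminates: M is
    q^(j(j+1)), a is 1/(q^2;q^2)_(j+1), k is q^(2(j+1)), m is q^(j(j-1)), b is 1/(q^2;q^2)_j, n is
    q^(2j), and s is the sign.\<close>
  have *: "- 1 * s * M * a = - 1 * s * M * a * k - s * m * b * n" if "M * a = M * a * k + m * n * b"
    for s M a k m n b :: "rat fls"
    using that by algebra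
  have "inv_qfact j = inv_qfact (Suc j) - (fls_X\<^sup>2) ^ Suc j * inv_qfact (Suc j)"
    using inv_qfact_Suc[of j] by (simp add: algebra_simps)
  moreover have "Suc j * j = j * (j - 1) + 2 * j"
    by (cases j) simp_all
  hence "fls_X ^ (Suc j * j) = fls_X ^ (j * (j - 1)) * (fls_X\<^sup>2 :: rat fls) ^ j"
    by (simp only: power_add power_mult)
  ultimately have eq: "fls_X ^ (Suc j * j) * inv_qfact (Suc j) =
      fls_X ^ (Suc j * j) * inv_qfact (Suc j) * (fls_X\<^sup>2) ^ Suc j + fls_X ^ (j * (j - 1)) * (fls_X\<^sup>2) ^ j * inv_qfact j"
    by (simp only: ring_distribs) (simp only: mult_ac add_diff_cancel_left' diff_add_cancel add_diff_eq)
  show "(- 1) ^ Suc j * fls_X ^ (Suc j * (Suc j - 1)) * inv_qfact (Suc j) =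
      (- 1) ^ Suc j * fls_X ^ (Suc j * (Suc j - 1)) * inv_qfact (Suc j) * (fls_X\<^sup>2) ^ Suc j -
      (- 1) ^ j * fls_X ^ (j * (j - 1)) * inv_qfact j * (fls_X\<^sup>2) ^ j"
    unfolding power_Suc[of "-1"] diff_Suc_1 by (rule *[OF eq])
qed simp

lemma euler_e_rec:
  assumes "mps_ord_ge 1 x"
  shows "euler_e (mps_const (fls_X\<^sup>2) * x) = (1 - x) * euler_e x"
  unfolding euler_e_def mps_powser_scale[symmetric]
proof (rule mps_powser_linear_mult[OF assms])
  fix j
  show "inv_qfact (Suc j) * (fls_X\<^sup>2) ^ Suc j = inv_qfact (Suc j) - inv_qfact j"
    unfolding inv_qfact_Suc[of j, symmetric] by (simp add: algebra_simps)
qed simp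

lemma mps_ord_ge_scale: "mps_ord_ge n x \<Longrightarrow> mps_ord_ge n (mps_const y * x)"
  for y :: "'b :: comm_ring_1"
  by (rule mps_ord_ge_mult_left)

lemma qpochhammer_Suc: "qpochhammer x y (Suc n) = qpochhammer x y n * (1 - x * y ^ n)"
  by (simp add: qpochhammer_def)

lemma qpochhammer_mult_euler_Eer_e:
  assumes "mps_ord_ge 1 x"
  shows "qpochhammer x (mps_const (fls_X\<^sup>2)) n * euler_e x = euler_e (mps_const ((fls_X\<^sup>2) ^ n) * x)"
proof (induction n)
  case (Suc n)
  have "euler_e (mps_const ((fls_X\<^sup>2) ^ Suc n) * x) = euler_e (mps_const (fls_X\<^sup>2) * (mps_const ((fls_X\<^sup>2) ^ n) * x))"
    by (simp add: mps_const_mult mult.assoc)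
  also have "\<dots> = (1 - mps_const ((fls_X\<^sup>2) ^ n) * x) * euler_e (mps_const ((fls_X\<^sup>2) ^ n) * x)"
    by (intro euler_e_rec mps_ord_ge_scale assms)
  finally show ?case
    unfolding Suc.IH[symmetric] by (simp add: qpochhammer_Suc mps_const_power mult_ac)
qed (simp add: qpochhammer_def)

lemma qpochhammer_mult_euler_E:
  assumes "mps_ord_ge 1 x"
  shows "qpochhammer x (mps_const (fls_X\<^sup>2)) n * euler_E (mps_const ((fls_X\<^sup>2) ^ n) * x) = euler_E x"
proof (induction n)
  case (Suc n)
  have "euler_E (mps_const ((fls_X\<^sup>2) ^ n) * x) =
      (1 - mps_const ((fls_X\<^sup>2) ^ n) * x) * euler_E (mps_const (fls_X\<^sup>2) * (mps_const ((fls_X\<^sup>2) ^ n) * x))"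
    by (intro euler_E_rec mps_ord_ge_scale assms)
  thus ?case
    by (subst Suc.IH[symmetric]) (simp add: qpochhammer_Suc mps_const_power mps_const_mult mult_ac)
qed (simp add: qpochhammer_def)

lemma tendsto_mps_powser_scale:
  fixes c :: "nat \<Rightarrow> rat fls"
  assumes "c 0 = 1"
  shows "(\<lambda>n. mps_powser c (mps_const ((fls_X\<^sup>2) ^ n) * x)) \<longlonglongrightarrow> 1"
  unfolding tendsto_mps_iff
proof
  fix e
  have "(\<lambda>n. \<Sum>j\<le>pm_deg e. c j * ((fls_X\<^sup>2) ^ n) ^ j * mps_coeff (x ^ j) e)
      \<longlonglongrightarrow> (\<Sum>j\<le>pm_deg e. if j = 0 then mps_coeff 1 e else 0)"
  proof (rule tendsto_fls_sum)
    fix j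
    have "(\<lambda>n. ((fls_X\<^sup>2) ^ n) ^ j :: rat fls) \<longlonglongrightarrow> (if j = 0 then 1 else 0)"
    proof (cases "j = 0")
      case False
      show ?thesis
        unfolding tendsto_fls_iff
      proof
        fix N
        show "\<forall>\<^sub>F n in sequentially. fls_ord_ge N (((fls_X\<^sup>2) ^ n) ^ j - (if j = 0 then 1 else 0 :: rat fls))"
          using eventually_ge_at_top[of "nat N"]
        proof eventually_elim
          case (elim n)
          have "n \<le> 2 * n * j" using False by (cases j) auto
          hence "N \<le> int (2 * n * j)" using elim by linarith
          thus ?case
            using False by (auto simp: fls_ord_ge_def fls_X_power_nth simp flip: power_mult)
        qed
      qed
    qed simp
    hence "(\<lambda>n. c j * ((fls_X\<^sup>2) ^ n) ^ j * mps_coeff (x ^ j) e)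
        \<longlonglongrightarrow> c j * (if j = 0 then 1 else 0) * mps_coeff (x ^ j) e"
      by (intro tendsto_fls_mult tendsto_const)
    thus "(\<lambda>n. c j * ((fls_X\<^sup>2) ^ n) ^ j * mps_coeff (x ^ j) e)
        \<longlonglongrightarrow> (if j = 0 then mps_coeff 1 e else 0)"
      by (cases "j = 0") (simp_all add: assms)
  qed
  thus "(\<lambda>n. mps_coeff (mps_powser c (mps_const ((fls_X\<^sup>2) ^ n) * x)) e) \<longlonglongrightarrow> mps_coeff 1 e"
    by (simp add: mps_powser_scale[symmetric]) (simp add: mps_powser_def)
qed

text \<open>Both functional equations move the same factors, so E(q^(2n) x) e(q^(2n) x) is
  independent of n, and it tends to 1.\<close>

lemma euler_E_mult_e:
  assumes "mps_ord_ge 1 x"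
  shows "euler_E x * euler_e x = 1"
proof -
  let ?y = "\<lambda>n. mps_const ((fls_X\<^sup>2) ^ n) * x"
  have "(\<lambda>n. euler_E (?y n) * euler_e (?y n)) \<longlonglongrightarrow> 1 * 1"
    unfolding euler_E_def euler_e_def
    by (intro tendsto_mps_mult tendsto_mps_powser_scale) simp_all
  moreover have "euler_E (?y n) * euler_e (?y n) = euler_E x * euler_e x" for n
    unfolding qpochhammer_mult_euler_E[OF assms, of n, symmetric]
      qpochhammer_mult_euler_Eer_e[OF assms, of n, symmetric] by (simp only: mult_ac)
  ultimately have "(\<lambda>n::nat. euler_E x * euler_e x) \<longlonglongrightarrow> 1" by simp
  thus ?thesis by (simp add: LIMSEQ_const_iff)
qed

text \<open>The finite product (x;q^2)_n equals e(q^(2n) x) E(x), whose first factor tends to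
  1.\<close>

lemma qpochhammer_inf_eq_euler_E:
  assumes "mps_ord_ge 1 x"
  shows "qpochhammer_inf x (mps_const (fls_X\<^sup>2)) = euler_E x"
proof -
  have "(\<lambda>n. euler_e (mps_const ((fls_X\<^sup>2) ^ n) * x) * euler_E x) \<longlonglongrightarrow> 1 * euler_E x"
    unfolding euler_e_def by (intro tendsto_mps_mult tendsto_mps_powser_scale) simp_all
  moreover have "euler_e (mps_const ((fls_X\<^sup>2) ^ n) * x) * euler_E x =
      qpochhammer x (mps_const (fls_X\<^sup>2)) n * (euler_E x * euler_e x)" for n
    by (subst qpochhammer_mult_euler_Eer_e[OF assms, symmetric]) (simp only: mult_ac)
  ultimately have "qpochhammer x (mps_const (fls_X\<^sup>2)) \<longlonglongrightarrow> euler_E x"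
    by (simp add: euler_E_mult_e[OF assms])
  thus ?thesis
    unfolding qpochhammer_inf_def by (rule limI)
qed

section \<open>Weighted order, integrality and leading terms\<close>

text \<open>
  After the substitution \<open>x\<^sup>d \<mapsto> q\<^bsup>B|d|\<^esup> x\<^sup>d\<close> the Laurent series in question become power series in \<open>q\<close>;
  the predicate says that, up to the monomial \<open>e\<close>, the result is divisible by \<open>q\<^sup>R\<close>. For \<open>R \<ge> 0\<close>
  these series form an ideal of those with \<open>R = 0\<close>.
\<close>

definition mps_wt_ge :: "int \<Rightarrow> ('a \<Rightarrow>\<^sub>0 nat) \<Rightarrow> int \<Rightarrow> ('a, 'b :: zero fls) mps \<Rightarrow> bool" where
  "mps_wt_ge B e R f \<longleftrightarrow>
    (\<forall>a b. a + b = e \<longrightarrow> fls_ord_ge (R - B * int (pm_deg a)) (mps_coeff f a))"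

lemma mps_wt_ge_mono: "mps_wt_ge B e R f \<Longrightarrow> R' \<le> R \<Longrightarrow> mps_wt_ge B e R' f"
  unfolding mps_wt_ge_def
proof (intro allI impI)
  fix a b assume *: "\<forall>a b. a + b = e \<longrightarrow> fls_ord_ge (R - B * int (pm_deg a)) (mps_coeff f a)"
    "R' \<le> R" "a + b = e"
  hence "fls_ord_ge (R - B * int (pm_deg a)) (mps_coeff f a)" by blast
  thus "fls_ord_ge (R' - B * int (pm_deg a)) (mps_coeff f a)"
    by (rule fls_ord_ge_mono) (use * in simp)
qed

lemma mps_wt_ge_add: "mps_wt_ge B e R f \<Longrightarrow> mps_wt_ge B e R g \<Longrightarrow> mps_wt_ge B e R (f + g)"
  for f :: "('a, 'b :: monoid_add fls) mps"
  by (auto simp: mps_wt_ge_def intro!: fls_ord_ge_add)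

lemma mps_wt_ge_mult:
  fixes f g :: "('a, 'b :: comm_ring_1 fls) mps"
  assumes "mps_wt_ge B e R f" "mps_wt_ge B e S g"
  shows "mps_wt_ge B e (R + S) (f * g)"
  unfolding mps_wt_ge_def
proof (intro allI impI)
  fix a b assume ab: "a + b = e"
  show "fls_ord_ge (R + S - B * int (pm_deg a)) (mps_coeff (f * g) a)"
    unfolding mps_coeff_times
  proof (rule fls_ord_ge_sum, safe)
    fix a1 a2 assume a: "a = a1 + a2"
    have "a1 + (a2 + b) = e" "a2 + (a1 + b) = e"
      using ab a by (simp_all add: ac_simps)
    hence "fls_ord_ge (R - B * int (pm_deg a1)) (mps_coeff f a1)"
        "fls_ord_ge (S - B * int (pm_deg a2)) (mps_coeff g a2)"
      using assms by (auto simp: mps_wt_ge_def)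
    from fls_ord_ge_mult[OF this]
    show "fls_ord_ge (R + S - B * int (pm_deg (a1 + a2))) (mps_coeff f a1 * mps_coeff g a2)"
      by (simp add: algebra_simps)
  qed
qed

lemma fls_ord_ge_one [simp]: "fls_ord_ge 0 1"
  by (simp add: fls_ord_ge_def)

lemma mps_wt_ge_const: "fls_ord_ge R c \<Longrightarrow> mps_wt_ge B e R (mps_const c)"
  by (auto simp: mps_wt_ge_def mps_coeff_monom)

lemma mps_wt_ge_zero: "mps_wt_ge B e R (0 :: ('a, 'b :: zero fls) mps)"
  by (simp add: mps_wt_ge_def)

lemma mps_wt_ge_one: "mps_wt_ge B e 0 (1 :: ('a, 'b :: comm_ring_1 fls) mps)"
  using mps_wt_ge_const[of 0 "1 :: 'b fls"] by simp

lemma mps_wt_ge_power: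
  fixes f :: "('a, 'b :: comm_ring_1 fls) mps"
  assumes "mps_wt_ge B e R f"
  shows "mps_wt_ge B e (int n * R) (f ^ n)"
proof (induction n)
  case (Suc n)
  show ?case
    using mps_wt_ge_mult[OF assms Suc.IH] by (simp add: algebra_simps)
qed (simp add: mps_wt_ge_one)

lemma mps_wt_ge_mult_minus_one:
  fixes f g :: "('a, 'b :: comm_ring_1 fls) mps"
  assumes "mps_wt_ge B e R (f - 1)" "mps_wt_ge B e R (g - 1)" "R \<ge> 0"
  shows "mps_wt_ge B e R (f * g - 1)"
proof -
  have "mps_wt_ge B e R ((f - 1) * (g - 1) + ((f - 1) + (g - 1)))"
    using mps_wt_ge_mult[OF assms(1,2)] assms
    by (intro mps_wt_ge_add) (auto elim: mps_wt_ge_mono)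
  thus ?thesis by (simp add: algebra_simps)
qed

lemma mps_wt_ge_prod_minus_one:
  fixes f :: "'x \<Rightarrow> ('a, 'b :: comm_ring_1 fls) mps"
  assumes "\<And>x. x \<in> A \<Longrightarrow> mps_wt_ge B e R (f x - 1)" "R \<ge> 0"
  shows "mps_wt_ge B e R ((\<Prod>x\<in>A. f x) - 1)"
  using assms
  by (induction A rule: infinite_finite_induct)
    (auto intro: mps_wt_ge_mult_minus_one simp: mps_wt_ge_zero)

lemma mps_wt_ge_powser_minus_one:
  fixes x :: "('a, 'b :: comm_ring_1 fls) mps"
  assumes "c 0 = 1" "\<And>j. fls_ord_ge 0 (c j)" "mps_wt_ge B e R x" "R \<ge> 0"
  shows "mps_wt_ge B e R (mps_powser c x - 1)"
  unfolding mps_wt_ge_def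
proof (intro allI impI)
  fix a b assume ab: "a + b = e"
  have "mps_coeff (mps_powser c x - 1) a =
      (\<Sum>j\<in>insert 0 {1..pm_deg a}. c j * mps_coeff (x ^ j) a) - mps_coeff 1 a"
    by (simp add: mps_powser_def atMost_atLeast0 Icc_eq_insert_lb_nat)
  also have "\<dots> = (\<Sum>j=1..pm_deg a. c j * mps_coeff (x ^ j) a)"
    by (subst sum.insert) (simp_all add: assms)
  also have "fls_ord_ge (R - B * int (pm_deg a)) \<dots>"
  proof (rule fls_ord_ge_sum)
    fix j assume "j \<in> {1..pm_deg a}"
    hence "R \<le> int j * R" using assms(4) by (cases j) (auto simp: algebra_simps)
    have "fls_ord_ge (int j * R - B * int (pm_deg a)) (mps_coeff (x ^ j) a)"
      using mps_wt_ge_power[OF assms(3), of j] ab by (auto simp: mps_wt_ge_def)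
    from fls_ord_ge_mult[OF assms(2) this]
    show "fls_ord_ge (R - B * int (pm_deg a)) (c j * mps_coeff (x ^ j) a)"
      by (rule fls_ord_ge_mono) (use \<open>R \<le> int j * R\<close> in simp)
  qed
  finally show "fls_ord_ge (R - B * int (pm_deg a)) (mps_coeff (mps_powser c x - 1) a)" .
qed

section \<open>Integral coefficients, integer powers and leading terms\<close>

definition fls_int_coeffs :: "rat fls \<Rightarrow> bool" where
  "fls_int_coeffs f \<longleftrightarrow> (\<forall>r. fls_nth f r \<in> \<int>)"

lemma fls_int_coeffs_0 [simp]: "fls_int_coeffs 0" and fls_int_coeffs_1 [simp]: "fls_int_coeffs 1"
  by (simp_all add: fls_int_coeffs_def)

lemma fls_int_coeffs_add: "fls_int_coeffs f \<Longrightarrow> fls_int_coeffs g \<Longrightarrow> fls_int_coeffs (f + g)"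
  and fls_int_coeffs_diff: "fls_int_coeffs f \<Longrightarrow> fls_int_coeffs g \<Longrightarrow> fls_int_coeffs (f - g)"
  and fls_int_coeffs_uminus: "fls_int_coeffs f \<Longrightarrow> fls_int_coeffs (- f)"
  by (simp_all add: fls_int_coeffs_def)

lemma fls_int_coeffs_mult: "fls_int_coeffs f \<Longrightarrow> fls_int_coeffs g \<Longrightarrow> fls_int_coeffs (f * g)"
  by (auto simp: fls_int_coeffs_def fls_times_nth(1) intro!: Ints_sum Ints_mult)

lemma fls_int_coeffs_sum: "(\<And>x. x \<in> A \<Longrightarrow> fls_int_coeffs (f x)) \<Longrightarrow> fls_int_coeffs (\<Sum>x\<in>A. f x)"
  by (induction A rule: infinite_finite_induct) (auto intro: fls_int_coeffs_add)

lemma fls_int_coeffs_power: "fls_int_coeffs f \<Longrightarrow> fls_int_coeffs (f ^ n)"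
  by (induction n) (auto intro: fls_int_coeffs_mult)

lemma fls_X_powi_nth: "fls_nth (fls_X powi n :: rat fls) k = (if k = n then 1 else 0)"
  by simp

lemma fls_int_coeffs_X_powi: "fls_int_coeffs (fls_X powi n)"
  unfolding fls_int_coeffs_def fls_X_powi_nth by simp

lemma fls_int_coeffs_X_power: "fls_int_coeffs (fls_X ^ n)"
  unfolding fls_int_coeffs_def fls_X_power_nth by simp

lemma fls_inverse_one_minus_X_power:
  assumes "n > 0"
  shows "fls_int_coeffs (inverse (1 - fls_X ^ n)) \<and> fls_ord_ge 0 (inverse (1 - fls_X ^ n :: rat fls))"
proof -
  define g :: "rat fps" where "g = Abs_fps (\<lambda>k. if n dvd k then 1 else 0)"
  have "(1 - fps_X ^ n) * g = 1"
    using assms by (intro fps_ext)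
      (auto simp: g_def algebra_simps fps_X_power_mult_nth dvd_minus_self not_less dest: dvd_imp_le)
  hence "fps_to_fls ((1 - fps_X ^ n) * g) = 1" by simp
  hence "(1 - fls_X ^ n) * fps_to_fls g = 1"
    by (simp add: fls_times_fps_to_fls fps_to_fls_power)
  hence "inverse (1 - fls_X ^ n) = fps_to_fls g"
    by (rule inverse_unique)
  thus ?thesis
    by (simp add: fls_int_coeffs_def fls_ord_ge_def g_def)
qed

lemma inv_qfact_int_coeffs: "fls_int_coeffs (inv_qfact j)" "fls_ord_ge 0 (inv_qfact j)"
proof (induction j)
  case (Suc j)
  have eq: "(1 - fls_X ^ (2 * Suc j)) * inv_qfact (Suc j) = inv_qfact j"
    using inv_qfact_Suc[of j] by (simp only: power_mult)
  have "1 - fls_X ^ (2 * Suc j) \<noteq> (0 :: rat fls)"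
    using fls_X_power_neq_1[of "2 * Suc j"] by auto
  hence "inverse (1 - fls_X ^ (2 * Suc j)) * (1 - fls_X ^ (2 * Suc j)) = (1 :: rat fls)"
    by (rule left_inverse)
  hence eq': "inv_qfact (Suc j) = inverse (1 - fls_X ^ (2 * Suc j)) * inv_qfact j"
    unfolding eq[symmetric] by (simp only: mult.assoc[symmetric] mult_1_left)
  {
    case 1
    show ?case unfolding eq'
      using Suc.IH fls_inverse_one_minus_X_power[of "2 * Suc j"] by (intro fls_int_coeffs_mult) auto
  next
    case 2
    show ?case unfolding eq'
      using fls_ord_ge_mult[of 0 _ 0] Suc.IH fls_inverse_one_minus_X_power[of "2 * Suc j"] by auto
  }
qed auto

lemma inv_qfact_1: "(1 - fls_X\<^sup>2) * inv_qfact (Suc 0) = 1"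
  using inv_qfact_Suc[of 0] by simp

definition mps_int_coeffs :: "('a, rat fls) mps \<Rightarrow> bool" where
  "mps_int_coeffs f \<longleftrightarrow> (\<forall>e. fls_int_coeffs (mps_coeff f e))"

lemma mps_int_coeffs_monom: "fls_int_coeffs c \<Longrightarrow> mps_int_coeffs (mps_monom d c)"
  by (simp add: mps_int_coeffs_def mps_coeff_monom)

lemma mps_int_coeffs_1 [simp]: "mps_int_coeffs 1"
  using mps_int_coeffs_monom[of 1 0] by simp

lemma mps_int_coeffs_mult: "mps_int_coeffs f \<Longrightarrow> mps_int_coeffs g \<Longrightarrow> mps_int_coeffs (f * g)"
  by (auto simp: mps_int_coeffs_def mps_coeff_times intro!: fls_int_coeffs_sum fls_int_coeffs_mult)

lemma mps_int_coeffs_power: "mps_int_coeffs f \<Longrightarrow> mps_int_coeffs (f ^ n)"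
  by (induction n) (auto intro: mps_int_coeffs_mult)

lemma mps_int_coeffs_prod: "(\<And>x. x \<in> A \<Longrightarrow> mps_int_coeffs (f x)) \<Longrightarrow> mps_int_coeffs (\<Prod>x\<in>A. f x)"
  by (induction A rule: infinite_finite_induct) (auto intro: mps_int_coeffs_mult)

lemma mps_int_coeffs_powser:
  "(\<And>j. fls_int_coeffs (c j)) \<Longrightarrow> mps_int_coeffs x \<Longrightarrow> mps_int_coeffs (mps_powser c x)"
  using mps_int_coeffs_power[of x]
  by (auto simp: mps_int_coeffs_def mps_powser_def intro!: fls_int_coeffs_sum fls_int_coeffs_mult)

lemma mps_int_coeffs_tendsto:
  assumes "(f \<longlongrightarrow> l) F" "F \<noteq> bot" "eventually (\<lambda>x. mps_int_coeffs (f x)) F"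
  shows "mps_int_coeffs l"
  unfolding mps_int_coeffs_def fls_int_coeffs_def
proof (intro allI)
  fix e r
  have "eventually (\<lambda>x. fls_ord_ge (r + 1) (mps_coeff (f x) e - mps_coeff l e)) F"
    using assms(1) by (auto simp: tendsto_mps_iff tendsto_fls_iff)
  with assms(3) have "eventually (\<lambda>x. fls_nth (mps_coeff l e) r \<in> \<int>) F"
  proof eventually_elim
    case (elim x)
    have "fls_nth (mps_coeff l e) r = fls_nth (mps_coeff (f x) e) r"
      using elim by (simp add: fls_ord_ge_def)
    thus ?case using elim by (simp add: mps_int_coeffs_def fls_int_coeffs_def)
  qed
  thus "fls_nth (mps_coeff l e) r \<in> \<int>"
    using assms(2) by (simp add: eventually_const_iff)
qed

text \<open>\<open>inverse\<close> on \<open>mps\<close> is a definite description, so negative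
  powers are handled through an explicitly supplied inverse g.\<close>

lemma mps_powi_closed:
  fixes f g :: "('a, 'b :: comm_ring_1) mps"
  assumes "f * g = 1" "P 1" "P f" "P g" "\<And>a b. P a \<Longrightarrow> P b \<Longrightarrow> P (a * b)"
  shows "P (f powi n)"
proof -
  have "P (f ^ k)" "P (g ^ k)" for k
    using assms by (induction k) auto
  thus ?thesis by (simp add: power_int_def mps_inverse_unique[OF assms(1)])
qed

lemma mps_powi_add:
  fixes f g :: "('a, 'b :: comm_ring_1) mps"
  assumes "f * g = 1"
  shows "f powi (m + n) = f powi m * f powi n"
proof -
  have fg: "f ^ k * g ^ k = 1" for k
    using assms by (simp flip: power_mult_distrib)
  \<comment> \<open>Presenting an integer by any difference a - b removes the sign cases from
    additivity, since f^a g^b is visibly multiplicative in the pair.\<close>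
  have *: "f powi i = f ^ a * g ^ b" if "i = int a - int b" for i a b
  proof (cases "a \<ge> b")
    case True
    hence "a = (a - b) + b" by simp
    hence "f ^ a * g ^ b = f ^ (a - b) * (f ^ b * g ^ b)"
      by (metis power_add mult.assoc)
    thus ?thesis using True that fg by (simp add: power_int_def nat_diff_distrib')
  next
    case False
    hence "b = (b - a) + a" by simp
    hence "f ^ a * g ^ b = g ^ (b - a) * (f ^ a * g ^ a)"
      by (metis power_add mult.assoc mult.commute)
    thus ?thesis using False that fg
      by (simp add: power_int_def mps_inverse_unique[OF assms] nat_diff_distrib')
  qed
  obtain a b c d where "m = int a - int b" "n = int c - int d"
    by (metis int_diff_cases)
  thus ?thesis
    using *[of m a b] *[of n c d] *[of "m + n" "a + c" "b + d"] by (simp add: power_add mult_ac)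
qed

text \<open>A first-order logarithm: for D \<ge> 1 the cross term of a product has order 2 D \<ge> D
  + 1, so products add their t and powers multiply it, negative powers included.\<close>

definition mps_lead :: "nat \<Rightarrow> ('a, 'b :: comm_ring_1) mps \<Rightarrow> ('a, 'b) mps \<Rightarrow> bool" where
  "mps_lead D f t \<longleftrightarrow> mps_ord_ge D t \<and> mps_ord_ge (Suc D) (f - 1 - t)"

lemma mps_lead_1 [simp]: "mps_lead D 1 0"
  by (simp add: mps_lead_def)

lemma mps_lead_mult:
  assumes "mps_lead D f s" "mps_lead D g t" "D \<ge> 1"
  shows "mps_lead D (f * g) (s + t)"
proof -
  have "mps_ord_ge (D + D) (s * t)"
    using assms by (intro mps_ord_ge_mult) (auto simp: mps_lead_def)
  hence "mps_ord_ge (Suc D) (s * t)"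
    by (rule mps_ord_ge_mono) (use assms in simp)
  hence "mps_ord_ge (Suc D) (g * (f - 1 - s) + (1 + s) * (g - 1 - t) + s * t)"
    using assms(1,2) unfolding mps_lead_def
    by (blast intro: mps_ord_ge_add mps_ord_ge_mult_left)
  also have "g * (f - 1 - s) + (1 + s) * (g - 1 - t) + s * t = f * g - 1 - (s + t)"
    by (simp add: algebra_simps)
  finally show ?thesis
    using assms by (simp add: mps_lead_def mps_ord_ge_add)
qed

lemma mps_lead_power:
  assumes "mps_lead D f t" "D \<ge> 1"
  shows "mps_lead D (f ^ n) (of_nat n * t)"
proof (induction n)
  case (Suc n)
  show ?case
    using mps_lead_mult[OF assms(1) Suc.IH assms(2)] by (simp add: ring_distribs)
qed simp

lemma mps_lead_prod:
  assumes "\<And>x. x \<in> A \<Longrightarrow> mps_lead D (f x) (t x)" "D \<ge> 1"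
  shows "mps_lead D (\<Prod>x\<in>A. f x) (\<Sum>x\<in>A. t x)"
  using assms by (induction A rule: infinite_finite_induct) (auto intro: mps_lead_mult)

lemma mps_lead_powi:
  assumes "f * g = 1" "mps_lead D f t" "mps_lead D g (- t)" "D \<ge> 1"
  shows "mps_lead D (f powi n) (of_int n * t)"
proof (cases "n \<ge> 0")
  case True
  thus ?thesis using mps_lead_power[OF assms(2,4), of "nat n"] by (simp add: power_int_def)
next
  case False
  thus ?thesis using mps_lead_power[OF assms(3,4), of "nat (- n)"]
    by (simp add: power_int_def mps_inverse_unique[OF assms(1)])
qed

lemma mps_lead_powser:
  fixes x :: "('a, 'b :: comm_ring_1) mps"
  assumes "c 0 = 1" "mps_ord_ge D x" "D \<ge> 1"
  shows "mps_lead D (mps_powser c x) (mps_const (c 1) * x)"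
proof -
  have x: "mps_ord_ge 1 x" using assms mps_ord_ge_mono by blast
  have D2: "mps_ord_ge (Suc D) (x ^ j)" if "j \<ge> 2" for j
  proof -
    have "mps_ord_ge (Suc D) (x ^ 2)"
      using mps_ord_ge_mult[OF assms(2,2)] assms(3)
      by (auto simp: power2_eq_square elim: mps_ord_ge_mono)
    hence "mps_ord_ge (Suc D) (x ^ (j - 2) * x ^ 2)"
      by (rule mps_ord_ge_mult_left)
    moreover have "j - 2 + 2 = j" using that by simp
    ultimately show ?thesis by (metis power_add)
  qed
  have "{..D} = insert 0 (insert 1 {2..D})" using assms(3) by auto
  hence split: "(\<Sum>j\<le>D. mps_const (c j) * x ^ j) = 1 + (mps_const (c 1) * x + (\<Sum>j=2..D. mps_const (c j) * x ^ j))"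
    by (simp add: assms)
  have "mps_ord_ge (Suc D) (\<Sum>j=2..D. mps_const (c j) * x ^ j)"
    by (intro mps_ord_ge_sum mps_ord_ge_mult_left D2) simp
  from mps_ord_ge_add[OF mps_powser_truncate[OF x, of D c, unfolded split] this]
  have "mps_ord_ge (Suc D) (mps_powser c x - 1 - mps_const (c 1) * x)"
    by (simp only: diff_diff_add[symmetric] diff_add_cancel)
  thus ?thesis
    unfolding mps_lead_def using assms by (auto intro: mps_ord_ge_mult_left)
qed

section \<open>Donaldson--Thomas series\<close>

definition DT_monom :: "(nat \<Rightarrow>\<^sub>0 nat) \<Rightarrow> int \<Rightarrow> series" where
  "DT_monom d s = mps_monom d (fls_X powi s)"

definition DT_factor :: "(nat, int fls) mps \<Rightarrow> (nat \<Rightarrow>\<^sub>0 nat) \<times> int \<Rightarrow> series" where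
  "DT_factor \<Omega> = (\<lambda>(d, s). qpochhammer_inf (mps_monom d (fls_X powi s)) (mps_const (fls_X\<^sup>2))
      powi (fls_nth (mps_coeff \<Omega> d) s))"

abbreviation DT_filter :: "((nat \<Rightarrow>\<^sub>0 nat) \<times> int) set filter" where
  "DT_filter \<equiv> finite_subsets_at_top {(d, s). d \<noteq> 0}"

lemma has_DT_series_iff:
  "has_DT_series P \<Omega> \<longleftrightarrow>
    mps_coeff \<Omega> 0 = 0 \<and> ((\<lambda>F. \<Prod>x\<in>F. DT_factor \<Omega> x) \<longlongrightarrow> P) DT_filter"
  by (simp only: has_DT_series_def DT_factor_def)

lemma DT_monom_ord: "mps_ord_ge (pm_deg d) (DT_monom d s)"
  by (auto simp: mps_ord_ge_def DT_monom_def mps_coeff_monom)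

lemma DT_monom_ord_1: "d \<noteq> 0 \<Longrightarrow> mps_ord_ge 1 (DT_monom d s)"
  using mps_ord_ge_mono[OF DT_monom_ord, of 1 d s] pm_deg_eq_0_iff[of d] by force

lemma DT_factor_eq:
  assumes "d \<noteq> 0"
  shows "DT_factor \<Omega> (d, s) = euler_E (DT_monom d s) powi (fls_nth (mps_coeff \<Omega> d) s)"
  using qpochhammer_inf_eq_euler_E[OF DT_monom_ord_1[OF assms]] by (simp add: DT_factor_def DT_monom_def)

lemmas euler_DT_monom = euler_E_mult_e[OF DT_monom_ord_1]

text \<open>The factor is an integer power of a power series in x^d q^s with constant term 1 and
  coefficients without poles in q, so its distance from 1 is governed by the weight of x^d q^s.
  Monomials not dividing e and zero exponents impose nothing.\<close>

lemma DT_factor_wt: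
  assumes d: "d \<noteq> 0" and R: "R \<ge> 0"
    and *: "(\<exists>b. d + b = e) \<Longrightarrow> fls_nth (mps_coeff \<Omega> d) s \<noteq> 0 \<Longrightarrow> R \<le> s + B * int (pm_deg d)"
  shows "mps_wt_ge B e R (DT_factor \<Omega> (d, s) - 1)"
proof (cases "fls_nth (mps_coeff \<Omega> d) s = 0")
  case True
  thus ?thesis by (simp add: DT_factor_eq d mps_wt_ge_zero)
next
  case False
  have x: "mps_wt_ge B e R (DT_monom d s)"
    unfolding mps_wt_ge_def
  proof (intro allI impI)
    fix a b assume "a + b = e"
    thus "fls_ord_ge (R - B * int (pm_deg a)) (mps_coeff (DT_monom d s) a)"
      using * False by (auto simp: DT_monom_def mps_coeff_monom fls_ord_ge_def algebra_simps)
  qed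
  have c: "fls_ord_ge 0 ((-1) ^ j * fls_X ^ (j * (j - 1)) * inv_qfact j)" for j
  proof -
    have "fls_ord_ge 0 ((-1) ^ j :: rat fls)"
      by (cases "even j") (simp_all add: fls_ord_ge_def)
    moreover have "fls_ord_ge 0 (fls_X ^ (j * (j - 1)) :: rat fls)"
      by (simp add: fls_ord_ge_def fls_X_power_nth del: of_nat_mult)
    ultimately show ?thesis
      using fls_ord_ge_mult[of 0 _ 0] inv_qfact_int_coeffs(2) by (metis add_0)
  qed
  have "mps_wt_ge B e R (euler_E (DT_monom d s) - 1)" "mps_wt_ge B e R (euler_e (DT_monom d s) - 1)"
    unfolding euler_E_def euler_e_def
    by (rule mps_wt_ge_powser_minus_one; use x R c inv_qfact_int_coeffs(2) in simp)+
  thus ?thesis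
    unfolding DT_factor_eq[OF d]
    by (intro mps_powi_closed[OF euler_DT_monom[OF d], where P = "\<lambda>f. mps_wt_ge B e R (f - 1)"])
      (auto intro: mps_wt_ge_mult_minus_one simp: mps_wt_ge_zero R)
qed

text \<open>Only the finitely many d dividing e count, and each coefficient of \<Omega> has a lowest
  power of q. Since d \<noteq> 0 has degree at least 1, a bound B on all these pole orders is also
  bounded by B |d|.\<close>

lemma ex_wt_bound:
  fixes \<Omega> :: "(nat, int fls) mps"
  assumes "mps_coeff \<Omega> 0 = 0"
  obtains B where "B \<ge> 0"
    "\<And>d b s. d + b = e \<Longrightarrow> fls_nth (mps_coeff \<Omega> d) s \<noteq> 0 \<Longrightarrow> 0 \<le> s + B * int (pm_deg d)"
proof -
  define B where "B = (\<Sum>d\<in>{d. \<exists>b. d + b = e}. \<bar>fls_subdegree (mps_coeff \<Omega> d)\<bar>)"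
  show ?thesis
  proof
    show B: "B \<ge> 0" by (simp add: B_def sum_nonneg)
    fix d b s assume d: "d + b = e" and s: "fls_nth (mps_coeff \<Omega> d) s \<noteq> 0"
    have "\<bar>fls_subdegree (mps_coeff \<Omega> d)\<bar> \<le> B"
      unfolding B_def using d by (intro member_le_sum finite_exponents_below) auto
    moreover have "fls_subdegree (mps_coeff \<Omega> d) \<le> s"
      using s fls_subdegree_leI by blast
    moreover have "d \<noteq> 0"
      using s assms by auto
    hence "pm_deg d > 0"
      by (metis gr0I pm_deg_eq_0_iff)
    hence "B * 1 \<le> B * int (pm_deg d)"
      using B by (intro mult_left_mono) auto
    ultimately show "0 \<le> s + B * int (pm_deg d)" by linarith
  qed
qed

text \<open>At a given monomial and precision all factors outside a finite set are 1 modulo a high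
  weight, so the finite subproducts form a Cauchy net.\<close>

lemma has_DT_series_ex:
  fixes \<Omega> :: "(nat, int fls) mps"
  assumes "mps_coeff \<Omega> 0 = 0"
  shows "\<exists>P. has_DT_series P \<Omega>"
proof -
  have "\<exists>P. ((\<lambda>F. \<Prod>x\<in>F. DT_factor \<Omega> x) \<longlongrightarrow> P) DT_filter"
  proof (rule convergent_mpsI)
    fix e :: "nat \<Rightarrow>\<^sub>0 nat" and N :: int
    obtain B where B: "B \<ge> 0"
      "\<And>d b s. d + b = e \<Longrightarrow> fls_nth (mps_coeff \<Omega> d) s \<noteq> 0 \<Longrightarrow> 0 \<le> s + B * int (pm_deg d)"
      using ex_wt_bound[OF assms] by metis
    \<comment> \<open>Weight R at the monomial e means order R - B |e| in q, which is at least N.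
      Factors of negative weight have exponent zero by the choice of B, which keeps F0 below
      finite.\<close>
    define R where "R = max 0 (N + B * int (pm_deg e))"
    define F0 where "F0 = {(d, s). d \<noteq> 0 \<and> (\<exists>b. d + b = e) \<and> 0 \<le> s + B * int (pm_deg d) \<and> s + B * int (pm_deg d) < R}"
    have "F0 \<subseteq> (SIGMA d : {d. \<exists>b. d + b = e}. {- B * int (pm_deg d)..<R - B * int (pm_deg d)})"
      by (auto simp: F0_def)
    hence fin: "finite F0"
      by (rule finite_subset) (intro finite_SigmaI finite_exponents_below finite_atLeastLessThan_int)
    have "fls_ord_ge N (mps_coeff (\<Prod>x\<in>F. DT_factor \<Omega> x) e - mps_coeff (\<Prod>x\<in>F0. DT_factor \<Omega> x) e)"
      if F: "finite F" "F0 \<subseteq> F" "F \<subseteq> {(d, s). d \<noteq> 0}" for F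
    proof -
      have "mps_wt_ge B e 0 (DT_factor \<Omega> (d, s) - 1)" if "(d, s) \<in> F0" for d s
        using that B by (intro DT_factor_wt) (auto simp: F0_def)
      hence "mps_wt_ge B e 0 ((\<Prod>x\<in>F0. DT_factor \<Omega> x) - 1)"
        by (intro mps_wt_ge_prod_minus_one) auto
      from mps_wt_ge_add[OF this mps_wt_ge_one]
      have 1: "mps_wt_ge B e 0 (\<Prod>x\<in>F0. DT_factor \<Omega> x)" by simp
      have "mps_wt_ge B e R (DT_factor \<Omega> (d, s) - 1)" if "(d, s) \<in> F - F0" for d s
        using that B(2) F by (intro DT_factor_wt) (auto simp: F0_def R_def not_less)
      hence "mps_wt_ge B e R ((\<Prod>x\<in>F - F0. DT_factor \<Omega> x) - 1)"
        by (intro mps_wt_ge_prod_minus_one) (auto simp: R_def)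
      from mps_wt_ge_mult[OF 1 this]
      have "mps_wt_ge B e R ((\<Prod>x\<in>F0. DT_factor \<Omega> x) * (\<Prod>x\<in>F - F0. DT_factor \<Omega> x) - (\<Prod>x\<in>F0. DT_factor \<Omega> x))"
        by (simp add: algebra_simps)
      also have "(\<Prod>x\<in>F0. DT_factor \<Omega> x) * (\<Prod>x\<in>F - F0. DT_factor \<Omega> x) = (\<Prod>x\<in>F. DT_factor \<Omega> x)"
        using F by (simp add: prod.subset_diff mult.commute)
      finally have "fls_ord_ge (R - B * int (pm_deg e))
          (mps_coeff ((\<Prod>x\<in>F. DT_factor \<Omega> x) - (\<Prod>x\<in>F0. DT_factor \<Omega> x)) e)"
        unfolding mps_wt_ge_def by (metis add.right_neutral)
      thus ?thesis
        by (auto simp: R_def elim: fls_ord_ge_mono)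
    qed
    moreover have "F0 \<subseteq> {(d, s). d \<noteq> 0}" by (auto simp: F0_def)
    ultimately show "\<exists>c. eventually (\<lambda>F. fls_ord_ge N (mps_coeff (\<Prod>x\<in>F. DT_factor \<Omega> x) e - c)) DT_filter"
      using fin unfolding eventually_finite_subsets_at_top by blast
  qed simp
  thus ?thesis
    using assms by (auto simp: has_DT_series_iff)
qed

lemma has_DT_series_unique_left: "has_DT_series P \<Omega> \<Longrightarrow> has_DT_series P' \<Omega> \<Longrightarrow> P = P'"
  using tendsto_unique[of DT_filter] by (auto simp: has_DT_series_iff)

section \<open>Multiplicativity, uniqueness and existence of the exponents\<close>

lemma has_DT_series_mult:
  assumes "has_DT_series P \<Omega>" "has_DT_series P' \<Omega>'"
  shows "has_DT_series (P * P') (\<Omega> + \<Omega>')"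
proof -
  have "((\<lambda>F. (\<Prod>x\<in>F. DT_factor \<Omega> x) * (\<Prod>x\<in>F. DT_factor \<Omega>' x)) \<longlongrightarrow> P * P') DT_filter"
    using assms by (intro tendsto_mps_mult) (auto simp: has_DT_series_iff)
  moreover have "eventually (\<lambda>F. (\<Prod>x\<in>F. DT_factor \<Omega> x) * (\<Prod>x\<in>F. DT_factor \<Omega>' x) =
      (\<Prod>x\<in>F. DT_factor (\<Omega> + \<Omega>') x)) DT_filter"
  proof (rule eventually_finite_subsets_at_top_weakI)
    fix F :: "((nat \<Rightarrow>\<^sub>0 nat) \<times> int) set" assume "F \<subseteq> {(d, s). d \<noteq> 0}"
    thus "(\<Prod>x\<in>F. DT_factor \<Omega> x) * (\<Prod>x\<in>F. DT_factor \<Omega>' x) = (\<Prod>x\<in>F. DT_factor (\<Omega> + \<Omega>') x)"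
      unfolding prod.distrib[symmetric]
      by (intro prod.cong) (auto simp: DT_factor_eq mps_powi_add[OF euler_DT_monom])
  qed
  ultimately have "((\<lambda>F. \<Prod>x\<in>F. DT_factor (\<Omega> + \<Omega>') x) \<longlongrightarrow> P * P') DT_filter"
    by (rule Lim_transform_eventually)
  thus ?thesis
    using assms by (simp add: has_DT_series_iff)
qed

lemma has_DT_series_0: "has_DT_series 1 0"
proof -
  have "DT_factor 0 x = 1" for x by (cases x) (simp add: DT_factor_def)
  thus ?thesis by (simp add: has_DT_series_iff)
qed

lemma has_DT_series_int_coeffs:
  assumes "has_DT_series P \<Omega>"
  shows "mps_int_coeffs P"
proof (rule mps_int_coeffs_tendsto)
  show "((\<lambda>F. \<Prod>x\<in>F. DT_factor \<Omega> x) \<longlongrightarrow> P) DT_filter"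
    using assms by (simp add: has_DT_series_iff)
  show "eventually (\<lambda>F. mps_int_coeffs (\<Prod>x\<in>F. DT_factor \<Omega> x)) DT_filter"
  proof (rule eventually_finite_subsets_at_top_weakI)
    fix F :: "((nat \<Rightarrow>\<^sub>0 nat) \<times> int) set" assume F: "F \<subseteq> {(d, s). d \<noteq> 0}"
    have "mps_int_coeffs (DT_factor \<Omega> (d, s))" if "d \<noteq> 0" for d s
    proof -
      have x: "mps_int_coeffs (DT_monom d s)"
        unfolding DT_monom_def by (intro mps_int_coeffs_monom fls_int_coeffs_X_powi)
      have "fls_int_coeffs (-1)" using fls_int_coeffs_uminus[of 1] by simp
      hence "mps_int_coeffs (euler_E (DT_monom d s))" "mps_int_coeffs (euler_e (DT_monom d s))"
        unfolding euler_E_def euler_e_def using x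
        by (auto intro!: mps_int_coeffs_powser fls_int_coeffs_mult fls_int_coeffs_power[of "-1"]
            fls_int_coeffs_X_power inv_qfact_int_coeffs)
      thus ?thesis
        unfolding DT_factor_eq[OF that]
        using mps_powi_closed[OF euler_DT_monom[OF that], where P = mps_int_coeffs]
          mps_int_coeffs_mult by (metis mps_int_coeffs_1)
    qed
    thus "mps_int_coeffs (\<Prod>x\<in>F. DT_factor \<Omega> x)"
      using F by (intro mps_int_coeffs_prod) auto
  qed
qed simp

definition fls_rat :: "int fls \<Rightarrow> rat fls" where
  "fls_rat f = Abs_fls (\<lambda>n. of_int (fls_nth f n))"

lemma fls_nth_rat [simp]: "fls_nth (fls_rat f) n = of_int (fls_nth f n)"
  unfolding fls_rat_def
  by (subst nth_Abs_fls_lower_bound[where N = "fls_subdegree f"]) auto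

lemma fls_int_coeffs_ex:
  assumes "fls_int_coeffs f"
  shows "\<exists>g. fls_rat g = f"
proof -
  define g where "g = Abs_fls (\<lambda>n. \<lfloor>fls_nth f n\<rfloor>)"
  have "fls_nth g n = \<lfloor>fls_nth f n\<rfloor>" for n
    unfolding g_def by (subst nth_Abs_fls_lower_bound[where N = "fls_subdegree f"]) auto
  hence "fls_rat g = f"
    using assms by (intro fls_eqI) (auto simp: fls_int_coeffs_def elim!: Ints_cases)
  thus ?thesis ..
qed

lemma DT_factor_lead:
  assumes "d \<noteq> 0" "D \<ge> 1" "mps_ord_ge D \<Omega>"
  shows "mps_lead D (DT_factor \<Omega> (d, s))
    (of_int (fls_nth (mps_coeff \<Omega> d) s) * (mps_const (- inv_qfact 1) * DT_monom d s))"
proof (cases "pm_deg d < D")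
  case True
  hence "mps_coeff \<Omega> d = 0" using assms by (simp add: mps_ord_ge_def)
  thus ?thesis by (simp add: DT_factor_eq assms)
next
  case False
  hence x: "mps_ord_ge D (DT_monom d s)"
    using mps_ord_ge_mono[OF DT_monom_ord] by (simp add: not_less)
  have neg: "mps_const (- a) = - mps_const a" for a :: "rat fls"
    using mps_const_diff[of 0 a] by simp
  show ?thesis
    unfolding DT_factor_eq[OF assms(1)]
  proof (rule mps_lead_powi[OF euler_DT_monom[OF assms(1)]])
    show "mps_lead D (euler_E (DT_monom d s)) (mps_const (- inv_qfact 1) * DT_monom d s)"
      using mps_lead_powser[of "\<lambda>j. (-1) ^ j * fls_X ^ (j * (j - 1)) * inv_qfact j", OF _ x assms(2)]
      by (simp add: euler_E_def)
    show "mps_lead D (euler_e (DT_monom d s)) (- (mps_const (- inv_qfact 1) * DT_monom d s))"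
      using mps_lead_powser[of inv_qfact, OF _ x assms(2)]
      by (simp add: euler_e_def neg)
  qed (use assms in simp)
qed

text \<open>A factor with d of degree D contributes its linear term - x^d q^s / (1 - q^2),
  multiplied by its exponent, and nothing else is visible in degree D. So P in its lowest degree
  amounts to \<Omega> there, which drives both uniqueness and existence.\<close>

lemma has_DT_series_lead:
  assumes P: "has_DT_series P \<Omega>" and D: "D \<ge> 1" "mps_ord_ge D \<Omega>"
  shows "mps_ord_ge D (P - 1)"
    and "pm_deg e = D \<Longrightarrow> mps_coeff P e = - inv_qfact 1 * fls_rat (mps_coeff \<Omega> e)"
proof -
  define t where "t = (\<lambda>(d, s). of_int (fls_nth (mps_coeff \<Omega> d) s) * (mps_const (- inv_qfact 1) * DT_monom d s))"
  have lead: "mps_lead D (\<Prod>x\<in>F. DT_factor \<Omega> x) (\<Sum>x\<in>F. t x)" if "F \<subseteq> {(d, s). d \<noteq> 0}" for F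
    using that D DT_factor_lead by (intro mps_lead_prod) (auto simp: t_def)
  have lim: "((\<lambda>F. mps_coeff (\<Prod>x\<in>F. DT_factor \<Omega> x) e) \<longlongrightarrow> mps_coeff P e) DT_filter" for e
    using P by (simp add: has_DT_series_iff tendsto_mps_iff)
  show "mps_ord_ge D (P - 1)"
    unfolding mps_ord_ge_def
  proof (intro allI impI)
    fix e :: "nat \<Rightarrow>\<^sub>0 nat" assume e: "pm_deg e < D"
    have "eventually (\<lambda>F. mps_coeff (\<Prod>x\<in>F. DT_factor \<Omega> x) e = mps_coeff 1 e) DT_filter"
    proof (rule eventually_finite_subsets_at_top_weakI)
      fix F :: "((nat \<Rightarrow>\<^sub>0 nat) \<times> int) set" assume "F \<subseteq> {(d, s). d \<noteq> 0}"
      hence "mps_ord_ge D ((\<Prod>x\<in>F. DT_factor \<Omega> x) - 1 - (\<Sum>x\<in>F. t x) + (\<Sum>x\<in>F. t x))"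
        using lead[of F] mps_ord_ge_mono[of "Suc D" _ D]
        by (intro mps_ord_ge_add) (auto simp: mps_lead_def)
      thus "mps_coeff (\<Prod>x\<in>F. DT_factor \<Omega> x) e = mps_coeff 1 e"
        using e by (simp add: mps_ord_ge_def)
    qed
    hence "((\<lambda>F. mps_coeff (\<Prod>x\<in>F. DT_factor \<Omega> x) e) \<longlongrightarrow> mps_coeff 1 e) DT_filter"
      by (rule tendsto_eventually)
    hence "mps_coeff P e = mps_coeff 1 e"
      by (rule tendsto_unique[OF finite_subsets_at_top_neq_bot lim])
    thus "mps_coeff (P - 1) e = 0" by simp
  qed
  assume e: "pm_deg e = D"
  hence e0: "e \<noteq> 0" using D by auto
  \<comment> \<open>A finite subproduct sees only those terms of the coefficient of \<Omega> at e
    whose index (e, s) lies in F; S is their sum, and it tends q-adically to the whole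
    coefficient.\<close>
  define S where "S = (\<lambda>F. \<Sum>(d, s)\<in>F. if d = e then of_int (fls_nth (mps_coeff \<Omega> d) s) * fls_X powi s else (0 :: rat fls))"
  have S: "(S \<longlongrightarrow> fls_rat (mps_coeff \<Omega> e)) DT_filter"
    unfolding tendsto_fls_iff
  proof
    fix N
    define s0 where "s0 = fls_subdegree (mps_coeff \<Omega> e)"
    have "fls_ord_ge N (S F - fls_rat (mps_coeff \<Omega> e))" if F: "finite F" "{e} \<times> {s0..<N} \<subseteq> F" for F
      unfolding fls_ord_ge_def
    proof (intro allI impI)
      fix r assume r: "r < N"
      have "fls_nth (S F) r = (\<Sum>(d, s)\<in>F. if (d, s) = (e, r) then of_int (fls_nth (mps_coeff \<Omega> e) r) else 0)"
        unfolding S_def fls_nth_sum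
      proof (rule sum.cong[OF refl], clarify)
        fix d s
        show "fls_nth (if d = e then of_int (fls_nth (mps_coeff \<Omega> d) s) * fls_X powi s else (0 :: rat fls)) r =
            (if (d, s) = (e, r) then of_int (fls_nth (mps_coeff \<Omega> e) r) else 0)"
          by (auto simp: fls_of_int)
      qed
      also have "\<dots> = (\<Sum>x\<in>F. if x = (e, r) then of_int (fls_nth (mps_coeff \<Omega> e) r) else 0)"
        by (rule sum.cong[OF refl]) (simp add: split_def prod_eq_iff)
      also have "\<dots> = (if (e, r) \<in> F then of_int (fls_nth (mps_coeff \<Omega> e) r) else 0)"
        using F by simp
      also have "\<dots> = of_int (fls_nth (mps_coeff \<Omega> e) r)"
      proof (cases "(e, r) \<in> F")
        case False
        hence "r < s0" using F r by (meson SigmaI atLeastLessThan_iff linorder_not_less singletonI subsetD)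
        thus ?thesis using False by (simp add: s0_def)
      qed simp
      finally show "fls_nth (S F - fls_rat (mps_coeff \<Omega> e)) r = 0" by simp
    qed
    thus "eventually (\<lambda>F. fls_ord_ge N (S F - fls_rat (mps_coeff \<Omega> e))) DT_filter"
      unfolding eventually_finite_subsets_at_top
      by (intro exI[of _ "{e} \<times> {s0..<N}"]) (use e0 in auto)
  qed
  have "eventually (\<lambda>F. mps_coeff (\<Prod>x\<in>F. DT_factor \<Omega> x) e = - inv_qfact 1 * S F) DT_filter"
  proof (rule eventually_finite_subsets_at_top_weakI)
    fix F :: "((nat \<Rightarrow>\<^sub>0 nat) \<times> int) set" assume "F \<subseteq> {(d, s). d \<noteq> 0}"
    from lead[OF this] have "mps_coeff (\<Prod>x\<in>F. DT_factor \<Omega> x) e = mps_coeff (\<Sum>x\<in>F. t x) e"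
      using e e0 by (auto simp: mps_lead_def mps_ord_ge_def mps_coeff_one)
    also have "\<dots> = - inv_qfact 1 * S F"
      unfolding S_def mps_coeff_sum sum_distrib_left
    proof (rule sum.cong[OF refl], clarify)
      fix d s
      have of_int: "(of_int a :: series) = mps_const (of_int a)" for a
        by (induction a rule: int_induct[of _ 0]) (simp_all add: mps_const_add mps_const_diff)
      show "mps_coeff (t (d, s)) e =
          - inv_qfact 1 * (if d = e then of_int (fls_nth (mps_coeff \<Omega> d) s) * fls_X powi s else 0)"
        by (simp add: t_def of_int DT_monom_def mps_coeff_monom)
    qed
    finally show "mps_coeff (\<Prod>x\<in>F. DT_factor \<Omega> x) e = - inv_qfact 1 * S F" .
  qed
  moreover have "((\<lambda>F. - inv_qfact 1 * S F) \<longlongrightarrow> - inv_qfact 1 * fls_rat (mps_coeff \<Omega> e)) DT_filter"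
    by (intro tendsto_fls_mult S tendsto_const)
  ultimately have "((\<lambda>F. mps_coeff (\<Prod>x\<in>F. DT_factor \<Omega> x) e) \<longlongrightarrow> - inv_qfact 1 * fls_rat (mps_coeff \<Omega> e)) DT_filter"
    by (simp add: tendsto_cong)
  thus "mps_coeff P e = - inv_qfact 1 * fls_rat (mps_coeff \<Omega> e)"
    by (rule tendsto_unique[rotated 1, OF lim]) simp
qed

lemma inv_qfact_1_nonzero: "inv_qfact 1 \<noteq> 0"
  using inv_qfact_1 by auto

lemma fls_rat_eq_0_iff: "fls_rat f = 0 \<longleftrightarrow> f = 0"
  by (auto simp: fls_eq_iff)

text \<open>Induction on the degree: once \<Omega> vanishes in lower degrees, its part in the next
  degree is, up to the unit - 1/(1 - q^2), the corresponding part of the series 1, hence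
  zero.\<close>

lemma has_DT_series_one_imp_zero:
  assumes "has_DT_series 1 \<Omega>"
  shows "\<Omega> = 0"
proof -
  have "mps_ord_ge (Suc n) \<Omega>" for n
  proof (induction n)
    case 0
    show ?case using assms by (auto simp: has_DT_series_def mps_ord_ge_def)
  next
    case (Suc n)
    have "mps_coeff \<Omega> e = 0" if "pm_deg e = Suc n" for e
    proof -
      have "e \<noteq> 0" using that by auto
      thus ?thesis
      using has_DT_series_lead(2)[OF assms _ Suc.IH that] inv_qfact_1_nonzero
      by (simp add: mps_coeff_one fls_rat_eq_0_iff)
    qed
    thus ?case using Suc.IH by (auto simp: mps_ord_ge_def less_Suc_eq)
  qed
  thus ?thesis using mps_eqI_ord[of \<Omega> 0] by simp
qed

text \<open>The product R for - \<Omega>' inverts P, so P R = 1 belongs to \<Omega> - \<Omega>' and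
  the case of the series 1 applies.\<close>

lemma has_DT_series_unique:
  assumes "has_DT_series P \<Omega>" "has_DT_series P \<Omega>'"
  shows "\<Omega> = \<Omega>'"
proof -
  obtain R where R: "has_DT_series R (- \<Omega>')"
    using has_DT_series_ex[of "- \<Omega>'"] assms by (auto simp: has_DT_series_def)
  have "has_DT_series (P * R) 0"
    using has_DT_series_mult[OF assms(2) R] by simp
  hence "P * R = 1"
    using has_DT_series_unique_left has_DT_series_0 by blast
  hence "has_DT_series 1 (\<Omega> - \<Omega>')"
    using has_DT_series_mult[OF assms(1) R] by simp
  thus ?thesis using has_DT_series_one_imp_zero by fastforce
qed

text \<open>The exponents are built degree by degree. Solving for the next degree multiplies the
  defect by -(1 - q^2), which preserves integrality; the defect itself is integral because P and all
  products are.\<close>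

lemma has_DT_series_of_int_coeffs:
  assumes P: "mps_int_coeffs P" "mps_coeff P 0 = 1"
  shows "\<exists>\<Omega>. has_DT_series P \<Omega>"
proof -
  define good where "good = (\<lambda>K \<Omega>. mps_coeff \<Omega> 0 = 0 \<and>
    (\<forall>P'. has_DT_series P' \<Omega> \<longrightarrow> mps_ord_ge (Suc K) (P' - P)))"
  have "\<exists>f. \<forall>n. good n (f n) \<and> mps_ord_ge (Suc n) (f (Suc n) - f n)"
  proof (rule dependent_nat_choice)
    have one: "P' = 1" if "has_DT_series P' 0" for P'
      using that has_DT_series_unique_left has_DT_series_0 by blast
    have "good 0 0"
      using P by (auto simp: good_def mps_ord_ge_def mps_coeff_one dest!: one)
    thus "\<exists>\<Omega>. good 0 \<Omega>" ..
  next
    fix \<Omega> K assume good: "good K \<Omega>"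
    then obtain P' where P': "has_DT_series P' \<Omega>"
      using has_DT_series_ex by (auto simp: good_def)
    have low: "mps_ord_ge (Suc K) (P' - P)"
      using good P' by (simp add: good_def)
    have "\<exists>g. fls_rat g = - (1 - fls_X\<^sup>2) * mps_coeff (P - P') e" for e
    proof (rule fls_int_coeffs_ex)
      have "fls_int_coeffs (mps_coeff P e)" "fls_int_coeffs (mps_coeff P' e)"
        using P has_DT_series_int_coeffs[OF P'] by (simp_all add: mps_int_coeffs_def)
      thus "fls_int_coeffs (- (1 - fls_X\<^sup>2) * mps_coeff (P - P') e)"
        by (auto intro!: fls_int_coeffs_mult fls_int_coeffs_uminus fls_int_coeffs_diff fls_int_coeffs_X_power)
    qed
    then obtain g where g: "\<And>e. fls_rat (g e) = - (1 - fls_X\<^sup>2) * mps_coeff (P - P') e"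
      by metis
    \<comment> \<open>Homogeneous of degree K + 1: multiplying P' by its product changes P' in that
      degree by exactly the defect P - P', and in no lower one.\<close>
    define \<Delta> where "\<Delta> = Abs_mps (\<lambda>e. if pm_deg e = Suc K then g e else 0)"
    have \<Delta>: "mps_ord_ge (Suc K) \<Delta>" "mps_coeff \<Delta> 0 = 0"
      by (auto simp: \<Delta>_def mps_ord_ge_def)
    then obtain R where R: "has_DT_series R \<Delta>"
      using has_DT_series_ex by blast
    have R1: "mps_ord_ge (Suc K) (R - 1)"
      using has_DT_series_lead(1)[OF R _ \<Delta>(1)] by simp
    have P'1: "mps_ord_ge 1 (P' - 1)"
      using has_DT_series_lead(1)[OF P', of 1] good
      by (auto simp: good_def mps_ord_ge_def)
    have "mps_ord_ge (Suc (Suc K)) (P' * R - P)"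
    proof -
      have "mps_ord_ge (Suc (Suc K)) ((P' - P) + (R - 1))"
        unfolding mps_ord_ge_def
      proof (intro allI impI)
        fix e :: "nat \<Rightarrow>\<^sub>0 nat" assume "pm_deg e < Suc (Suc K)"
        then consider "pm_deg e < Suc K" | "pm_deg e = Suc K" by linarith
        thus "mps_coeff (P' - P + (R - 1)) e = 0"
        proof cases
          case 1
          thus ?thesis using low R1 by (simp add: mps_ord_ge_def)
        next
          case 2
          hence "mps_coeff R e = - inv_qfact 1 * fls_rat (g e)"
            using has_DT_series_lead(2)[OF R _ \<Delta>(1) 2] by (simp add: \<Delta>_def)
          also have "\<dots> = ((1 - fls_X\<^sup>2) * inv_qfact (Suc 0)) * mps_coeff (P - P') e"
            by (simp add: g algebra_simps)
          also have "\<dots> = mps_coeff (P - P') e"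
            by (simp only: inv_qfact_1 mult_1_left)
          finally show ?thesis using 2 by (auto simp: mps_coeff_one)
        qed
      qed
      moreover have "mps_ord_ge (1 + Suc K) ((P' - 1) * (R - 1))"
        by (rule mps_ord_ge_mult[OF P'1 R1])
      ultimately have "mps_ord_ge (Suc (Suc K)) ((P' - P) + (R - 1) + (P' - 1) * (R - 1))"
        unfolding plus_1_eq_Suc by (rule mps_ord_ge_add)
      thus ?thesis by (simp add: algebra_simps)
    qed
    moreover have "has_DT_series (P' * R) (\<Omega> + \<Delta>)"
      by (rule has_DT_series_mult[OF P' R])
    moreover have "mps_coeff (\<Omega> + \<Delta>) 0 = 0"
      using good \<Delta>(2) by (simp add: good_def)
    ultimately have "good (Suc K) (\<Omega> + \<Delta>)"
      unfolding good_def using has_DT_series_unique_left by blast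
    thus "\<exists>\<Omega>'. good (Suc K) \<Omega>' \<and> mps_ord_ge (Suc K) (\<Omega>' - \<Omega>)"
      using \<Delta>(1) by (intro exI[of _ "\<Omega> + \<Delta>"]) simp
  qed
  then obtain f where good: "\<And>n. good n (f n)" and step: "\<And>n. mps_ord_ge (Suc n) (f (Suc n) - f n)"
    by blast
  \<comment> \<open>Later corrections start above the degree of e, so the limit of the exponents can
    be defined coefficient by coefficient.\<close>
  have chain: "mps_coeff (f (pm_deg e + n)) e = mps_coeff (f (pm_deg e)) e" for e n
    by (induction n) (use step in \<open>auto simp: mps_ord_ge_def\<close>)
  define \<Omega> where "\<Omega> = Abs_mps (\<lambda>e. mps_coeff (f (pm_deg e)) e)"
  have "mps_coeff \<Omega> 0 = 0"
    using good[of 0] by (simp add: \<Omega>_def good_def)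
  then obtain P' where P': "has_DT_series P' \<Omega>"
    using has_DT_series_ex by blast
  have "P' = P"
  proof (rule mps_eqI_ord)
    fix n
    have low: "mps_ord_ge (Suc n) (\<Omega> - f n)"
      unfolding mps_ord_ge_def
    proof (intro allI impI)
      fix e :: "nat \<Rightarrow>\<^sub>0 nat" assume "pm_deg e < Suc n"
      then obtain j where "n = pm_deg e + j" using le_Suc_ex less_Suc_eq_le by blast
      thus "mps_coeff (\<Omega> - f n) e = 0" by (simp add: \<Omega>_def chain)
    qed
    hence "mps_coeff (\<Omega> - f n) 0 = 0" by (simp add: mps_ord_ge_def)
    then obtain R where R: "has_DT_series R (\<Omega> - f n)"
      using has_DT_series_ex by blast
    obtain P\<^sub>n where P\<^sub>n: "has_DT_series P\<^sub>n (f n)"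
      using has_DT_series_ex[of "f n"] good[of n] by (auto simp: good_def)
    have "P' = P\<^sub>n * R"
      using has_DT_series_mult[OF P\<^sub>n R] P' has_DT_series_unique_left by simp
    hence eq: "P' - P = (P\<^sub>n - P) + P\<^sub>n * (R - 1)"
      by (simp add: algebra_simps)
    have "mps_ord_ge (Suc n) (P\<^sub>n - P)"
      using good P\<^sub>n by (auto simp: good_def)
    thus "mps_ord_ge (Suc n) (P' - P)"
      unfolding eq using has_DT_series_lead(1)[OF R _ low]
      by (intro mps_ord_ge_add mps_ord_ge_mult_left) auto
  qed
  thus ?thesis using P' by blast
qed

lemma DT_series_eqI: "has_DT_series (motivic_series Q) \<Omega> \<Longrightarrow> DT_series Q = \<Omega>"
  unfolding DT_series_def using has_DT_series_unique by blast

section \<open>The \<open>q\<close>-Vandermonde identity\<close>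

text \<open>The transpose of the Pascal rule [N+1, M] = [N, M-1] + p^M [N, M]: it acts on the summed
  function instead of on the binomial coefficients, which therefore never have to be formed.\<close>

definition qstep :: "'a :: comm_ring_1 \<Rightarrow> (nat \<Rightarrow> 'a) \<Rightarrow> nat \<Rightarrow> 'a" where
  "qstep p g = (\<lambda>M. g (Suc M) + p ^ M * g M)"

text \<open>By Pascal's rule this is the sum of \<open>[N choose M]\<^sub>p g(M)\<close> over \<open>M\<close>, without division.\<close>

definition qbinom_sum :: "'a :: comm_ring_1 \<Rightarrow> nat \<Rightarrow> (nat \<Rightarrow> 'a) \<Rightarrow> 'a" where
  "qbinom_sum p N g = (qstep p ^^ N) g 0"

lemma qbinom_sum_0 [simp]: "qbinom_sum p 0 g = g 0"
  by (simp add: qbinom_sum_def)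

lemma qstep_funpow_linear:
  "(qstep p ^^ N) (\<lambda>M. \<Sum>a\<in>A. c a * g a M) = (\<lambda>M. \<Sum>a\<in>A. c a * (qstep p ^^ N) (g a) M)"
  by (induction N) (simp_all add: qstep_def fun_eq_iff sum_distrib_left sum.distrib algebra_simps)

lemma qbinom_sum_linear:
  "qbinom_sum p N (\<lambda>M. \<Sum>a\<in>A. c a * g a M) = (\<Sum>a\<in>A. c a * qbinom_sum p N (g a))"
  by (simp add: qbinom_sum_def qstep_funpow_linear)

lemma qbinom_sum_scale: "qbinom_sum p N (\<lambda>M. c * g M) = c * qbinom_sum p N g"
  using qbinom_sum_linear[of p N "\<lambda>_. c" "\<lambda>_. g" "{0::nat}"] by simp

lemma qbinom_sum_diff: "qbinom_sum p N (\<lambda>M. g M - h M) = qbinom_sum p N g - qbinom_sum p N h"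
  using qbinom_sum_linear[of p N "\<lambda>b. if b then 1 else -1" "\<lambda>b. if b then g else h" UNIV]
  by (simp add: UNIV_bool algebra_simps)

lemma qbinom_sum_add: "qbinom_sum p (N + D) g = qbinom_sum p N ((qstep p ^^ D) g)"
  by (simp add: qbinom_sum_def funpow_add)

lemma dvd_qbinom_sum:
  assumes "\<And>M. c dvd g M"
  shows "c dvd qbinom_sum p N g"
proof -
  have "c dvd (qstep p ^^ N) g M" for M
    using assms by (induction N arbitrary: M) (auto simp: qstep_def)
  thus ?thesis by (simp add: qbinom_sum_def)
qed

text \<open>Here U j plays 1/(p;p)_j, and U (D - r) U r / U D is the binomial coefficient [D, r].
  Keeping U D on the left avoids division in a general ring; invertibility of 1 - p^(j+1) permits
  the cancellation in the induction step.\<close>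

lemma qstep_funpow_eq_sum:
  fixes p :: "'a :: comm_ring_1" and U :: "nat \<Rightarrow> 'a"
  assumes U0: "U 0 = 1" and U: "\<And>j. (1 - p ^ Suc j) * U (Suc j) = U j"
    and unit: "\<And>j. (1 - p ^ Suc j) dvd 1"
  shows "U D * (qstep p ^^ D) g M =
    (\<Sum>r\<le>D. U (D - r) * U r * p ^ ((D - r) * M) * g (M + r))"
proof (induction D arbitrary: g)
  case (Suc D)
  define f where "f = (\<lambda>r. U (Suc D - r) * U r * p ^ ((Suc D - r) * M) * g (M + r))"
  define A where "A = (\<lambda>r. U (D - r) * U r * p ^ ((D - r) * M) * p ^ (M + r) * g (M + r))"
  define B where "B = (\<lambda>r. U (D - r) * U r * p ^ ((D - r) * M) * g (M + Suc r))"
  have A: "p ^ r * (1 - p ^ (Suc D - r)) * f r = A r" if "r \<le> D" for r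
  proof -
    have "Suc D - r = Suc (D - r)" using that by simp
    thus ?thesis
      by (simp add: A_def f_def U[symmetric, of "D - r"] power_add mult_ac del: power_Suc)
  qed
  have B: "(1 - p ^ Suc r) * f (Suc r) = B r" for r
    by (simp add: B_def f_def U[symmetric, of r] mult_ac del: power_Suc)
  \<comment> \<open>The Pascal rule in terms of U: the first part lowers the index D + 1 - r and
    yields A, the second lowers r and yields B.\<close>
  have split: "1 - p ^ Suc D = p ^ r * (1 - p ^ (Suc D - r)) + (1 - p ^ r)" if "r \<le> Suc D" for r
  proof -
    have "p ^ Suc D = p ^ r * p ^ (Suc D - r)" using that by (simp only: power_add[symmetric]) simp
    thus ?thesis by (simp only: right_diff_distrib) simp
  qed
  have "(1 - p ^ Suc D) * (\<Sum>r\<le>Suc D. f r) =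
      (\<Sum>r\<le>Suc D. p ^ r * (1 - p ^ (Suc D - r)) * f r + (1 - p ^ r) * f r)"
    unfolding sum_distrib_left
  proof (rule sum.cong[OF refl])
    fix r assume "r \<in> {..Suc D}"
    hence "r \<le> Suc D" by simp
    from split[OF this]
    show "(1 - p ^ Suc D) * f r = p ^ r * (1 - p ^ (Suc D - r)) * f r + (1 - p ^ r) * f r"
      by (simp only: distrib_right)
  qed
  also have "\<dots> = (\<Sum>r\<le>Suc D. p ^ r * (1 - p ^ (Suc D - r)) * f r) + (\<Sum>r\<le>Suc D. (1 - p ^ r) * f r)"
    by (rule sum.distrib)
  also have "(\<Sum>r\<le>Suc D. p ^ r * (1 - p ^ (Suc D - r)) * f r) = (\<Sum>r\<le>D. A r)"
    by (simp add: A)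
  also have "(\<Sum>r\<le>Suc D. (1 - p ^ r) * f r) = (\<Sum>r\<le>D. B r)"
    unfolding sum.atMost_Suc_shift B by simp
  also have "(\<Sum>r\<le>D. A r) + (\<Sum>r\<le>D. B r) =
      (\<Sum>r\<le>D. U (D - r) * U r * p ^ ((D - r) * M) * qstep p g (M + r))"
    unfolding sum.distrib[symmetric]
    by (intro sum.cong) (simp_all add: A_def B_def qstep_def algebra_simps)
  also have "\<dots> = U D * (qstep p ^^ Suc D) g M"
    by (simp add: Suc.IH[symmetric] funpow_swap1)
  finally have eq: "(1 - p ^ Suc D) * (\<Sum>r\<le>Suc D. f r) = U D * (qstep p ^^ Suc D) g M" .
  obtain v where v: "1 = (1 - p ^ Suc D) * v"
    using unit[of D] by (auto elim!: dvdE)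
  have "U (Suc D) * (qstep p ^^ Suc D) g M =
      ((1 - p ^ Suc D) * v) * (U (Suc D) * (qstep p ^^ Suc D) g M)"
    by (simp only: v[symmetric] mult_1_left)
  also have "\<dots> = v * (U D * (qstep p ^^ Suc D) g M)"
    by (simp only: U[symmetric, of D] mult_ac)
  also have "\<dots> = ((1 - p ^ Suc D) * v) * (\<Sum>r\<le>Suc D. f r)"
    by (simp only: eq[symmetric] mult_ac)
  finally show ?case
    by (simp only: v[symmetric] mult_1_left f_def)
qed (simp add: U0)

section \<open>The multivariate Vandermonde sum and the splitting operator\<close>

definition dominated :: "'v set \<Rightarrow> ('v \<Rightarrow> nat) \<Rightarrow> ('v \<Rightarrow> nat) set" where
  "dominated V f = {r. (\<forall>i. i \<notin> V \<longrightarrow> r i = 0) \<and> (\<forall>i\<in>V. r i \<le> f i)}"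

lemma sum_dominated_insert:
  assumes "t \<notin> V"
  shows "(\<Sum>r\<in>dominated (insert t V) f. h r) = (\<Sum>a\<le>f t. \<Sum>r\<in>dominated V f. h (r(t := a)))"
proof -
  have "(\<Sum>r\<in>dominated (insert t V) f. h r) = (\<Sum>(a, r)\<in>{..f t} \<times> dominated V f. h (r(t := a)))"
    by (rule sum.reindex_bij_witness[of _ "\<lambda>(a, r). r(t := a)" "\<lambda>r. (r t, r(t := 0))"])
      (use assms in \<open>auto simp: dominated_def fun_eq_iff\<close>)
  thus ?thesis by (simp add: sum.cartesian_product)
qed

text \<open>Nodes are added in order of increasing \<rho>. The newest node t has the largest rank,
  so the only new exponent is (f t - r t) M with M the total of the earlier r; by
  \<open>qstep_funpow_eq_sum\<close> the sum over \<open>r t\<close> is then the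
  \<open>f t\<close>-fold Pascal step of g at M.\<close>

lemma qvandermonde:
  fixes p :: "'a :: comm_ring_1" and \<rho> :: "'v \<Rightarrow> 'r :: linorder"
  assumes U: "U 0 = 1" "\<And>j. (1 - p ^ Suc j) * U (Suc j) = U j" "\<And>j. (1 - p ^ Suc j) dvd 1"
    and V: "finite V" "inj_on \<rho> V"
  shows "(\<Sum>r\<in>dominated V f. p ^ (\<Sum>i\<in>V. \<Sum>j\<in>V. if \<rho> j < \<rho> i then (f i - r i) * r j else 0) *
      (\<Prod>i\<in>V. U (f i - r i) * U (r i)) * g (\<Sum>i\<in>V. r i)) =
    (\<Prod>i\<in>V. U (f i)) * qbinom_sum p (\<Sum>i\<in>V. f i) g"
  using V
proof (induction V arbitrary: g rule: finite_ranking_induct[where f = \<rho>])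
  case empty
  have "dominated {} f = {\<lambda>_. 0}" by (auto simp: dominated_def)
  thus ?case by simp
next
  case (insert t V)
  show ?case
  \<comment> \<open>The induction rule neither excludes that t is already present nor gives strict
    inequality of ranks; injectivity of \<rho> supplies the latter.\<close>
  proof (cases "t \<in> V")
    case True
    thus ?thesis using insert by (simp add: insert_absorb)
  next
    case t: False
    have less: "\<rho> i < \<rho> t" if "i \<in> V" for i
      using insert.hyps(2)[OF that] insert.prems that t
      by (metis inj_on_eq_iff insertI1 insertI2 order_le_less)
    define E where "E = (\<lambda>r. \<Sum>i\<in>V. \<Sum>j\<in>V. if \<rho> j < \<rho> i then (f i - r i) * r j else 0)"
    define W where "W = (\<lambda>r. \<Prod>i\<in>V. U (f i - r i) * U (r i))"
    have "(\<Sum>r\<in>dominated (insert t V) f.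
        p ^ (\<Sum>i\<in>insert t V. \<Sum>j\<in>insert t V. if \<rho> j < \<rho> i then (f i - r i) * r j else 0) *
        (\<Prod>i\<in>insert t V. U (f i - r i) * U (r i)) * g (\<Sum>i\<in>insert t V. r i)) =
      (\<Sum>a\<le>f t. \<Sum>r\<in>dominated V f. U (f t - a) * U a *
        (p ^ E r * W r * (p ^ ((f t - a) * (\<Sum>i\<in>V. r i)) * g ((\<Sum>i\<in>V. r i) + a))))"
      unfolding sum_dominated_insert[OF t]
    proof (intro sum.cong refl)
      fix a and r :: "'v \<Rightarrow> nat"
      let ?r = "r(t := a)"
      have neq: "i \<noteq> t" if "i \<in> V" for i using that t by auto
      have 1: "(\<Sum>i\<in>V. ?r i) = (\<Sum>i\<in>V. r i)"
        by (intro sum.cong) (use neq in auto)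
      have 2: "(\<Prod>i\<in>V. U (f i - ?r i) * U (?r i)) = W r"
        unfolding W_def by (intro prod.cong) (use neq in auto)
      have "(\<Sum>i\<in>V. \<Sum>j\<in>insert t V. if \<rho> j < \<rho> i then (f i - ?r i) * ?r j else 0) = E r"
        unfolding E_def
      proof (rule sum.cong[OF refl])
        fix i assume i: "i \<in> V"
        have "\<not> \<rho> t < \<rho> i" using less[OF i] by simp
        hence "(\<Sum>j\<in>insert t V. if \<rho> j < \<rho> i then (f i - ?r i) * ?r j else 0) =
            (\<Sum>j\<in>V. if \<rho> j < \<rho> i then (f i - ?r i) * ?r j else 0)"
          using insert.hyps(1) t by simp
        also have "\<dots> = (\<Sum>j\<in>V. if \<rho> j < \<rho> i then (f i - r i) * r j else 0)"
          by (intro sum.cong) (use neq i in auto)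
        finally show "(\<Sum>j\<in>insert t V. if \<rho> j < \<rho> i then (f i - ?r i) * ?r j else 0) =
            (\<Sum>j\<in>V. if \<rho> j < \<rho> i then (f i - r i) * r j else 0)" .
      qed
      moreover have "(\<Sum>j\<in>insert t V. if \<rho> j < \<rho> t then (f t - ?r t) * ?r j else 0) = (f t - a) * (\<Sum>i\<in>V. r i)"
        unfolding sum_distrib_left using insert.hyps(1) t less neq
        by (auto intro!: sum.cong)
      ultimately have 3: "(\<Sum>i\<in>insert t V. \<Sum>j\<in>insert t V. if \<rho> j < \<rho> i then (f i - ?r i) * ?r j else 0)
          = (f t - a) * (\<Sum>i\<in>V. r i) + E r"
        by (subst sum.insert[OF insert.hyps(1) t]) simp
      show "p ^ (\<Sum>i\<in>insert t V. \<Sum>j\<in>insert t V. if \<rho> j < \<rho> i then (f i - ?r i) * ?r j else 0) *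
          (\<Prod>i\<in>insert t V. U (f i - ?r i) * U (?r i)) * g (\<Sum>i\<in>insert t V. ?r i) =
          U (f t - a) * U a * (p ^ E r * W r * (p ^ ((f t - a) * (\<Sum>i\<in>V. r i)) * g ((\<Sum>i\<in>V. r i) + a)))"
        unfolding 3
        unfolding prod.insert[OF insert.hyps(1) t] sum.insert[OF insert.hyps(1) t] 1 2
        by (simp add: power_add mult_ac add.commute)
    qed
    also have "\<dots> = (\<Sum>a\<le>f t. U (f t - a) * U a *
        ((\<Prod>i\<in>V. U (f i)) * qbinom_sum p (\<Sum>i\<in>V. f i) (\<lambda>M. p ^ ((f t - a) * M) * g (M + a))))"
    proof (rule sum.cong[OF refl])
      fix a
      have "inj_on \<rho> V" using insert.prems by auto
      from insert.IH[OF this, of "\<lambda>M. p ^ ((f t - a) * M) * g (M + a)"]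
      show "(\<Sum>r\<in>dominated V f. U (f t - a) * U a *
          (p ^ E r * W r * (p ^ ((f t - a) * (\<Sum>i\<in>V. r i)) * g ((\<Sum>i\<in>V. r i) + a)))) =
        U (f t - a) * U a *
          ((\<Prod>i\<in>V. U (f i)) * qbinom_sum p (\<Sum>i\<in>V. f i) (\<lambda>M. p ^ ((f t - a) * M) * g (M + a)))"
        by (simp add: E_def W_def sum_distrib_left[symmetric])
    qed
    also have "\<dots> = (\<Prod>i\<in>V. U (f i)) * qbinom_sum p (\<Sum>i\<in>V. f i)
        (\<lambda>M. \<Sum>a\<le>f t. (U (f t - a) * U a) * (p ^ ((f t - a) * M) * g (M + a)))"
      unfolding qbinom_sum_linear sum_distrib_left by (simp add: mult_ac)
    also have "(\<lambda>M. \<Sum>a\<le>f t. (U (f t - a) * U a) * (p ^ ((f t - a) * M) * g (M + a))) =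
        (\<lambda>M. U (f t) * (qstep p ^^ f t) g M)"
      by (simp add: qstep_funpow_eq_sum[OF U] mult.assoc)
    also have "(\<Prod>i\<in>V. U (f i)) * qbinom_sum p (\<Sum>i\<in>V. f i) (\<lambda>M. U (f t) * (qstep p ^^ f t) g M) =
        (\<Prod>i\<in>insert t V. U (f i)) * qbinom_sum p (\<Sum>i\<in>insert t V. f i) g"
      unfolding qbinom_sum_scale qbinom_sum_add[symmetric]
      using insert.hyps(1) t by (simp add: mult_ac add.commute)
    finally show ?thesis .
  qed
qed

text \<open>The T of the overview, with p in the place of P: the power p^(M^2) comes from the shift
  l = 2 \<epsilon> among the copies, and \<kappa>^M from their parameters.\<close>

definition split_op :: "'a :: comm_ring_1 \<Rightarrow> 'a \<Rightarrow> (nat \<Rightarrow> 'a) \<Rightarrow> nat \<Rightarrow> 'a" where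
  "split_op p \<kappa> g N = qbinom_sum p N (\<lambda>M. p ^ (M * M) * \<kappa> ^ M * g M)"

lemma split_op_fixed:
  assumes A: "\<And>n. A n = (1 - p ^ Suc n * \<kappa>) * A (Suc n)"
  shows "split_op p \<kappa> A = A"
proof
  fix N
  \<comment> \<open>\<open>\<Phi> n\<close> is the summand after the dilation \<open>\<kappa> \<mapsto> p\<^sup>n \<kappa>\<close>; Pascal's step acts on it as one more dilation.\<close>
  define \<Phi> where "\<Phi> = (\<lambda>n M. p ^ (M * M) * (p ^ n * \<kappa>) ^ M * A (n + M))"
  have step: "qstep p (\<Phi> n) = \<Phi> (Suc n)" for n
  proof
    fix M
    have 1: "\<Phi> n (Suc M) = p ^ (M * M) * p ^ M * (p ^ n * \<kappa>) ^ M * (p ^ Suc (n + M) * \<kappa>) * A (Suc (n + M))"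
      by (simp add: \<Phi>_def power_add mult_ac)
    have 2: "p ^ M * \<Phi> n M = p ^ (M * M) * p ^ M * (p ^ n * \<kappa>) ^ M * (1 - p ^ Suc (n + M) * \<kappa>) * A (Suc (n + M))"
      by (simp only: \<Phi>_def A[of "n + M"] mult_ac)
    have "qstep p (\<Phi> n) M = p ^ (M * M) * p ^ M * (p ^ n * \<kappa>) ^ M * A (Suc (n + M))"
      unfolding qstep_def 1 2 by (simp only: ring_distribs) (simp add: mult_ac)
    also have "\<dots> = \<Phi> (Suc n) M"
      by (simp add: \<Phi>_def power_mult_distrib mult_ac)
    finally show "qstep p (\<Phi> n) M = \<Phi> (Suc n) M" .
  qed
  have "(qstep p ^^ N) (\<Phi> 0) = \<Phi> N"
    by (induction N) (simp_all add: step)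
  thus "split_op p \<kappa> A N = A N"
    by (simp add: split_op_def qbinom_sum_def) (simp add: \<Phi>_def)
qed

lemma split_op_diff: "split_op p \<kappa> (\<lambda>N. g N - h N) = (\<lambda>N. split_op p \<kappa> g N - split_op p \<kappa> h N)"
  unfolding split_op_def qbinom_sum_diff[symmetric] by (simp add: algebra_simps)

lemma split_op_scale: "split_op p \<kappa> (\<lambda>N. c * g N) = (\<lambda>N. c * split_op p \<kappa> g N)"
  unfolding split_op_def qbinom_sum_scale[symmetric] by (simp add: algebra_simps)

text \<open>The summand M = 0 is the only one without a factor \<kappa>, and g 0 = 0 removes it. For
  N = 0 it is the only summand, so vanishing at 0 persists under iteration.\<close>

lemma split_op_dvd:
  assumes "x dvd \<kappa>" "\<And>N. c dvd g N" "g 0 = 0"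
  shows "x * c dvd split_op p \<kappa> g N" "split_op p \<kappa> g 0 = 0"
proof -
  show "split_op p \<kappa> g 0 = 0" using assms by (simp add: split_op_def)
  show "x * c dvd split_op p \<kappa> g N"
    unfolding split_op_def
  proof (rule dvd_qbinom_sum)
    fix M
    show "x * c dvd p ^ (M * M) * \<kappa> ^ M * g M"
    proof (cases M)
      case (Suc m)
      have "x dvd p ^ (M * M) * \<kappa> ^ M" using assms(1) Suc by simp
      thus ?thesis using assms(2) by (intro mult_dvd_mono)
    qed (simp add: assms)
  qed
qed

text \<open>The preceding lemma is iterated on A - A(0), which vanishes at 0. Keeping A(0) as a
  factor avoids inverting it in a general ring.\<close>

lemma split_op_funpow_converges:
  assumes A: "split_op p \<kappa> A = A" and x: "x dvd \<kappa>"
  shows "x ^ L dvd A N - A 0 * (split_op p \<kappa> ^^ L) (\<lambda>_. 1) N"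
proof -
  have eq: "(split_op p \<kappa> ^^ L) (\<lambda>N. A N - A 0 * 1) = (\<lambda>N. A N - A 0 * (split_op p \<kappa> ^^ L) (\<lambda>_. 1) N)"
  proof (induction L)
    case (Suc L)
    show ?case
      by (simp only: funpow.simps comp_apply Suc.IH split_op_diff) (simp only: split_op_scale A)
  qed simp
  have "(\<forall>N. x ^ L dvd (split_op p \<kappa> ^^ L) (\<lambda>N. A N - A 0 * 1) N) \<and>
      (split_op p \<kappa> ^^ L) (\<lambda>N. A N - A 0 * 1) 0 = 0"
  proof (induction L)
    case (Suc L)
    thus ?case using split_op_dvd[OF x, of "x ^ L" "(split_op p \<kappa> ^^ L) (\<lambda>N. A N - A 0 * 1)" p]
      by simp
  qed simp
  thus ?thesis unfolding eq by blast
qed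

section \<open>Coefficients of motivic series\<close>

text \<open>Cutting at the total multiplicity makes all sums finite. Merging a copy with its
  original preserves the total, so one bound K serves both sides of every splitting
  identity.\<close>

definition bounded_vecs :: "'v set \<Rightarrow> nat \<Rightarrow> ('v \<Rightarrow> nat) set" where
  "bounded_vecs S K = {f. (\<forall>s. s \<notin> S \<longrightarrow> f s = 0) \<and> sum f S \<le> K}"

definition quad :: "'v set \<Rightarrow> 'v quiver \<Rightarrow> ('v \<Rightarrow> nat) \<Rightarrow> int" where
  "quad S Q f = (\<Sum>i\<in>S. \<Sum>j\<in>S. adj Q i j * int (f i) * int (f j))"

definition qterm :: "'v set \<Rightarrow> 'v quiver \<Rightarrow> ('v \<Rightarrow> nat) \<Rightarrow> series" where
  "qterm S Q f = mps_const ((- fls_X) powi quad S Q f) *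
    (\<Prod>i\<in>S. gpar Q i ^ f i * mps_const (inv_qfact (f i)))"

lemma finite_bounded_vecs: "finite S \<Longrightarrow> finite (bounded_vecs S K)"
proof -
  assume S: "finite S"
  have "f s \<le> K" if "f \<in> bounded_vecs S K" "s \<in> S" for f s
    using that S member_le_sum[of s S f] by (auto simp: bounded_vecs_def)
  hence "bounded_vecs S K \<subseteq> {f. \<forall>s. (s \<in> S \<longrightarrow> f s \<in> {..K}) \<and> (s \<notin> S \<longrightarrow> f s = 0)}"
    by (auto simp: bounded_vecs_def)
  thus ?thesis
    by (rule finite_subset) (intro finite_set_of_finite_funs S finite_atMost)
qed

lemma qterm_superset:
  assumes "finite T" "S \<subseteq> T" "\<And>s. s \<notin> S \<Longrightarrow> f s = 0"
  shows "qterm T Q f = qterm S Q f"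
proof -
  have "quad T Q f = (\<Sum>i\<in>S. \<Sum>j\<in>T. adj Q i j * int (f i) * int (f j))"
    unfolding quad_def by (rule sum.mono_neutral_right) (use assms in auto)
  also have "\<dots> = quad S Q f"
    unfolding quad_def
    by (intro sum.cong refl sum.mono_neutral_right) (use assms in auto)
  finally have 1: "quad T Q f = quad S Q f" .
  have "(\<Prod>i\<in>T. gpar Q i ^ f i * mps_const (inv_qfact (f i))) =
      (\<Prod>i\<in>S. gpar Q i ^ f i * mps_const (inv_qfact (f i)))"
    by (rule prod.mono_neutral_right) (use assms in auto)
  thus ?thesis by (simp add: qterm_def 1)
qed

lemma qterm_cong:
  assumes "\<And>i j. i \<in> S \<Longrightarrow> j \<in> S \<Longrightarrow> adj Q i j = adj Q' i j" "\<And>i. i \<in> S \<Longrightarrow> gpar Q i = gpar Q' i"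
  shows "qterm S Q f = qterm S Q' f"
  unfolding qterm_def quad_def using assms by simp

lemma motivic_series_qterm:
  "motivic_series Q = (\<Sum>\<^sub>\<infinity>d\<in>{d. Poly_Mapping.keys d \<subseteq> nodes Q}.
    qterm (Poly_Mapping.keys d) Q (Poly_Mapping.lookup d))"
  by (simp only: motivic_series_def qterm_def quad_def inv_qfact_def)

lemma qterm_ord:
  assumes "\<And>s. s \<in> S \<Longrightarrow> mps_ord_ge 1 (gpar Q s)"
  shows "mps_ord_ge (sum f S) (qterm S Q f)"
proof -
  have "mps_ord_ge (sum f S) (\<Prod>i\<in>S. gpar Q i ^ f i * mps_const (inv_qfact (f i)))"
    using assms
  proof (induction S rule: infinite_finite_induct)
    case (insert s S)
    have "mps_ord_ge (f s) (mps_const (inv_qfact (f s)) * gpar Q s ^ f s)"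
      by (intro mps_ord_ge_mult_left mps_ord_ge_power insert) simp
    hence "mps_ord_ge (f s + sum f S) ((gpar Q s ^ f s * mps_const (inv_qfact (f s))) *
        (\<Prod>i\<in>S. gpar Q i ^ f i * mps_const (inv_qfact (f i))))"
      by (intro mps_ord_ge_mult insert) (simp_all add: mult.commute insert)
    thus ?case using insert.hyps by simp
  qed auto
  thus ?thesis unfolding qterm_def by (rule mps_ord_ge_mult_left)
qed

lemma tendsto_finite_subsets_eventually_const:
  assumes "finite T" "T \<subseteq> A" "\<And>F. finite F \<Longrightarrow> T \<subseteq> F \<Longrightarrow> F \<subseteq> A \<Longrightarrow> h F = l"
  shows "(h \<longlongrightarrow> l) (finite_subsets_at_top A)"
  by (rule tendsto_eventually) (use assms in \<open>auto simp: eventually_finite_subsets_at_top\<close>)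

lemma infsum_mps_coeff:
  fixes h :: "'x \<Rightarrow> ('a, 'b :: {comm_ring_1, t2_space}) mps"
  assumes fin: "\<And>e. finite {d \<in> A. mps_coeff (h d) e \<noteq> 0}"
  shows "mps_coeff (\<Sum>\<^sub>\<infinity>d\<in>A. h d) e = (\<Sum>d | d \<in> A \<and> mps_coeff (h d) e \<noteq> 0. mps_coeff (h d) e)"
proof -
  define l where "l = Abs_mps (\<lambda>e. \<Sum>d | d \<in> A \<and> mps_coeff (h d) e \<noteq> 0. mps_coeff (h d) e)"
  have "(sum h \<longlongrightarrow> l) (finite_subsets_at_top A)"
    unfolding tendsto_mps_iff
  proof
    fix e
    let ?T = "{d \<in> A. mps_coeff (h d) e \<noteq> 0}"
    show "((\<lambda>F. mps_coeff (sum h F) e) \<longlongrightarrow> mps_coeff l e) (finite_subsets_at_top A)"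
    proof (rule tendsto_finite_subsets_eventually_const[of ?T])
      fix F assume F: "finite F" "?T \<subseteq> F" "F \<subseteq> A"
      have "(\<Sum>d\<in>F. mps_coeff (h d) e) = (\<Sum>d\<in>?T. mps_coeff (h d) e)"
        by (rule sum.mono_neutral_right) (use F in auto)
      thus "mps_coeff (sum h F) e = mps_coeff l e"
        by (simp add: l_def mps_coeff_sum)
    qed (use fin in auto)
  qed
  hence "(h has_sum l) A" by (simp add: has_sum_def)
  hence "infsum h A = l" by (rule infsumI)
  thus ?thesis by (simp add: l_def)
qed

lemma bij_betw_lookup_bounded_vecs:
  assumes S: "finite S"
  shows "bij_betw Poly_Mapping.lookup {d. Poly_Mapping.keys d \<subseteq> S \<and> pm_deg d \<le> K} (bounded_vecs S K)"
proof (rule bij_betw_byWitness[where f' = Abs_poly_mapping])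
  have fin: "finite {s. f s \<noteq> 0}" if "f \<in> bounded_vecs S K" for f
    by (rule finite_subset[OF _ S]) (use that in \<open>auto simp: bounded_vecs_def\<close>)
  show "\<forall>f\<in>bounded_vecs S K. Poly_Mapping.lookup (Abs_poly_mapping f) = f"
    using fin by (simp add: Abs_poly_mapping_inverse)
  show "Abs_poly_mapping ` bounded_vecs S K \<subseteq> {d. Poly_Mapping.keys d \<subseteq> S \<and> pm_deg d \<le> K}"
  proof safe
    fix f assume f: "f \<in> bounded_vecs S K"
    have look: "Poly_Mapping.lookup (Abs_poly_mapping f) = f"
      using fin[OF f] by (simp add: Abs_poly_mapping_inverse)
    show keys: "s \<in> S" if "s \<in> Poly_Mapping.keys (Abs_poly_mapping f)" for s
      using that f by (auto simp: in_keys_iff look bounded_vecs_def)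
    show "pm_deg (Abs_poly_mapping f) \<le> K"
      using f keys by (subst pm_deg_superset[OF S]) (auto simp: look bounded_vecs_def)
  qed
  show "Poly_Mapping.lookup ` {d. Poly_Mapping.keys d \<subseteq> S \<and> pm_deg d \<le> K} \<subseteq> bounded_vecs S K"
    by (auto simp: bounded_vecs_def pm_deg_superset[OF S, symmetric] in_keys_iff)
qed simp

text \<open>A term has order at least its total multiplicity, which gives the cut K, and it is a
  multiple of the parameter of each node in its support, which discards the nodes outside S.
  Assumption \<open>ex\<close> ranges over all monomials because the infinite sum has to converge as
  a whole; S is tied to e only.\<close>

lemma motivic_series_coeff:
  assumes ord: "\<And>s. s \<in> nodes Q \<Longrightarrow> mps_ord_ge 1 (gpar Q s)"
    and ex: "\<And>e. \<exists>S. finite S \<and> (\<forall>s\<in>nodes Q - S. \<forall>f. gpar Q s dvd f \<longrightarrow> mps_coeff f e = 0)"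
    and S: "finite S" "S \<subseteq> nodes Q"
      "\<And>s f. s \<in> nodes Q - S \<Longrightarrow> gpar Q s dvd f \<Longrightarrow> mps_coeff f e = 0"
    and K: "pm_deg e \<le> K"
  shows "mps_coeff (motivic_series Q) e = mps_coeff (\<Sum>f\<in>bounded_vecs S K. qterm S Q f) e"
proof -
  let ?h = "\<lambda>d. qterm (Poly_Mapping.keys d) Q (Poly_Mapping.lookup d)"
  let ?A = "{d. Poly_Mapping.keys d \<subseteq> nodes Q}"
  have deg: "pm_deg d \<le> pm_deg e" if "d \<in> ?A" "mps_coeff (?h d) e \<noteq> 0" for d e
  proof (rule ccontr)
    have "mps_ord_ge (pm_deg d) (?h d)"
      unfolding pm_deg_def using that ord by (intro qterm_ord) auto
    moreover assume "\<not> pm_deg d \<le> pm_deg e"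
    ultimately show False using that by (auto simp: mps_ord_ge_def)
  qed
  have dvd: "gpar Q s dvd ?h d" if s: "s \<in> Poly_Mapping.keys d" for s d
  proof -
    have "gpar Q s dvd gpar Q s ^ Poly_Mapping.lookup d s * mps_const (inv_qfact (Poly_Mapping.lookup d s))"
      using s by (intro dvd_mult2 dvd_power) (auto simp: in_keys_iff)
    also have "\<dots> dvd (\<Prod>i\<in>Poly_Mapping.keys d. gpar Q i ^ Poly_Mapping.lookup d i *
        mps_const (inv_qfact (Poly_Mapping.lookup d i)))"
      using s by (intro dvd_prodI) auto
    finally show ?thesis unfolding qterm_def by (rule dvd_mult)
  qed
  have keys: "Poly_Mapping.keys d \<subseteq> T"
    if "d \<in> ?A" "mps_coeff (?h d) e \<noteq> 0" "\<forall>s\<in>nodes Q - T. \<forall>f. gpar Q s dvd f \<longrightarrow> mps_coeff f e = 0" for d e T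
    using that dvd by blast
  have fin: "finite {d \<in> ?A. mps_coeff (?h d) e \<noteq> 0}" for e
  proof -
    obtain T where T: "finite T" "\<forall>s\<in>nodes Q - T. \<forall>f. gpar Q s dvd f \<longrightarrow> mps_coeff f e = 0"
      using ex by blast
    have "{d \<in> ?A. mps_coeff (?h d) e \<noteq> 0} \<subseteq> {d. Poly_Mapping.keys d \<subseteq> T \<and> pm_deg d \<le> pm_deg e}"
      using keys[OF _ _ T(2)] deg by blast
    thus ?thesis
      by (rule finite_subset)
        (use bij_betw_finite[OF bij_betw_lookup_bounded_vecs[OF T(1)]] finite_bounded_vecs[OF T(1)] in blast)
  qed
  let ?B = "{d. Poly_Mapping.keys d \<subseteq> S \<and> pm_deg d \<le> K}"
  have "mps_coeff (motivic_series Q) e = (\<Sum>d | d \<in> ?A \<and> mps_coeff (?h d) e \<noteq> 0. mps_coeff (?h d) e)"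
    unfolding motivic_series_qterm by (rule infsum_mps_coeff[OF fin])
  also have "\<dots> = (\<Sum>d\<in>?B. mps_coeff (?h d) e)"
  proof (rule sum.mono_neutral_left)
    show "finite ?B"
      using bij_betw_finite[OF bij_betw_lookup_bounded_vecs[OF S(1)]] finite_bounded_vecs[OF S(1)] by blast
    have "d \<in> ?B" if "d \<in> ?A" "mps_coeff (?h d) e \<noteq> 0" for d
      using keys[OF that] S(3) deg[OF that] K by auto
    thus "{d. d \<in> ?A \<and> mps_coeff (?h d) e \<noteq> 0} \<subseteq> ?B" by blast
    show "\<forall>d\<in>?B - {d. d \<in> ?A \<and> mps_coeff (?h d) e \<noteq> 0}. mps_coeff (?h d) e = 0"
      using S(2) by blast
  qed
  also have "\<dots> = (\<Sum>d\<in>?B. mps_coeff (qterm S Q (Poly_Mapping.lookup d)) e)"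
  proof (rule sum.cong[OF refl])
    fix d assume "d \<in> ?B"
    thus "mps_coeff (?h d) e = mps_coeff (qterm S Q (Poly_Mapping.lookup d)) e"
      by (subst qterm_superset[OF S(1), symmetric]) (auto simp: in_keys_iff)
  qed
  also have "\<dots> = (\<Sum>f\<in>bounded_vecs S K. mps_coeff (qterm S Q f) e)"
    by (rule sum.reindex_bij_betw[OF bij_betw_lookup_bounded_vecs[OF S(1)]])
  finally show ?thesis by (simp add: mps_coeff_sum)
qed

section \<open>Splitting and the motivic series\<close>

text \<open>
  For \<open>\<epsilon> = -1\<close> the Vandermonde sum is in base \<open>q\<^sup>-\<^sup>2\<close>: here \<open>U j = 1 / (q\<^sup>-\<^sup>2;q\<^sup>-\<^sup>2)\<^sub>j\<close>, and \<open>\<gamma>\<close> collects the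
  powers of \<open>q\<close> that arise from rewriting \<open>1 / (q\<^sup>2;q\<^sup>2)\<^sub>j\<close> in this base.
\<close>

lemma qbase_change:
  assumes "\<epsilon> = 1 \<and> k = 0 \<or> \<epsilon> = -1 \<and> k = -1"
  obtains U \<gamma> :: "nat \<Rightarrow> rat fls" where "U 0 = 1"
    "\<And>j. (1 - ((fls_X\<^sup>2) powi \<epsilon>) ^ Suc j) * U (Suc j) = U j"
    "\<And>a b. inv_qfact a * inv_qfact b * (fls_X\<^sup>2) powi (k * int (a * b)) = \<gamma> (a + b) * (U a * U b)"
  using assms
proof (elim disjE)
  assume "\<epsilon> = 1 \<and> k = 0"
  thus thesis
    using that[of inv_qfact "\<lambda>_. 1"] inv_qfact_Suc by simp
next
  assume ek: "\<epsilon> = -1 \<and> k = -1"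
  define Y :: "rat fls" where "Y = fls_X"
  have Y: "Y \<noteq> 0" by (simp add: Y_def)
  define U where "U = (\<lambda>j. (-1) ^ j * Y ^ (j * Suc j) * inv_qfact j)"
  define \<gamma> where "\<gamma> = (\<lambda>j. (-1) ^ j * inverse Y ^ (j * Suc j))"
  show thesis
  proof (rule that[of U \<gamma>])
    show "U 0 = 1" by (simp add: U_def)
    fix j
    define Z where "Z = (Y\<^sup>2) ^ Suc j"
    have Z: "Z \<noteq> 0" using Y by (simp add: Z_def)
    have "Suc j * Suc (Suc j) = j * Suc j + 2 * Suc j" by simp
    hence YZ: "Y ^ (Suc j * Suc (Suc j)) = Y ^ (j * Suc j) * Z"
      unfolding Z_def by (simp only: power_add power_mult)
    have u: "inv_qfact j = (1 - Z) * inv_qfact (Suc j)"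
      unfolding Z_def Y_def by (rule inv_qfact_Suc[symmetric])
    have "((Y\<^sup>2) powi \<epsilon>) ^ Suc j = inverse Z"
      using ek unfolding Z_def by (simp add: power_int_minus power_inverse del: power_Suc)
    hence "(1 - ((Y\<^sup>2) powi \<epsilon>) ^ Suc j) * U (Suc j) =
        (-1) ^ Suc j * Y ^ (j * Suc j) * inv_qfact (Suc j) * (Z - inverse Z * Z)"
      unfolding U_def YZ by (simp add: algebra_simps)
    also have "\<dots> = U j"
      using Z by (simp add: U_def u algebra_simps)
    finally show "(1 - ((fls_X\<^sup>2) powi \<epsilon>) ^ Suc j) * U (Suc j) = U j"
      unfolding Y_def .
  next
    fix a b
    have "(a + b) * Suc (a + b) = a * Suc a + b * Suc b + 2 * (a * b)"
      by (simp add: algebra_simps)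
    hence "\<gamma> (a + b) = (-1) ^ a * (-1) ^ b * inverse Y ^ (a * Suc a) * inverse Y ^ (b * Suc b) * inverse (Y\<^sup>2) ^ (a * b)"
      unfolding \<gamma>_def by (simp only: power_add power_mult power_inverse mult.assoc)
    hence "\<gamma> (a + b) * (U a * U b) = ((-1) ^ a * (-1) ^ a) * ((-1) ^ b * (-1) ^ b) *
       (inverse Y ^ (a * Suc a) * Y ^ (a * Suc a)) * (inverse Y ^ (b * Suc b) * Y ^ (b * Suc b)) *
       (inv_qfact a * inv_qfact b * inverse (Y\<^sup>2) ^ (a * b))"
      by (simp only: U_def mult_ac)
    also have "\<dots> = inv_qfact a * inv_qfact b * inverse (Y\<^sup>2) ^ (a * b)"
      using Y by (simp add: power_mult_distrib[symmetric] del: power_Suc)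
    also have "inverse (Y\<^sup>2) ^ (a * b) = (Y\<^sup>2) powi (k * int (a * b))"
      using ek by (simp add: power_int_minus power_inverse flip: of_nat_mult)
    finally show "inv_qfact a * inv_qfact b * (fls_X\<^sup>2) powi (k * int (a * b)) = \<gamma> (a + b) * (U a * U b)"
      unfolding Y_def ..
  qed
qed

abbreviation qbase :: "int \<Rightarrow> series" where
  "qbase \<epsilon> \<equiv> mps_const ((fls_X\<^sup>2) powi \<epsilon>)"

text \<open>One splitting without the numbering of the nodes: \<tau> sends a chosen node to its copy
  and \<rho> ranks the chosen nodes. For distinct chosen nodes the shifts k and k + 1 are 0 and
  \<epsilon> in some order, so a single condition on ranks describes both cases of (k, l).\<close>

locale node_splitting =
  fixes \<epsilon> k :: int and \<kappa> :: series and \<rho> :: "'v \<Rightarrow> int" and \<tau> :: "'v \<Rightarrow> 'v"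
    and S V :: "'v set" and Q Q' :: "'v quiver"
  assumes eps: "\<epsilon> = 1 \<and> k = 0 \<or> \<epsilon> = -1 \<and> k = -1"
    and S: "finite S" and V: "V \<subseteq> S" and \<tau>: "inj_on \<tau> V" "\<tau> ` V \<inter> S = {}" and \<rho>: "inj_on \<rho> V"
    and sym: "\<And>i j. i \<in> S \<Longrightarrow> j \<in> S \<Longrightarrow> adj Q i j = adj Q j i"
    and adj_old: "\<And>i j. i \<in> S \<Longrightarrow> j \<in> S \<Longrightarrow> adj Q' i j = adj Q i j"
    and adj_mixed: "\<And>i v. i \<in> S \<Longrightarrow> v \<in> V \<Longrightarrow> adj Q' i (\<tau> v) =
      adj Q i v + (if i \<in> V then (if \<rho> v < \<rho> i then \<epsilon> else 0) + (if i = v then k else 0) else 0)"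
    and adj_sym: "\<And>i v. i \<in> S \<Longrightarrow> v \<in> V \<Longrightarrow> adj Q' (\<tau> v) i = adj Q' i (\<tau> v)"
    and adj_new: "\<And>v v'. v \<in> V \<Longrightarrow> v' \<in> V \<Longrightarrow> adj Q' (\<tau> v) (\<tau> v') = adj Q v v' + 2 * \<epsilon>"
    and gpar_old: "\<And>i. i \<in> S \<Longrightarrow> gpar Q' i = gpar Q i"
    and gpar_new: "\<And>v. v \<in> V \<Longrightarrow> gpar Q' (\<tau> v) = \<kappa> * gpar Q v"
begin

lemma finite_V: "finite V"
  using S V finite_subset by blast

lemma sum_new: "sum h (S \<union> \<tau> ` V) = sum h S + (\<Sum>v\<in>V. h (\<tau> v))"
  using S finite_V \<tau> by (subst sum.union_disjoint) (auto simp: sum.reindex)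

lemma prod_new: "prod h (S \<union> \<tau> ` V) = prod h S * (\<Prod>v\<in>V. h (\<tau> v))"
  using S finite_V \<tau> by (subst prod.union_disjoint) (auto simp: prod.reindex)

definition inversions :: "('v \<Rightarrow> nat) \<Rightarrow> ('v \<Rightarrow> nat) \<Rightarrow> nat" where
  "inversions f r = (\<Sum>i\<in>V. \<Sum>j\<in>V. if \<rho> j < \<rho> i then (f i - r i) * r j else 0)"

text \<open>Write f = a + b with b the multiplicities of the copies. Without shifts the four blocks
  of old nodes and copies recombine to the form at f. The shifts of the two mixed blocks agree by
  symmetry and that of the copies is 2 \<epsilon>, so the excess is even and yields a power of q^2
  without sign.\<close>

lemma quad_new:
  assumes r: "r \<in> dominated V f" and f': "\<And>s. s \<in> S \<Longrightarrow> f' s = f s - r s" "\<And>v. v \<in> V \<Longrightarrow> f' (\<tau> v) = r v"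
  shows "quad (S \<union> \<tau> ` V) Q' f' = quad S Q f +
    2 * (\<epsilon> * int (inversions f r + sum r V * sum r V) + (\<Sum>v\<in>V. k * int ((f v - r v) * r v)))"
proof -
  define a b where "a = (\<lambda>i. int (f i - r i))" and "b = (\<lambda>i. int (r i))"
  have ab: "int (f i) = a i + b i" for i
    using r by (cases "i \<in> V") (auto simp: a_def b_def dominated_def)
  have b0: "b i = 0" if "i \<notin> V" for i using r that by (auto simp: b_def dominated_def)
  have sumV: "(\<Sum>v\<in>V. g v * b v) = (\<Sum>v\<in>S. g v * b v)" for g
    using S V b0 by (intro sum.mono_neutral_left) auto
  let ?C = "\<lambda>x y. \<Sum>i\<in>S. \<Sum>j\<in>S. adj Q i j * x i * y j"
  define I where "I = (\<Sum>i\<in>V. \<Sum>v\<in>V. if \<rho> v < \<rho> i then a i * b v else 0)"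
  define J where "J = (\<Sum>i\<in>V. a i * b i)"
  have SS: "(\<Sum>i\<in>S. \<Sum>j\<in>S. adj Q' i j * int (f' i) * int (f' j)) = ?C a a"
    by (intro sum.cong refl) (simp add: adj_old f' a_def)
  have SV: "(\<Sum>i\<in>S. \<Sum>v\<in>V. adj Q' i (\<tau> v) * int (f' i) * int (f' (\<tau> v))) = ?C a b + (\<epsilon> * I + k * J)"
  proof -
    have "(\<Sum>i\<in>S. \<Sum>v\<in>V. adj Q' i (\<tau> v) * int (f' i) * int (f' (\<tau> v))) =
      (\<Sum>i\<in>S. (\<Sum>v\<in>V. adj Q i v * a i * b v) + (if i \<in> V then (\<Sum>v\<in>V. \<epsilon> * (if \<rho> v < \<rho> i then a i * b v else 0) +
         k * (if v = i then a i * b v else 0)) else 0))"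
      unfolding if_distrib[of "\<lambda>x. _ + x"]
    proof (intro sum.cong refl)
      fix i assume i: "i \<in> S"
      show "(\<Sum>v\<in>V. adj Q' i (\<tau> v) * int (f' i) * int (f' (\<tau> v))) =
        (if i \<in> V then (\<Sum>v\<in>V. adj Q i v * a i * b v) + (\<Sum>v\<in>V. \<epsilon> * (if \<rho> v < \<rho> i then a i * b v else 0) +
         k * (if v = i then a i * b v else 0)) else (\<Sum>v\<in>V. adj Q i v * a i * b v) + 0)"
      proof (cases "i \<in> V")
        case True
        thus ?thesis using i
          by (simp only: if_True sum.distrib[symmetric], intro sum.cong refl)
            (auto simp: adj_mixed f' a_def b_def algebra_simps)
      next
        case False
        thus ?thesis using i by (auto simp: adj_mixed f' a_def b_def intro!: sum.cong)
      qed
    qed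
    also have "\<dots> = (\<Sum>i\<in>S. \<Sum>v\<in>V. adj Q i v * a i * b v) + (\<Sum>i\<in>V. \<Sum>v\<in>V. \<epsilon> * (if \<rho> v < \<rho> i then a i * b v else 0) +
         k * (if v = i then a i * b v else 0))"
      unfolding sum.distrib[of _ _ S] using S V
      by (subst sum.inter_restrict[symmetric]) (auto simp: Int_absorb1)
    also have "(\<Sum>i\<in>S. \<Sum>v\<in>V. adj Q i v * a i * b v) = ?C a b"
      by (simp only: sumV)
    also have "(\<Sum>i\<in>V. \<Sum>v\<in>V. \<epsilon> * (if \<rho> v < \<rho> i then a i * b v else 0) +
         k * (if v = i then a i * b v else 0)) = \<epsilon> * I + k * J"
      using finite_V by (simp add: I_def J_def sum.distrib flip: sum_distrib_left)
    finally show ?thesis .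
  qed
  have VS: "(\<Sum>v\<in>V. \<Sum>i\<in>S. adj Q' (\<tau> v) i * int (f' (\<tau> v)) * int (f' i)) = ?C a b + (\<epsilon> * I + k * J)"
    unfolding SV[symmetric] by (subst sum.swap) (intro sum.cong refl, simp add: adj_sym mult_ac)
  have VV: "(\<Sum>v\<in>V. \<Sum>v'\<in>V. adj Q' (\<tau> v) (\<tau> v') * int (f' (\<tau> v)) * int (f' (\<tau> v'))) =
      ?C b b + 2 * \<epsilon> * (sum b V * sum b V)"
  proof -
    have "(\<Sum>v\<in>V. \<Sum>v'\<in>V. adj Q' (\<tau> v) (\<tau> v') * int (f' (\<tau> v)) * int (f' (\<tau> v'))) =
        (\<Sum>v\<in>V. \<Sum>v'\<in>V. adj Q v v' * b v * b v' + 2 * \<epsilon> * (b v * b v'))"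
      by (intro sum.cong refl) (simp add: adj_new f' b_def algebra_simps)
    also have "\<dots> = (\<Sum>v\<in>V. (\<Sum>v'\<in>V. adj Q v v' * b v') * b v) + 2 * \<epsilon> * (sum b V * sum b V)"
      by (simp add: sum.distrib sum_product sum_distrib_left sum_distrib_right mult_ac)
    also have "(\<Sum>v\<in>V. (\<Sum>v'\<in>V. adj Q v v' * b v') * b v) = ?C b b"
      unfolding sumV by (simp add: sum_distrib_left sum_distrib_right mult_ac)
    finally show ?thesis .
  qed
  have "?C b a = (\<Sum>j\<in>S. \<Sum>i\<in>S. adj Q i j * b i * a j)" by (rule sum.swap)
  also have "\<dots> = ?C a b"
    by (intro sum.cong refl) (simp add: sym mult_ac)
  finally have "?C b a = ?C a b" .
  hence C: "quad S Q f = ?C a a + 2 * ?C a b + ?C b b"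
    by (simp add: quad_def ab algebra_simps sum.distrib)
  have I: "int (inversions f r) = I"
    unfolding I_def inversions_def of_nat_sum a_def b_def by (intro sum.cong refl) simp
  have "quad (S \<union> \<tau> ` V) Q' f' = ?C a a + 2 * (?C a b + (\<epsilon> * I + k * J)) + (?C b b + 2 * \<epsilon> * (sum b V * sum b V))"
    unfolding quad_def sum_new sum.distrib SS SV VS VV by simp
  also have "\<dots> = quad S Q f + 2 * (\<epsilon> * (I + sum b V * sum b V) + k * J)"
    unfolding C by (simp add: algebra_simps)
  finally show ?thesis
    by (simp add: I b_def a_def J_def sum_distrib_left)
qed

text \<open>\<open>f\<close> holds the multiplicities after merging each new node with its old one, \<open>r\<close> those of the new nodes.\<close>

definition split_vec :: "('v \<Rightarrow> nat) \<Rightarrow> ('v \<Rightarrow> nat) \<Rightarrow> 'v \<Rightarrow> nat" where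
  "split_vec f r = (\<lambda>s. if s \<in> \<tau> ` V then r (inv_into V \<tau> s) else f s - r s)"

lemma split_vec_old: "s \<in> S \<Longrightarrow> split_vec f r s = f s - r s"
  using \<tau> by (auto simp: split_vec_def)

lemma split_vec_new: "v \<in> V \<Longrightarrow> split_vec f r (\<tau> v) = r v"
  using \<tau> by (simp add: split_vec_def)

lemma sum_split_vec:
  assumes "r \<in> dominated V f"
  shows "sum (split_vec f r) (S \<union> \<tau> ` V) = sum f S" "sum (split_vec f r) (\<tau> ` V) = sum r V"
proof -
  have "sum r V = sum r S"
    using S V assms by (intro sum.mono_neutral_left) (auto simp: dominated_def)
  moreover have "f s - r s + r s = f s" for s
    using assms by (cases "s \<in> V") (auto simp: dominated_def)
  ultimately show "sum (split_vec f r) (S \<union> \<tau> ` V) = sum f S"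
    unfolding sum_new by (simp add: split_vec_old split_vec_new flip: sum.distrib)
  show "sum (split_vec f r) (\<tau> ` V) = sum r V"
    using \<tau> by (simp add: sum.reindex split_vec_new)
qed

text \<open>A vector on the split quiver is the same as its merged vector f together with the share
  r \<le> f that goes to the copies.\<close>

lemma sum_bounded_vecs_new:
  "(\<Sum>f\<in>bounded_vecs (S \<union> \<tau> ` V) K. h f) = (\<Sum>f\<in>bounded_vecs S K. \<Sum>r\<in>dominated V f. h (split_vec f r))"
proof -
  have fin: "finite (dominated V f)" for f
    by (rule finite_subset[OF _ finite_bounded_vecs[OF finite_V, of "sum f V"]])
      (auto simp: dominated_def bounded_vecs_def intro: sum_mono)
  define merge where "merge = (\<lambda>f s. if s \<in> S then f s + (if s \<in> V then f (\<tau> s) else 0) else 0 :: nat)"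
  have inverse: "split_vec (merge f) (\<lambda>s. if s \<in> V then f (\<tau> s) else 0) = f"
    if "f \<in> bounded_vecs (S \<union> \<tau> ` V) K" for f
    using that V \<tau> by (auto simp: merge_def split_vec_def bounded_vecs_def fun_eq_iff inv_into_into)
  have "(\<Sum>f\<in>bounded_vecs (S \<union> \<tau> ` V) K. h f) = (\<Sum>(f, r)\<in>Sigma (bounded_vecs S K) (dominated V). h (split_vec f r))"
  proof (rule sum.reindex_bij_witness[where i = "\<lambda>(f, r). split_vec f r" and
        j = "\<lambda>f. (merge f, \<lambda>s. if s \<in> V then f (\<tau> s) else 0)"],
      goal_cases)
    case (1 f)
    thus ?case by (simp add: inverse)
  next
    case (5 f)
    thus ?case by (simp add: inverse)
  next
    case (2 f)
    have "(\<Sum>s\<in>S. f s + (if s \<in> V then f (\<tau> s) else 0)) = sum f (S \<union> \<tau> ` V)"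
      unfolding sum_new sum.distrib using S V
      by (subst sum.inter_restrict[symmetric]) (auto simp: Int_absorb1)
    moreover have "(\<Sum>s\<in>S. if s \<in> S then f s + (if s \<in> V then f (\<tau> s) else 0) else 0) =
        (\<Sum>s\<in>S. f s + (if s \<in> V then f (\<tau> s) else 0))"
      by (intro sum.cong) auto
    ultimately show ?case using 2 V by (auto simp: merge_def bounded_vecs_def dominated_def)
  next
    case (3 fr)
    obtain f r where fr: "fr = (f, r)" by fastforce
    have "f s = 0" if "s \<notin> S" for s using 3 that by (auto simp: fr bounded_vecs_def)
    moreover have "r s = 0" if "s \<notin> V" for s using 3 that by (auto simp: fr dominated_def)
    moreover have "r s \<le> f s" if "s \<in> V" for s using 3 that by (auto simp: fr dominated_def)
    ultimately show ?case using V
      by (auto simp: merge_def fr split_vec_old split_vec_new fun_eq_iff)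
  next
    case (4 fr)
    obtain f r where fr: "fr = (f, r)" by fastforce
    have r: "r \<in> dominated V f" and f: "f \<in> bounded_vecs S K" using 4 by (auto simp: fr)
    have "split_vec f r s = 0" if "s \<notin> S \<union> \<tau> ` V" for s
      using that f by (auto simp: split_vec_def bounded_vecs_def)
    thus ?case
      using f unfolding fr bounded_vecs_def by (simp add: sum_split_vec[OF r])
  qed
  thus ?thesis
    using finite_bounded_vecs[OF S] fin by (simp add: sum.Sigma)
qed

text \<open>The last bracket gathers everything that depends on r. The diagonal shift k is kept with
  the q-factorials of its node, in the shape in which \<open>qbase_change\<close> absorbs
  it.\<close>

lemma qterm_new:
  assumes r: "r \<in> dominated V f"
  shows "qterm (S \<union> \<tau> ` V) Q' (split_vec f r) =
    mps_const ((- fls_X) powi quad S Q f) * (\<Prod>s\<in>S. gpar Q s ^ f s) *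
    (\<Prod>s\<in>S - V. mps_const (inv_qfact (f s))) *
    (qbase \<epsilon> ^ inversions f r *
      (\<Prod>v\<in>V. mps_const (inv_qfact (f v - r v) * inv_qfact (r v) * (fls_X\<^sup>2) powi (k * int ((f v - r v) * r v)))) *
      (qbase \<epsilon> ^ (sum r V * sum r V) * \<kappa> ^ sum r V))"
proof -
  have X: "fls_X \<noteq> (0 :: rat fls)" "(fls_X\<^sup>2) \<noteq> (0 :: rat fls)" by simp_all
  have powi_sum: "x powi (\<Sum>v\<in>V. g v) = (\<Prod>v\<in>V. x powi g v)" if "x \<noteq> 0" for x :: "rat fls" and g
    using finite_V by (induction V rule: finite_induct) (simp_all add: power_int_add that)
  have sq: "(- fls_X) powi (2 * z) = (fls_X\<^sup>2 :: rat fls) powi z" for z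
    by (simp only: power_int_mult) (simp add: power_int_numeral)
  have add_sq: "(- fls_X) powi (y + 2 * z) = (- fls_X) powi y * (fls_X\<^sup>2 :: rat fls) powi z" for y z
    unfolding sq[symmetric] using X by (intro power_int_add) simp
  have q: "quad (S \<union> \<tau> ` V) Q' (split_vec f r) = quad S Q f +
      2 * (\<epsilon> * int (inversions f r + sum r V * sum r V) + (\<Sum>v\<in>V. k * int ((f v - r v) * r v)))"
    by (rule quad_new[OF r]) (simp_all add: split_vec_old split_vec_new)
  have "((- fls_X) powi quad (S \<union> \<tau> ` V) Q' (split_vec f r) :: rat fls) = (- fls_X) powi quad S Q f *
      (fls_X\<^sup>2) powi (\<epsilon> * int (inversions f r + sum r V * sum r V) + (\<Sum>v\<in>V. k * int ((f v - r v) * r v)))"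
    unfolding q by (rule add_sq)
  also have "\<dots> = (- fls_X) powi quad S Q f * (((fls_X\<^sup>2) powi \<epsilon>) ^ inversions f r * ((fls_X\<^sup>2) powi \<epsilon>) ^ (sum r V * sum r V) *
      (\<Prod>v\<in>V. (fls_X\<^sup>2) powi (k * int ((f v - r v) * r v))))"
  proof -
    have "(fls_X\<^sup>2) powi (\<epsilon> * int n) = ((fls_X\<^sup>2 :: rat fls) powi \<epsilon>) ^ n" for n
      by (simp only: power_int_mult power_int_of_nat)
    thus ?thesis
      by (simp only: power_int_add[OF disjI1[OF X(2)]] powi_sum[OF X(2)] power_add)
  qed
  finally have 1: "((- fls_X) powi quad (S \<union> \<tau> ` V) Q' (split_vec f r) :: rat fls) = \<dots>" .
  have "(\<Prod>s\<in>S. gpar Q s ^ (f s - r s)) * (\<Prod>v\<in>V. (\<kappa> * gpar Q v) ^ r v) =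
      (\<Prod>s\<in>S. gpar Q s ^ (f s - r s)) * (\<Prod>s\<in>S. gpar Q s ^ r s) * \<kappa> ^ sum r V"
  proof -
    have "(\<Prod>v\<in>V. gpar Q v ^ r v) = (\<Prod>s\<in>S. gpar Q s ^ r s)"
      using S V r by (intro prod.mono_neutral_left) (auto simp: dominated_def)
    thus ?thesis by (simp add: power_mult_distrib prod.distrib power_sum mult_ac)
  qed
  also have "(\<Prod>s\<in>S. gpar Q s ^ (f s - r s)) * (\<Prod>s\<in>S. gpar Q s ^ r s) = (\<Prod>s\<in>S. gpar Q s ^ f s)"
    unfolding prod.distrib[symmetric] power_add[symmetric]
  proof (intro prod.cong refl)
    fix s
    have "f s - r s + r s = f s" using r by (cases "s \<in> V") (auto simp: dominated_def)
    thus "gpar Q s ^ (f s - r s + r s) = gpar Q s ^ f s" by simp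
  qed
  finally have 2: "(\<Prod>s\<in>S. gpar Q s ^ (f s - r s)) * (\<Prod>v\<in>V. (\<kappa> * gpar Q v) ^ r v) =
      (\<Prod>s\<in>S. gpar Q s ^ f s) * \<kappa> ^ sum r V" .
  have 3: "(\<Prod>s\<in>S. mps_const (inv_qfact (f s - r s)) :: series) =
      (\<Prod>s\<in>S - V. mps_const (inv_qfact (f s))) * (\<Prod>v\<in>V. mps_const (inv_qfact (f v - r v)))"
  proof -
    have "(\<Prod>s\<in>S - V. mps_const (inv_qfact (f s - r s)) :: series) = (\<Prod>s\<in>S - V. mps_const (inv_qfact (f s)))"
      using r by (intro prod.cong) (auto simp: dominated_def)
    thus ?thesis by (subst prod.subset_diff[OF V S]) simp
  qed
  have "(\<Prod>s\<in>S \<union> \<tau> ` V. gpar Q' s ^ split_vec f r s * mps_const (inv_qfact (split_vec f r s))) =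
      ((\<Prod>s\<in>S. gpar Q s ^ (f s - r s)) * (\<Prod>v\<in>V. (\<kappa> * gpar Q v) ^ r v)) *
      ((\<Prod>s\<in>S. mps_const (inv_qfact (f s - r s))) * (\<Prod>v\<in>V. mps_const (inv_qfact (r v))))"
    unfolding prod_new
    by (simp add: split_vec_old split_vec_new gpar_old gpar_new prod.distrib mult_ac)
  also have "\<dots> = (\<Prod>s\<in>S. gpar Q s ^ f s) * \<kappa> ^ sum r V *
      ((\<Prod>s\<in>S - V. mps_const (inv_qfact (f s))) * (\<Prod>v\<in>V. mps_const (inv_qfact (f v - r v))) *
      (\<Prod>v\<in>V. mps_const (inv_qfact (r v))))"
    by (simp only: 2 3)
  finally show ?thesis
    unfolding qterm_def 1 mps_const_mult mps_const_prod mps_const_power prod.distrib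
    by (simp only: mult_ac)
qed

text \<open>For fixed f the sum over r is the Vandermonde sum of the function P^(M^2) \<kappa>^M
  g(M), after the q-factorials have been rewritten in base P.\<close>

lemma sum_qterm_new:
  "(\<Sum>f\<in>bounded_vecs (S \<union> \<tau> ` V) K. qterm (S \<union> \<tau> ` V) Q' f * g (sum f (\<tau> ` V))) =
   (\<Sum>f\<in>bounded_vecs S K. qterm S Q f * split_op (qbase \<epsilon>) \<kappa> g (sum f V))"
  unfolding sum_bounded_vecs_new
proof (rule sum.cong[OF refl])
  fix f
  obtain U \<gamma> where U: "U 0 = 1" "\<And>j. (1 - ((fls_X\<^sup>2) powi \<epsilon>) ^ Suc j) * U (Suc j) = U j"
    and \<gamma>: "\<And>a b. inv_qfact a * inv_qfact b * (fls_X\<^sup>2) powi (k * int (a * b)) = \<gamma> (a + b) * (U a * U b)"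
    by (rule qbase_change[OF eps]) metis
  \<comment> \<open>The case b = 0 of the base change turns U back into 1/(q^2;q^2) once the sum has
    been evaluated.\<close>
  have \<gamma>0: "\<gamma> a * U a = inv_qfact a" for a
    using \<gamma>[of a 0] U(1) by simp
  define M where "M = mps_const ((- fls_X) powi quad S Q f) * (\<Prod>s\<in>S. gpar Q s ^ f s) *
    (\<Prod>s\<in>S - V. mps_const (inv_qfact (f s)))"
  define G where "G = (\<Prod>v\<in>V. mps_const (\<gamma> (f v)) :: series)"
  have unit: "(1 - qbase \<epsilon> ^ Suc j) dvd 1" for j
  proof -
    have "((fls_X\<^sup>2) powi \<epsilon>) ^ Suc j \<noteq> (1 :: rat fls)"
      using fls_X_power_neq_1[of "2 * Suc j"] eps unfolding power_mult
      by (auto simp: power_int_minus power_inverse simp del: power_Suc)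
    hence "1 - ((fls_X\<^sup>2) powi \<epsilon>) ^ Suc j \<noteq> (0 :: rat fls)" by simp
    hence "(1 - ((fls_X\<^sup>2) powi \<epsilon>) ^ Suc j) * inverse (1 - ((fls_X\<^sup>2) powi \<epsilon>) ^ Suc j) = (1 :: rat fls)"
      by (rule right_inverse)
    hence "mps_const (1 - ((fls_X\<^sup>2) powi \<epsilon>) ^ Suc j) * mps_const (inverse (1 - ((fls_X\<^sup>2) powi \<epsilon>) ^ Suc j)) = (1 :: series)"
      by (simp only: mps_const_mult[symmetric] mps_const_1)
    hence "mps_const (1 - ((fls_X\<^sup>2) powi \<epsilon>) ^ Suc j) dvd (1 :: series)"
      by (metis dvd_triv_left)
    thus ?thesis by (simp only: mps_const_diff mps_const_power mps_const_1)
  qed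
  have "(\<Sum>r\<in>dominated V f. qterm (S \<union> \<tau> ` V) Q' (split_vec f r) * g (sum (split_vec f r) (\<tau> ` V))) =
      (\<Sum>r\<in>dominated V f. M * G * (qbase \<epsilon> ^ (\<Sum>i\<in>V. \<Sum>j\<in>V. if \<rho> j < \<rho> i then (f i - r i) * r j else 0) *
        (\<Prod>i\<in>V. mps_const (U (f i - r i)) * mps_const (U (r i))) *
        (qbase \<epsilon> ^ (sum r V * sum r V) * \<kappa> ^ sum r V * g (sum r V))))"
  proof (rule sum.cong[OF refl])
    fix r assume r: "r \<in> dominated V f"
    have "(\<Prod>v\<in>V. mps_const (inv_qfact (f v - r v) * inv_qfact (r v) * (fls_X\<^sup>2) powi (k * int ((f v - r v) * r v)))) =
        (\<Prod>v\<in>V. mps_const (\<gamma> (f v)) * (mps_const (U (f v - r v)) * mps_const (U (r v))) :: series)"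
    proof (rule prod.cong[OF refl])
      fix v assume "v \<in> V"
      hence "f v - r v + r v = f v" using r by (auto simp: dominated_def)
      thus "mps_const (inv_qfact (f v - r v) * inv_qfact (r v) * (fls_X\<^sup>2) powi (k * int ((f v - r v) * r v))) =
          (mps_const (\<gamma> (f v)) * (mps_const (U (f v - r v)) * mps_const (U (r v))) :: series)"
        by (simp only: \<gamma> mps_const_mult)
    qed
    also have "\<dots> = G * (\<Prod>i\<in>V. mps_const (U (f i - r i)) * mps_const (U (r i)))"
      by (simp add: G_def prod.distrib)
    finally show "qterm (S \<union> \<tau> ` V) Q' (split_vec f r) * g (sum (split_vec f r) (\<tau> ` V)) =
        M * G * (qbase \<epsilon> ^ (\<Sum>i\<in>V. \<Sum>j\<in>V. if \<rho> j < \<rho> i then (f i - r i) * r j else 0) *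
        (\<Prod>i\<in>V. mps_const (U (f i - r i)) * mps_const (U (r i))) *
        (qbase \<epsilon> ^ (sum r V * sum r V) * \<kappa> ^ sum r V * g (sum r V)))"
      unfolding qterm_new[OF r] sum_split_vec[OF r] M_def inversions_def by (simp only: mult_ac)
  qed
  also have "\<dots> = M * G * ((\<Prod>i\<in>V. mps_const (U (f i))) * split_op (qbase \<epsilon>) \<kappa> g (sum f V))"
    unfolding sum_distrib_left[symmetric] split_op_def
    by (subst qvandermonde[where U = "\<lambda>j. mps_const (U j)" and \<rho> = \<rho> and
          g = "\<lambda>M. qbase \<epsilon> ^ (M * M) * \<kappa> ^ M * g M"])
      (use U unit finite_V \<rho> in \<open>simp_all only: mps_const_1 mps_const_power[symmetric]
        mps_const_diff[of 1, unfolded mps_const_1, symmetric] mps_const_mult[symmetric]\<close>)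
  also have "M * G * ((\<Prod>i\<in>V. mps_const (U (f i))) * split_op (qbase \<epsilon>) \<kappa> g (sum f V)) =
      M * (\<Prod>i\<in>V. mps_const (inv_qfact (f i))) * split_op (qbase \<epsilon>) \<kappa> g (sum f V)"
    unfolding \<gamma>0[symmetric] mps_const_mult prod.distrib G_def by (simp only: mult_ac)
  also have "M * (\<Prod>i\<in>V. mps_const (inv_qfact (f i))) = qterm S Q f"
    unfolding M_def qterm_def prod.distrib prod.subset_diff[OF V S, of "\<lambda>s. mps_const (inv_qfact (f s))"]
    by (simp only: mult_ac)
  finally show "(\<Sum>r\<in>dominated V f. qterm (S \<union> \<tau> ` V) Q' (split_vec f r) * g (sum (split_vec f r) (\<tau> ` V))) =
      qterm S Q f * split_op (qbase \<epsilon>) \<kappa> g (sum f V)" .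
qed

end

section \<open>Growth by splitting\<close>

text \<open>For \<open>\<epsilon> = -1\<close> the order given by \<open>\<sigma>\<close> has to be reversed, hence the factor \<open>\<epsilon>\<close> in front of it.\<close>

lemma is_splitting_node_splitting:
  assumes eps: "\<epsilon> = 1 \<and> k = 0 \<or> \<epsilon> = -1 \<and> k = -1"
    and split: "is_splitting k (2 * \<epsilon>) n \<kappa> \<sigma> (\<lambda>_. 0) Q w Q' w'"
    and sym: "symmetric_quiver Q" and fin: "finite (nodes Q)"
  shows "node_splitting \<epsilon> k \<kappa> (\<lambda>v. \<epsilon> * int (\<sigma> (inv_into {1..n} w v))) (\<lambda>v. w' (inv_into {1..n} w v))
    (nodes Q) (w ` {1..n}) Q Q'"
proof -
  note split = split[unfolded is_splitting_def]
  have w: "inj_on w {1..n}" "w ` {1..n} \<subseteq> nodes Q" and w': "inj_on w' {1..n}" "w' ` {1..n} \<inter> nodes Q = {}"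
    and nodes': "nodes Q' = nodes Q \<union> w' ` {1..n}" and sym': "symmetric_quiver Q'"
    and \<sigma>: "\<sigma> permutes {1..n}" using split by auto
  have old: "\<And>i j. i \<in> nodes Q \<Longrightarrow> j \<in> nodes Q \<Longrightarrow> adj Q' i j = adj Q i j"
    and spec: "\<And>s a. s \<in> nodes Q - w ` {1..n} \<Longrightarrow> a \<in> {1..n} \<Longrightarrow> adj Q' s (w' a) = adj Q s (w a)"
    and diag: "\<And>a. a \<in> {1..n} \<Longrightarrow> adj Q' (w a) (w' a) = adj Q (w a) (w a) + k"
    and new: "\<And>a b. a \<in> {1..n} \<Longrightarrow> b \<in> {1..n} \<Longrightarrow> adj Q' (w' a) (w' b) = adj Q (w a) (w b) + 2 * \<epsilon>"
    using split by auto
  have ordered: "if \<sigma> a < \<sigma> b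
       then adj Q' (w a) (w' b) = adj Q (w a) (w b) + k \<and> adj Q' (w' a) (w b) = adj Q (w a) (w b) + k + 1
       else adj Q' (w a) (w' b) = adj Q (w a) (w b) + k + 1 \<and> adj Q' (w' a) (w b) = adj Q (w a) (w b) + k"
    if "a \<in> {1..n}" "b \<in> {1..n}" "a < b" for a b
    using split that by blast
  have adj_sym: "adj Q' i j = adj Q' j i" if "i \<in> nodes Q'" "j \<in> nodes Q'" for i j
    using sym' that by (simp add: symmetric_quiver_def)
  have \<sigma>_eq: "\<sigma> a = \<sigma> b \<longleftrightarrow> a = b" for a b
    using permutes_inj[OF \<sigma>] by (auto dest: injD)
  have mixed: "adj Q' (w a) (w' b) = adj Q (w a) (w b) +
      ((if \<epsilon> * int (\<sigma> b) < \<epsilon> * int (\<sigma> a) then \<epsilon> else 0) + (if a = b then k else 0))"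
    if ab: "a \<in> {1..n}" "b \<in> {1..n}" for a b
  proof (cases a b rule: linorder_cases)
    case less
    thus ?thesis using ordered[OF ab less] eps \<sigma>_eq[of a b]
      by (auto split: if_splits)
  next
    case equal
    thus ?thesis using diag ab by simp
  next
    \<comment> \<open>The definition lists the mixed entries for a < b only; the opposite order is
      read through the symmetry of both quivers.\<close>
    case greater
    have "adj Q' (w' b) (w a) = adj Q' (w a) (w' b)"
      by (rule adj_sym) (use ab w nodes' in auto)
    moreover have "w a \<in> nodes Q" "w b \<in> nodes Q" using ab w by auto
    hence "adj Q (w b) (w a) = adj Q (w a) (w b)"
      using sym unfolding symmetric_quiver_def by blast
    ultimately show ?thesis using ordered[OF ab(2,1) greater] eps \<sigma>_eq[of a b] greater
      by (auto split: if_splits)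
  qed
  show ?thesis
  proof
    have eps0: "\<epsilon> \<noteq> 0" using eps by auto
    have inv: "inv_into {1..n} w (w a) = a" if "a \<in> {1..n}" for a
      using that w by simp
    show "inj_on (\<lambda>v. w' (inv_into {1..n} w v)) (w ` {1..n})"
      by (rule inj_on_imageI, rule inj_on_cong[THEN iffD1, OF _ w'(1)]) (simp only: o_def inv)
    show "(\<lambda>v. w' (inv_into {1..n} w v)) ` w ` {1..n} \<inter> nodes Q = {}"
      unfolding image_image using w'(2) inv by fastforce
    show "inj_on (\<lambda>v. \<epsilon> * int (\<sigma> (inv_into {1..n} w v))) (w ` {1..n})"
      by (rule inj_on_imageI, rule inj_onI) (simp only: o_def inv, simp add: eps0 \<sigma>_eq)
    fix i v assume i: "i \<in> nodes Q" and "v \<in> w ` {1..n}"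
    then obtain b where b: "b \<in> {1..n}" "v = w b" by auto
    show "adj Q' i (w' (inv_into {1..n} w v)) = adj Q i v +
       (if i \<in> w ` {1..n} then (if \<epsilon> * int (\<sigma> (inv_into {1..n} w v)) < \<epsilon> * int (\<sigma> (inv_into {1..n} w i)) then \<epsilon> else 0) +
          (if i = v then k else 0) else 0)"
    proof (cases "i \<in> w ` {1..n}")
      case True
      then obtain a where a: "a \<in> {1..n}" "i = w a" by auto
      have "w a = w b \<longleftrightarrow> a = b" using a b w by (auto dest: inj_onD)
      thus ?thesis using True mixed[OF a(1) b(1)] by (simp only: a(2) b(2) inv[OF a(1)] inv[OF b(1)] if_True)
    next
      case False
      thus ?thesis using spec[of i b] i b inv by simp
    qed
    show "adj Q' (w' (inv_into {1..n} w v)) i = adj Q' i (w' (inv_into {1..n} w v))"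
      by (rule adj_sym) (use i b inv nodes' in auto)
  qed (use eps fin w sym old new split in \<open>auto simp: symmetric_quiver_def\<close>)
qed

locale splitting_growth =
  fixes \<epsilon> k :: int and n :: nat and \<kappa> :: series and w :: "nat \<Rightarrow> nat \<Rightarrow> 'v" and \<sigma> :: "nat \<Rightarrow> nat \<Rightarrow> nat"
    and Q :: "nat \<Rightarrow> 'v quiver"
  assumes eps: "\<epsilon> = 1 \<and> k = 0 \<or> \<epsilon> = -1 \<and> k = -1"
    and split: "\<And>i. i \<ge> 1 \<Longrightarrow> is_splitting k (2 * \<epsilon>) n \<kappa> (\<sigma> i) (\<lambda>_. 0) (Q i) (w i) (Q (Suc i)) (w (Suc i))"
    and sym: "symmetric_quiver (Q 1)" and fin: "finite (nodes (Q 1))"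
    and gpar_ord: "\<And>s. s \<in> nodes (Q 1) \<Longrightarrow> mps_ord_ge 1 (gpar (Q 1) s)"
    and \<kappa>: "mps_var 0 dvd \<kappa>"
begin

definition active :: "nat \<Rightarrow> 'v set" where
  "active i = w i ` {1..n}"

lemma active_subset: "i \<ge> 1 \<Longrightarrow> active i \<subseteq> nodes (Q i)"
  using split[of i] by (simp add: is_splitting_def active_def)

lemma nodes_Suc: "i \<ge> 1 \<Longrightarrow> nodes (Q (Suc i)) = nodes (Q i) \<union> active (Suc i)"
  using split[of i] by (simp add: is_splitting_def active_def)

lemma finite_nodes: "i \<ge> 1 \<Longrightarrow> finite (nodes (Q i))"
proof (induction i rule: dec_induct)
  case (step i)
  thus ?case by (simp add: nodes_Suc active_def)
qed (rule fin)

lemma symmetric: "i \<ge> 1 \<Longrightarrow> symmetric_quiver (Q i)"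
proof (induction i rule: dec_induct)
  case (step i)
  thus ?case using split[of i] by (simp add: is_splitting_def)
qed (rule sym)

lemma extends:
  assumes "i \<ge> 1" "i \<le> j"
  shows "nodes (Q i) \<subseteq> nodes (Q j) \<and> (\<forall>s\<in>nodes (Q i). gpar (Q j) s = gpar (Q i) s) \<and>
    (\<forall>s\<in>nodes (Q i). \<forall>t\<in>nodes (Q i). adj (Q j) s t = adj (Q i) s t)"
  using assms(2)
proof (induction j rule: dec_induct)
  case (step j)
  thus ?case using split[of j] nodes_Suc[of j] assms(1) by (auto simp: is_splitting_def subset_iff)
qed simp

lemma nodes_Union: "nodes (quiver_Union Q) = (\<Union>i\<in>{1..}. nodes (Q i))"
  by (simp add: quiver_Union_def)

lemma adj_Union:
  assumes "L \<ge> 1" "s \<in> nodes (Q L)" "t \<in> nodes (Q L)"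
  shows "adj (quiver_Union Q) s t = adj (Q L) s t"
proof -
  define i where "i = (LEAST i. i \<ge> 1 \<and> s \<in> nodes (Q i) \<and> t \<in> nodes (Q i))"
  have "i \<ge> 1 \<and> s \<in> nodes (Q i) \<and> t \<in> nodes (Q i)"
    unfolding i_def by (rule LeastI[of _ L]) (use assms in simp)
  moreover have "i \<le> L"
    unfolding i_def by (rule Least_le) (use assms in simp)
  ultimately have "adj (Q L) s t = adj (Q i) s t"
    using extends[of i L] by blast
  thus ?thesis by (simp add: quiver_Union_def i_def)
qed

lemma gpar_Union:
  assumes "L \<ge> 1" "s \<in> nodes (Q L)"
  shows "gpar (quiver_Union Q) s = gpar (Q L) s"
proof -
  define i where "i = (LEAST i. i \<ge> 1 \<and> s \<in> nodes (Q i))"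
  have "i \<ge> 1 \<and> s \<in> nodes (Q i)"
    unfolding i_def by (rule LeastI[of _ L]) (use assms in simp)
  moreover have "i \<le> L"
    unfolding i_def by (rule Least_le) (use assms in simp)
  ultimately have "gpar (Q L) s = gpar (Q i) s"
    using extends[of i L] by blast
  thus ?thesis by (simp add: quiver_Union_def i_def)
qed

lemma gpar_active:
  assumes "i \<ge> 1" "s \<in> active (Suc i)"
  obtains v where "v \<in> active i" "gpar (Q (Suc i)) s = \<kappa> * gpar (Q i) v"
proof -
  obtain a where a: "a \<in> {1..n}" "s = w (Suc i) a" using assms(2) by (auto simp: active_def)
  have "\<forall>a\<in>{1..n}. gpar (Q (Suc i)) (w (Suc i) a) = \<kappa> * gpar (Q i) (w i a)"
    using split[OF assms(1)] unfolding is_splitting_def by blast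
  thus thesis using a by (intro that[of "w i a"]) (auto simp: active_def)
qed

lemma gpar_Q_ord: "i \<ge> 1 \<Longrightarrow> s \<in> nodes (Q i) \<Longrightarrow> mps_ord_ge 1 (gpar (Q i) s)"
proof (induction i arbitrary: s rule: dec_induct)
  case (step i)
  consider "s \<in> nodes (Q i)" | "s \<in> active (Suc i)"
    using step.prems nodes_Suc[OF step.hyps(1)] by blast
  thus ?case
  proof cases
    case 1
    thus ?thesis using step extends[of i "Suc i"] by simp
  next
    case 2
    then obtain v where "v \<in> active i" "gpar (Q (Suc i)) s = \<kappa> * gpar (Q i) v"
      using gpar_active[OF step.hyps(1)] by blast
    thus ?thesis using step active_subset[of i] by (auto intro: mps_ord_ge_mult_left)
  qed
qed (rule gpar_ord)

lemma var_power_dvd_gpar: "s \<in> active (Suc i) \<Longrightarrow> mps_var 0 ^ i dvd gpar (Q (Suc i)) s"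
proof (induction i arbitrary: s)
  case (Suc i)
  then obtain v where "v \<in> active (Suc i)" "gpar (Q (Suc (Suc i))) s = \<kappa> * gpar (Q (Suc i)) v"
    using gpar_active[of "Suc i"] by auto
  thus ?case using Suc.IH[of v] \<kappa> by (simp add: mult_dvd_mono)
qed simp

text \<open>Such a node first appears in some Q (i' + 1) with i' > L, and each of the i' generations
  behind it contributed a factor \<kappa>. Hence each monomial meets only finitely many nodes of the
  infinite quiver.\<close>

lemma var_power_dvd_gpar_Union:
  assumes "s \<in> nodes (quiver_Union Q) - nodes (Q (Suc L))"
  shows "mps_var 0 ^ L dvd gpar (quiver_Union Q) s"
proof -
  obtain j where j: "j \<ge> 1" "s \<in> nodes (Q j)" using assms by (auto simp: nodes_Union)
  define i where "i = (LEAST i. i \<ge> 1 \<and> s \<in> nodes (Q i))"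
  have i: "i \<ge> 1" "s \<in> nodes (Q i)"
    unfolding i_def using LeastI[of "\<lambda>i. i \<ge> 1 \<and> s \<in> nodes (Q i)" j] j by auto
  have "i > Suc L"
    using i assms extends[of i "Suc L"] by (force simp: not_less[symmetric])
  then obtain i' where i': "i = Suc i'" "i' \<ge> Suc L" by (cases i) auto
  have "s \<notin> nodes (Q i')"
  proof
    assume "s \<in> nodes (Q i')"
    hence "i \<le> i'" unfolding i_def using i' by (intro Least_le) auto
    thus False using i' by simp
  qed
  hence "s \<in> active (Suc i')" using i i' nodes_Suc[of i'] by auto
  hence "mps_var 0 ^ i' dvd gpar (quiver_Union Q) s"
    using var_power_dvd_gpar gpar_Union[OF i] i' by simp
  moreover have "mps_var 0 ^ L dvd (mps_var 0 ^ i' :: series)"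
    using i' by (intro le_imp_power_dvd) simp
  ultimately show ?thesis by (rule dvd_trans[rotated])
qed

text \<open>The copies made in one step are the nodes split in the next, so the weight T g produced
  by \<open>sum_qterm_new\<close> is again a function of the active total; the induction therefore
  runs over all g.\<close>

lemma sum_qterm_Suc:
  "(\<Sum>f\<in>bounded_vecs (nodes (Q (Suc L))) K. qterm (nodes (Q (Suc L))) (Q (Suc L)) f * g (sum f (active (Suc L)))) =
   (\<Sum>f\<in>bounded_vecs (nodes (Q 1)) K. qterm (nodes (Q 1)) (Q 1) f * (split_op (qbase \<epsilon>) \<kappa> ^^ L) g (sum f (active 1)))"
proof (induction L arbitrary: g)
  case (Suc L)
  let ?i = "Suc L"
  let ?\<tau> = "\<lambda>v. w (Suc ?i) (inv_into {1..n} (w ?i) v)"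
  interpret node_splitting \<epsilon> k \<kappa> "\<lambda>v. \<epsilon> * int (\<sigma> ?i (inv_into {1..n} (w ?i) v))" ?\<tau>
    "nodes (Q ?i)" "active ?i" "Q ?i" "Q (Suc ?i)"
    unfolding active_def
    by (rule is_splitting_node_splitting[OF eps split symmetric finite_nodes]) simp_all
  have i1: "1 \<le> ?i" by simp
  have "inj_on (w ?i) {1..n}" using split[of ?i] by (simp add: is_splitting_def)
  hence img: "?\<tau> ` active ?i = active (Suc ?i)"
    by (simp add: active_def image_image)
  show ?case
    using sum_qterm_new[where K = K and g = g] Suc.IH[of "split_op (qbase \<epsilon>) \<kappa> g"]
    unfolding img nodes_Suc[OF i1]
    by (simp add: funpow_swap1)
qed simp

end

section \<open>Powers of x_0 and the extra node\<close>

lemma mps_var_power: "mps_var i ^ L = (mps_monom (Poly_Mapping.single i L) 1 :: ('a, 'b :: comm_ring_1) mps)"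
  by (induction L) (simp_all add: mps_var_def mps_monom_mult flip: single_add)

lemma mps_coeff_var_power_dvd:
  fixes f :: "('a, 'b :: comm_ring_1) mps"
  assumes "mps_var i ^ L dvd f" "Poly_Mapping.lookup e i < L"
  shows "mps_coeff f e = 0"
proof -
  obtain g where "f = mps_monom (Poly_Mapping.single i L) 1 * g"
    using assms(1) by (auto simp: mps_var_power elim!: dvdE)
  moreover have "e \<noteq> Poly_Mapping.single i L + b" for b
    using assms(2) by (auto simp: lookup_add)
  ultimately show ?thesis by (simp add: mps_coeff_monom_mult_eq_0)
qed

text \<open>The motivic series of the quiver consisting of the extra node alone, with diagonal entry
  c, as a function of its parameter.\<close>

definition extra_series :: "int \<Rightarrow> series \<Rightarrow> series" where
  "extra_series c = mps_powser (\<lambda>j. (- fls_X) powi (c * int j * int j) * inv_qfact j)"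

text \<open>The coupling enters the quadratic form twice and has the constant value \<epsilon> on V,
  so its effect is to rescale x by q^(2 \<epsilon> F) with F the total multiplicity on V.\<close>

lemma qterm_add_node:
  fixes Q :: "'v quiver" and c \<epsilon> :: int and x :: series
  assumes S: "finite S" "z \<notin> S" "V \<subseteq> S" and f: "f z = 0"
  defines "Q' \<equiv> add_node z c (\<lambda>s. if s \<in> V then \<epsilon> else 0) x Q"
  shows "qterm (insert z S) Q' (f(z := j)) = qterm S Q f *
    (mps_const ((- fls_X) powi (c * int j * int j) * inv_qfact j) *
      (mps_const (((fls_X\<^sup>2) powi \<epsilon>) ^ sum f V) * x) ^ j)"
proof -
  let ?f = "f(z := j)"
  have neq: "s \<noteq> z" if "s \<in> S" for s using that S by auto
  have cross: "(\<Sum>s\<in>S. (if s \<in> V then \<epsilon> else 0) * int (f s)) = \<epsilon> * int (sum f V)"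
  proof -
    have "(\<Sum>s\<in>S. (if s \<in> V then \<epsilon> else 0) * int (f s)) = (\<Sum>s\<in>V. (if s \<in> V then \<epsilon> else 0) * int (f s))"
      using S by (intro sum.mono_neutral_right) auto
    also have "\<dots> = (\<Sum>s\<in>V. \<epsilon> * int (f s))" by (intro sum.cong) auto
    finally show ?thesis by (simp add: sum_distrib_left)
  qed
  have "(\<Sum>t\<in>S. adj Q' z t * int (?f z) * int (?f t)) = (\<Sum>s\<in>S. (if s \<in> V then \<epsilon> else 0) * int (f s)) * int j"
    unfolding sum_distrib_right by (intro sum.cong refl) (use neq in \<open>auto simp: Q'_def add_node_def\<close>)
  hence 1: "(\<Sum>t\<in>S. adj Q' z t * int (?f z) * int (?f t)) = \<epsilon> * int (sum f V) * int j"
    by (simp only: cross)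
  have "(\<Sum>s\<in>S. adj Q' s z * int (?f s) * int (?f z)) = (\<Sum>s\<in>S. (if s \<in> V then \<epsilon> else 0) * int (f s)) * int j"
    unfolding sum_distrib_right by (intro sum.cong refl) (use neq in \<open>auto simp: Q'_def add_node_def\<close>)
  hence 2: "(\<Sum>s\<in>S. adj Q' s z * int (?f s) * int (?f z)) = \<epsilon> * int (sum f V) * int j"
    by (simp only: cross)
  have 3: "(\<Sum>s\<in>S. \<Sum>t\<in>S. adj Q' s t * int (?f s) * int (?f t)) = quad S Q f"
    unfolding quad_def by (intro sum.cong refl) (use neq in \<open>auto simp: Q'_def add_node_def\<close>)
  have "quad (insert z S) Q' ?f = quad S Q f + c * int j * int j + 2 * (\<epsilon> * int (sum f V * j))"
    unfolding quad_def[of "insert z S"] sum.insert[OF S(1,2)] sum.distrib 1 2 3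
    by (simp add: Q'_def add_node_def)
  moreover have "((- fls_X) powi (a + b + 2 * (\<epsilon> * int m)) :: rat fls) =
      (- fls_X) powi a * (- fls_X) powi b * ((fls_X\<^sup>2) powi \<epsilon>) ^ m" for a b m
  proof -
    have "(- fls_X) powi (2 * (\<epsilon> * int m)) = (((fls_X\<^sup>2) powi \<epsilon>) ^ m :: rat fls)"
      by (simp only: power_int_mult power_int_of_nat) (simp add: power_int_numeral)
    moreover have X: "- fls_X \<noteq> (0 :: rat fls)" by simp
    ultimately show ?thesis by (simp only: power_int_add[OF disjI1[OF X]])
  qed
  ultimately have pow: "((- fls_X) powi quad (insert z S) Q' ?f :: rat fls) =
      (- fls_X) powi quad S Q f * (- fls_X) powi (c * int j * int j) * (((fls_X\<^sup>2) powi \<epsilon>) ^ sum f V) ^ j"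
    by (simp only: power_mult)
  have prod: "(\<Prod>i\<in>insert z S. gpar Q' i ^ ?f i * mps_const (inv_qfact (?f i))) =
      x ^ j * mps_const (inv_qfact j) * (\<Prod>i\<in>S. gpar Q i ^ f i * mps_const (inv_qfact (f i)))"
  proof -
    have "(\<Prod>i\<in>S. gpar Q' i ^ ?f i * mps_const (inv_qfact (?f i))) =
        (\<Prod>i\<in>S. gpar Q i ^ f i * mps_const (inv_qfact (f i)))"
      by (intro prod.cong refl) (use neq in \<open>auto simp: Q'_def add_node_def\<close>)
    thus ?thesis using S by (simp add: Q'_def add_node_def)
  qed
  show ?thesis
    unfolding qterm_def pow prod
    by (simp only: mps_const_mult mps_const_power power_mult_distrib mult_ac)
qed

lemma sum_bounded_vecs_insert:
  assumes "finite S" "z \<notin> S"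
  shows "(\<Sum>f\<in>bounded_vecs (insert z S) K. h f) = (\<Sum>f\<in>bounded_vecs S K. \<Sum>j\<le>K - sum f S. h (f(z := j)))"
proof -
  have sum_upd: "(\<Sum>s\<in>S. if s = z then j else f s) = sum f S" for f :: "'a \<Rightarrow> nat" and j
    using assms by (intro sum.cong) auto
  have "(\<Sum>f\<in>bounded_vecs (insert z S) K. h f) = (\<Sum>(f, j)\<in>Sigma (bounded_vecs S K) (\<lambda>f. {..K - sum f S}). h (f(z := j)))"
    by (rule sum.reindex_bij_witness[where i = "\<lambda>(f, j). f(z := j)" and j = "\<lambda>f. (f(z := 0), f z)"])
      (use assms in \<open>auto simp: bounded_vecs_def fun_eq_iff sum_upd\<close>)
  thus ?thesis
    using finite_bounded_vecs[OF assms(1)] by (simp add: sum.Sigma)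
qed

lemma motivic_series_add_node_coeff:
  assumes S: "finite (nodes Q)" "z \<notin> nodes Q" "V \<subseteq> nodes Q"
    and ord: "\<And>s. s \<in> nodes Q \<Longrightarrow> mps_ord_ge 1 (gpar Q s)" and x: "mps_ord_ge 1 x"
    and K: "pm_deg e \<le> K"
  shows "mps_coeff (motivic_series (add_node z c (\<lambda>s. if s \<in> V then \<epsilon> else 0) x Q)) e =
    mps_coeff (\<Sum>f\<in>bounded_vecs (nodes Q) K. qterm (nodes Q) Q f *
      extra_series c (mps_const (((fls_X\<^sup>2) powi \<epsilon>) ^ sum f V) * x)) e"
proof -
  define Q' where "Q' = add_node z c (\<lambda>s. if s \<in> V then \<epsilon> else 0) x Q"
  let ?S = "nodes Q"
  have nodes': "nodes Q' = insert z ?S" by (simp add: Q'_def add_node_def)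
  let ?y = "\<lambda>f. mps_const (((fls_X\<^sup>2) powi \<epsilon>) ^ sum f V) * x"
  let ?\<alpha> = "\<lambda>j. (- fls_X) powi (c * int j * int j) * inv_qfact j"
  have "mps_coeff (motivic_series Q') e = mps_coeff (\<Sum>f\<in>bounded_vecs (insert z ?S) K. qterm (insert z ?S) Q' f) e"
  proof (rule motivic_series_coeff)
    show "mps_ord_ge 1 (gpar Q' s)" if "s \<in> nodes Q'" for s
      using that ord x by (auto simp: Q'_def add_node_def)
    show "\<exists>S. finite S \<and> (\<forall>s\<in>nodes Q' - S. \<forall>f. gpar Q' s dvd f \<longrightarrow> mps_coeff f e = 0)" for e
      using S by (intro exI[of _ "nodes Q'"]) (auto simp: nodes')
  qed (use S K in \<open>auto simp: nodes'\<close>)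
  also have "(\<Sum>f\<in>bounded_vecs (insert z ?S) K. qterm (insert z ?S) Q' f) =
      (\<Sum>f\<in>bounded_vecs ?S K. qterm ?S Q f * (\<Sum>j\<le>K - sum f ?S. mps_const (?\<alpha> j) * ?y f ^ j))"
    unfolding sum_bounded_vecs_insert[OF S(1,2)] sum_distrib_left
  proof (intro sum.cong refl)
    fix f j assume "f \<in> bounded_vecs ?S K"
    hence "f z = 0" using S by (auto simp: bounded_vecs_def)
    thus "qterm (insert z ?S) Q' (f(z := j)) = qterm ?S Q f * (mps_const (?\<alpha> j) * ?y f ^ j)"
      unfolding Q'_def by (rule qterm_add_node[OF S])
  qed
  also have "mps_coeff \<dots> e = mps_coeff (\<Sum>f\<in>bounded_vecs ?S K. qterm ?S Q f * extra_series c (?y f)) e"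
    unfolding mps_coeff_sum
  proof (rule sum.cong[OF refl])
    fix f assume f: "f \<in> bounded_vecs ?S K"
    \<comment> \<open>The term of f already has order \<open>sum f ?S\<close>, so completing the
      truncated sum over j to the full series changes only degrees above K.\<close>
    have "mps_ord_ge (sum f ?S + Suc (K - sum f ?S))
        (qterm ?S Q f * (extra_series c (?y f) - (\<Sum>j\<le>K - sum f ?S. mps_const (?\<alpha> j) * ?y f ^ j)))"
      unfolding extra_series_def
      by (intro mps_ord_ge_mult qterm_ord ord mps_powser_truncate mps_ord_ge_scale x)
    moreover have "sum f ?S + Suc (K - sum f ?S) = Suc K" using f by (simp add: bounded_vecs_def)
    ultimately show "mps_coeff (qterm ?S Q f * (\<Sum>j\<le>K - sum f ?S. mps_const (?\<alpha> j) * ?y f ^ j)) e =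
        mps_coeff (qterm ?S Q f * extra_series c (?y f)) e"
      using K by (simp add: mps_ord_ge_def right_diff_distrib)
  qed
  finally show ?thesis by (simp add: Q'_def)
qed

lemma mps_var_ord: "mps_ord_ge (Suc 0) (mps_var i)"
  unfolding mps_ord_ge_def mps_var_def mps_coeff_monom
  by (metis One_nat_def less_irrefl pm_deg_single)

context splitting_growth
begin

text \<open>Nodes outside Q (L + 1) have parameters divisible by x_0^L and cannot contribute to a
  monomial with a smaller exponent of x_0.\<close>

lemma motivic_series_Union_coeff:
  assumes "pm_deg e \<le> K" "Poly_Mapping.lookup e 0 < L"
  shows "mps_coeff (motivic_series (quiver_Union Q)) e =
    mps_coeff (\<Sum>f\<in>bounded_vecs (nodes (Q (Suc L))) K. qterm (nodes (Q (Suc L))) (Q (Suc L)) f) e"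
proof -
  have vanish: "mps_coeff f e = 0"
    if "s \<in> nodes (quiver_Union Q) - nodes (Q (Suc L))" "gpar (quiver_Union Q) s dvd f"
      "Poly_Mapping.lookup e 0 < L" for s f e L
    by (rule mps_coeff_var_power_dvd[OF dvd_trans[OF var_power_dvd_gpar_Union[OF that(1)] that(2)] that(3)])
  have "mps_coeff (motivic_series (quiver_Union Q)) e =
    mps_coeff (\<Sum>f\<in>bounded_vecs (nodes (Q (Suc L))) K. qterm (nodes (Q (Suc L))) (quiver_Union Q) f) e"
  proof (rule motivic_series_coeff)
    show "mps_ord_ge 1 (gpar (quiver_Union Q) s)" if s: "s \<in> nodes (quiver_Union Q)" for s
    proof -
      obtain i where "i \<ge> 1" "s \<in> nodes (Q i)" using s by (auto simp: nodes_Union)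
      thus ?thesis using gpar_Union gpar_Q_ord by simp
    qed
    show "\<exists>S. finite S \<and> (\<forall>s\<in>nodes (quiver_Union Q) - S. \<forall>f. gpar (quiver_Union Q) s dvd f \<longrightarrow> mps_coeff f e = 0)" for e
      using finite_nodes[of "Suc (Suc (Poly_Mapping.lookup e 0))"] vanish[of _ "Suc (Poly_Mapping.lookup e 0)"]
      by (intro exI[of _ "nodes (Q (Suc (Suc (Poly_Mapping.lookup e 0))))"]) auto
    show "nodes (Q (Suc L)) \<subseteq> nodes (quiver_Union Q)" by (auto simp: nodes_Union)
  qed (use assms vanish finite_nodes[of "Suc L"] in auto)
  also have "(\<Sum>f\<in>bounded_vecs (nodes (Q (Suc L))) K. qterm (nodes (Q (Suc L))) (quiver_Union Q) f) =
      (\<Sum>f\<in>bounded_vecs (nodes (Q (Suc L))) K. qterm (nodes (Q (Suc L))) (Q (Suc L)) f)"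
    by (intro sum.cong refl qterm_cong) (simp_all add: adj_Union gpar_Union)
  finally show ?thesis .
qed

lemma motivic_series_add_node:
  assumes z: "z \<notin> nodes (Q 1)"
    and A: "\<And>j. A j = extra_series c (mps_const (((fls_X\<^sup>2) powi \<epsilon>) ^ j) * mps_var 0)"
    and rec: "\<And>j. A j = (1 - qbase \<epsilon> ^ Suc j * \<kappa>) * A (Suc j)"
  shows "motivic_series (add_node z c (\<lambda>s. if s \<in> active 1 then \<epsilon> else 0) (mps_var 0) (Q 1)) =
    A 0 * motivic_series (quiver_Union Q)"
proof (rule mps_eqI)
  fix e :: "nat \<Rightarrow>\<^sub>0 nat"
  define K where "K = pm_deg e"
  \<comment> \<open>One more than the exponent of x_0 in e, so that multiples of x_0^L have
    coefficient 0 at e.\<close>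
  define L where "L = Suc (Poly_Mapping.lookup e 0)"
  define W where "W = (\<Sum>f\<in>bounded_vecs (nodes (Q (Suc L))) K. qterm (nodes (Q (Suc L))) (Q (Suc L)) f)"
  let ?T = "(split_op (qbase \<epsilon>) \<kappa> ^^ L) (\<lambda>_. 1)"
  have W: "W = (\<Sum>f\<in>bounded_vecs (nodes (Q 1)) K. qterm (nodes (Q 1)) (Q 1) f * ?T (sum f (active 1)))"
    unfolding W_def using sum_qterm_Suc[where L = L and K = K and g = "\<lambda>_. 1"] by simp
  let ?P = "\<Sum>f\<in>bounded_vecs (nodes (Q 1)) K. qterm (nodes (Q 1)) (Q 1) f * A (sum f (active 1))"
  have "?P - A 0 * W =
      (\<Sum>f\<in>bounded_vecs (nodes (Q 1)) K. qterm (nodes (Q 1)) (Q 1) f * (A (sum f (active 1)) - A 0 * ?T (sum f (active 1))))"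
    unfolding W by (simp add: sum_distrib_left sum_subtractf right_diff_distrib mult_ac)
  moreover have "mps_var 0 ^ L dvd \<dots>"
    by (intro dvd_sum dvd_mult split_op_funpow_converges split_op_fixed rec \<kappa>)
  ultimately have "mps_var 0 ^ L dvd ?P - A 0 * W"
    by (simp only:)
  hence "mps_coeff (?P - A 0 * W) e = 0"
    by (rule mps_coeff_var_power_dvd) (simp add: L_def)
  hence "mps_coeff ?P e = mps_coeff (A 0 * W) e" by simp
  \<comment> \<open>W is known to agree with the series of the union on the divisors of e, which is
    all that the coefficient of the product at e involves.\<close>
  also have "\<dots> = mps_coeff (A 0 * motivic_series (quiver_Union Q)) e"
    unfolding mps_coeff_times
  proof (intro sum.cong refl, clarify)
    fix a b assume ab: "e = a + b"
    have "mps_coeff (motivic_series (quiver_Union Q)) b = mps_coeff W b"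
      unfolding W_def by (rule motivic_series_Union_coeff) (simp_all add: K_def L_def ab lookup_add)
    thus "mps_coeff (A 0) a * mps_coeff W b = mps_coeff (A 0) a * mps_coeff (motivic_series (quiver_Union Q)) b"
      by simp
  qed
  finally show "mps_coeff (motivic_series (add_node z c (\<lambda>s. if s \<in> active 1 then \<epsilon> else 0) (mps_var 0) (Q 1))) e =
      mps_coeff (A 0 * motivic_series (quiver_Union Q)) e"
    using motivic_series_add_node_coeff[OF fin z active_subset[OF order_refl] gpar_ord
        mps_var_ord[of 0, folded One_nat_def], where e = e and K = K and c = c and \<epsilon> = \<epsilon>]
    by (simp add: A K_def)
qed

end

section \<open>Donaldson--Thomas series of the two quivers\<close>

lemma has_DT_series_monom:
  assumes d: "d \<noteq> 0" and c: "\<And>t. fls_nth c t = (if t = s then n else 0)"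
  shows "has_DT_series (euler_E (DT_monom d s) powi n) (mps_monom d c)"
  unfolding has_DT_series_iff
proof
  show "mps_coeff (mps_monom d c) 0 = 0" using d by (simp add: mps_coeff_monom)
  show "((\<lambda>F. \<Prod>x\<in>F. DT_factor (mps_monom d c) x) \<longlongrightarrow> euler_E (DT_monom d s) powi n) DT_filter"
  proof (rule tendsto_finite_subsets_eventually_const[of "{(d, s)}"])
    fix F assume F: "finite F" "{(d, s)} \<subseteq> F" "F \<subseteq> {(d, s). d \<noteq> (0 :: nat \<Rightarrow>\<^sub>0 nat)}"
    have factor: "DT_factor (mps_monom d c) (d', s') = (if (d', s') = (d, s) then euler_E (DT_monom d s) powi n else 1)"
      if "d' \<noteq> 0" for d' s'
      using that by (auto simp: DT_factor_eq mps_coeff_monom c)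
    have "(\<Prod>x\<in>F. DT_factor (mps_monom d c) x) = (\<Prod>x\<in>F. if x = (d, s) then euler_E (DT_monom d s) powi n else 1)"
    proof (intro prod.cong refl)
      fix x assume "x \<in> F"
      moreover obtain d' s' where "x = (d', s')" by fastforce
      ultimately show "DT_factor (mps_monom d c) x = (if x = (d, s) then euler_E (DT_monom d s) powi n else 1)"
        using factor[of d' s'] F by auto
    qed
    also have "\<dots> = euler_E (DT_monom d s) powi n" using F by simp
    finally show "(\<Prod>x\<in>F. DT_factor (mps_monom d c) x) = euler_E (DT_monom d s) powi n" .
  qed (use d in auto)
qed

lemma mps_int_coeffs_motivic_series:
  assumes S: "finite (nodes Q)" and gpar: "\<And>s. s \<in> nodes Q \<Longrightarrow> mps_ord_ge 1 (gpar Q s) \<and> mps_int_coeffs (gpar Q s)"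
  shows "mps_int_coeffs (motivic_series Q)" "mps_coeff (motivic_series Q) 0 = 1"
proof -
  have coeff: "mps_coeff (motivic_series Q) e = mps_coeff (\<Sum>f\<in>bounded_vecs (nodes Q) (pm_deg e). qterm (nodes Q) Q f) e" for e
    by (rule motivic_series_coeff) (use S gpar in auto)
  have "fls_int_coeffs ((- fls_X) powi m)" for m
    using fls_int_coeffs_X_powi[of m] fls_int_coeffs_uminus[OF fls_int_coeffs_X_powi[of m]]
    by (cases "even m") (simp_all add: power_int_minus_left_even power_int_minus_left_odd del: fls_X_power_int)
  hence "mps_int_coeffs (qterm (nodes Q) Q f)" for f
    unfolding qterm_def using gpar
    by (intro mps_int_coeffs_mult mps_int_coeffs_monom mps_int_coeffs_prod mps_int_coeffs_power inv_qfact_int_coeffs) auto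
  thus "mps_int_coeffs (motivic_series Q)"
    unfolding mps_int_coeffs_def coeff mps_coeff_sum by (auto intro: fls_int_coeffs_sum)
  have "bounded_vecs (nodes Q) 0 = {\<lambda>_. 0}"
    using S by (auto simp: bounded_vecs_def fun_eq_iff)
  thus "mps_coeff (motivic_series Q) 0 = 1"
    by (simp add: coeff qterm_def quad_def mps_coeff_one)
qed

text \<open>The product for - \<omega> is the inverse of A; multiplying P by it both recovers the
  series of Q and produces exponents for it, so existence for Q needs no argument of its
  own.\<close>

lemma DT_series_quotient:
  assumes P: "has_DT_series P \<Omega>" and A: "has_DT_series A \<omega>" and eq: "P = A * motivic_series Q"
  shows "DT_series Q = \<Omega> - \<omega>"
proof -
  obtain R where R: "has_DT_series R (- \<omega>)"
    using has_DT_series_ex[of "- \<omega>"] A by (auto simp: has_DT_series_def)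
  have "has_DT_series (A * R) 0"
    using has_DT_series_mult[OF A R] by simp
  hence "A * R = 1"
    using has_DT_series_unique_left has_DT_series_0 by blast
  moreover have "P * R = (A * R) * motivic_series Q"
    by (simp add: eq mult_ac)
  ultimately have "P * R = motivic_series Q" by simp
  moreover have "has_DT_series (P * R) (\<Omega> - \<omega>)"
    using has_DT_series_mult[OF P R] by simp
  ultimately show ?thesis
    by (intro DT_series_eqI) simp
qed

text \<open>The identities (-1)^(j^2) = (-1)^j and j^2 = j (j - 1) + j turn the diagonal entry 1
  into Euler's series E at q x; the entry 0 gives e directly.\<close>

lemma extra_series_eq:
  assumes x: "mps_ord_ge 1 x"
  shows "extra_series 1 x = euler_E (mps_const fls_X * x)" "extra_series 0 x = euler_e x"
proof -
  have "(- fls_X) powi (1 * int j * int j) * inv_qfact j =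
      (- 1) ^ j * fls_X ^ (j * (j - 1)) * inv_qfact j * fls_X ^ j" for j
  proof -
    have "j * j = j * (j - 1) + j" by (cases j) simp_all
    hence X: "fls_X ^ (j * j) = fls_X ^ (j * (j - 1)) * (fls_X ^ j :: rat fls)"
      by (simp only: power_add[symmetric])
    have "(- fls_X) powi (1 * int j * int j) = (- fls_X :: rat fls) ^ (j * j)"
      by (simp only: mult_1_left of_nat_mult[symmetric] power_int_of_nat)
    also have "\<dots> = (- 1) ^ (j * j) * fls_X ^ (j * j)" by (rule power_minus)
    also have "(- 1) ^ (j * j) = ((- 1) ^ j :: rat fls)" by (cases "even j") simp_all
    finally show ?thesis unfolding X by (simp only: mult_ac)
  qed
  thus "extra_series 1 x = euler_E (mps_const fls_X * x)"
    by (simp only: extra_series_def euler_E_def mps_powser_scale[symmetric])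
  show "extra_series 0 x = euler_e x" by (simp add: extra_series_def euler_e_def)
qed

theorem theorem3p10:
  fixes m n :: nat
    and k l c00 c0v :: int
    and \<kappa> :: series
    and \<omega>\<^sub>0 :: "(nat, int fls) mps"
    and v :: "nat \<Rightarrow> nat"
    and Q :: "nat \<Rightarrow> nat quiver"
  assumes parameters:
      "(k = 0 \<and> l = 2 \<and> c00 = 1 \<and> c0v = 1 \<and>
          \<kappa> = mps_const (inverse fls_X) * mps_var 0 \<and> \<omega>\<^sub>0 = mps_const fls_X * mps_var 0) \<or>
       (k = -1 \<and> l = -2 \<and> c00 = 0 \<and> c0v = -1 \<and>
          \<kappa> = mps_var 0 \<and> \<omega>\<^sub>0 = - mps_var 0)"
    and symmetric: "symmetric_quiver (Q 1)"
    and nodes_Q1: "nodes (Q 1) = {1..m}"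
    and gpar_Q1: "\<forall>i\<in>{1..m}. gpar (Q 1) i = mps_var i"
    and inj_v: "inj_on v {1..n}"
    and chosen: "v ` {1..n} \<subseteq> {1..m}"
    and grows: "grows_by_splitting k l n \<kappa> (\<lambda>_ _. 0) v Q"
  shows "DT_series (quiver_Union Q) =
    DT_series (add_node 0 c00 (\<lambda>s. if s \<in> v ` {1..n} then c0v else 0) (mps_var 0) (Q 1)) - \<omega>\<^sub>0"
proof -
  let ?Q' = "add_node 0 c00 (\<lambda>s. if s \<in> v ` {1..n} then c0v else 0) (mps_var 0) (Q 1)"
  obtain w \<sigma> where w: "w 1 = v"
    "\<And>i. i \<ge> 1 \<Longrightarrow> is_splitting k l n \<kappa> (\<sigma> i) (\<lambda>_. 0) (Q i) (w i) (Q (Suc i)) (w (Suc i))"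
    using grows by (auto simp: grows_by_splitting_def)
  \<comment> \<open>The coupling \<open>c0v\<close> of the extra node is the \<epsilon> of the
    general argument.\<close>
  have l: "l = 2 * c0v" using parameters by auto
  interpret splitting_growth c0v k n \<kappa> w \<sigma> Q
    by standard (use parameters symmetric nodes_Q1 gpar_Q1 w(2) in \<open>auto simp: l mps_var_ord\<close>)
  define A where "A = (\<lambda>j. extra_series c00 (mps_const (((fls_X\<^sup>2) powi c0v) ^ j) * mps_var 0))"
  let ?d = "Poly_Mapping.single 0 1 :: nat \<Rightarrow>\<^sub>0 nat"
  have d: "?d \<noteq> 0" by (metis pm_deg_0 pm_deg_single zero_neq_one)
  have "(\<forall>j. A j = (1 - qbase c0v ^ Suc j * \<kappa>) * A (Suc j)) \<and> has_DT_series (A 0) \<omega>\<^sub>0"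
    using parameters
  proof (elim disjE conjE)
    assume par: "c00 = 1" "c0v = 1" "\<kappa> = mps_const (inverse fls_X) * mps_var 0" "\<omega>\<^sub>0 = mps_const fls_X * mps_var 0"
    let ?y = "\<lambda>j. mps_const (fls_X * (fls_X\<^sup>2) ^ j) * mps_var 0 :: series"
    have A: "A j = euler_E (?y j)" for j
      unfolding A_def par by (subst extra_series_eq) 
        (simp_all add: mps_ord_ge_scale mps_var_ord mps_const_mult mult.assoc)
    have "A j = (1 - qbase c0v ^ Suc j * \<kappa>) * A (Suc j)" for j
    proof -
      have "euler_E (?y j) = (1 - ?y j) * euler_E (mps_const (fls_X\<^sup>2) * ?y j)"
        by (intro euler_E_rec mps_ord_ge_scale) (simp add: mps_var_ord)
      moreover have "mps_const (fls_X\<^sup>2) * ?y j = ?y (Suc j)"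
        by (simp add: mps_const_mult mult_ac)
      \<comment> \<open>The q^(-1) in \<kappa> is what makes P^(j+1) \<kappa> equal to the argument
        q P^j x_0 of E.\<close>
      moreover have "qbase c0v ^ Suc j * \<kappa> = ?y j"
      proof -
        have "fls_X * (fls_X\<^sup>2) ^ j = ((fls_X\<^sup>2) ^ Suc j * inverse fls_X :: rat fls)"
        proof -
          have "fls_X * inverse fls_X = (1 :: rat fls)" by (rule right_inverse) simp
          hence "y * (fls_X * fls_X) * inverse fls_X = y * fls_X" for y :: "rat fls"
            by (simp only: mult.assoc mult_1_right)
          from this[of "(fls_X * fls_X) ^ j"] show ?thesis
            by (simp only: power_Suc2 power2_eq_square mult.commute[of fls_X "(fls_X * fls_X) ^ j"])
        qed
        thus ?thesis unfolding par
          by (simp only: mps_const_power[symmetric] mps_const_mult mult.assoc power_int_1_right)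
      qed
      ultimately show ?thesis unfolding A by (simp only:)
    qed
    moreover have "has_DT_series (A 0) \<omega>\<^sub>0"
    proof -
      \<comment> \<open>A(0) = (q x_0;q^2)_\<infinity> is a single factor of the infinite product,
        with exponent 1.\<close>
      have "?y 0 = DT_monom ?d 1"
        by (simp add: DT_monom_def mps_var_def mps_monom_mult)
      moreover have "\<omega>\<^sub>0 = mps_monom ?d fls_X"
        by (simp add: par mps_var_def mps_monom_mult)
      ultimately show ?thesis
        using has_DT_series_monom[OF d, of "fls_X" 1 1] by (simp add: A)
    qed
    ultimately show ?thesis by blast
  next
    assume par: "c00 = 0" "c0v = -1" "\<kappa> = mps_var 0" "\<omega>\<^sub>0 = - mps_var 0"
    let ?p = "(fls_X\<^sup>2) powi - 1 :: rat fls"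
    let ?y = "\<lambda>j. mps_const (?p ^ j) * mps_var 0 :: series"
    have A: "A j = euler_e (?y j)" for j
      unfolding A_def par by (subst extra_series_eq) (simp_all add: mps_ord_ge_scale mps_var_ord)
    have "A j = (1 - qbase c0v ^ Suc j * \<kappa>) * A (Suc j)" for j
    proof -
      \<comment> \<open>Here P = q^(-2), so the recursion of e is taken at P^(j+1) x_0, where
        multiplication by q^2 leads back from j + 1 to j.\<close>
      have "euler_e (mps_const (fls_X\<^sup>2) * ?y (Suc j)) = (1 - ?y (Suc j)) * euler_e (?y (Suc j))"
        by (intro euler_e_rec mps_ord_ge_scale) (simp add: mps_var_ord)
      moreover have "mps_const (fls_X\<^sup>2) * ?y (Suc j) = ?y j"
      proof -
        have "fls_X\<^sup>2 * ?p = 1"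
          by (simp only: power_int_minus power_int_1_right) (rule right_inverse, simp)
        hence "fls_X\<^sup>2 * ?p ^ Suc j = ?p ^ j"
          by (simp only: power_Suc mult.assoc[symmetric] mult_1_left)
        thus ?thesis by (simp only: mult.assoc[symmetric] mps_const_mult[symmetric])
      qed
      ultimately show ?thesis unfolding A par by (simp only: mps_const_power)
    qed
    moreover have "has_DT_series (A 0) \<omega>\<^sub>0"
    proof -
      \<comment> \<open>A(0) is the inverse of (x_0;q^2)_\<infinity>, a single factor with exponent
        -1; hence the sign of \<open>\<omega>\<^sub>0\<close>.\<close>
      have "A 0 = euler_E (DT_monom ?d 0) powi - 1"
        using mps_inverse_unique[OF euler_DT_monom[OF d, of 0]]
        by (simp add: A power_int_def DT_monom_def mps_var_def)
      moreover have "\<omega>\<^sub>0 = mps_monom ?d (- 1)"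
        by (rule mps_eqI) (simp add: par mps_var_def mps_coeff_monom)
      ultimately show ?thesis
        using has_DT_series_monom[OF d, of "- 1" 0 "- 1"] by simp
    qed
    ultimately show ?thesis by blast
  qed
  hence rec: "\<And>j. A j = (1 - qbase c0v ^ Suc j * \<kappa>) * A (Suc j)" and A0: "has_DT_series (A 0) \<omega>\<^sub>0"
    by blast+
  have P: "motivic_series ?Q' = A 0 * motivic_series (quiver_Union Q)"
    using motivic_series_add_node[of 0 A c00, OF _ _ rec] nodes_Q1 by (simp add: A_def active_def w(1)[simplified])
  have "mps_int_coeffs (mps_var i)" for i
    by (simp add: mps_var_def mps_int_coeffs_monom)
  \<comment> \<open>Integrality is invoked for Q_1^+ only: it provides the exponents \<Omega> from
    which those of Q_\<infinity> follow by subtraction.\<close>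
  hence "mps_int_coeffs (motivic_series ?Q')" "mps_coeff (motivic_series ?Q') 0 = 1"
    using nodes_Q1 gpar_Q1
    by (auto intro!: mps_int_coeffs_motivic_series simp: add_node_def mps_var_ord)
  then obtain \<Omega> where \<Omega>: "has_DT_series (motivic_series ?Q') \<Omega>"
    using has_DT_series_of_int_coeffs by blast
  show ?thesis
    unfolding DT_series_quotient[OF \<Omega> A0 P] DT_series_eqI[OF \<Omega>] ..
qed

end
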